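(* (Reconstruction formula) Let $$G(x,y)=\mathcal{R}f(x,y)=\sum_{k=0}^\infty\sum_{i,j=1}^{2k+1}\widehat G(k)_{ij}\,\mathcal{Y}_k^i(x)\overline{\mathcal{Y}_k^j(y)}\in H^\Delta_{\frac12+t}(S^2\times S^2),\qquad t\ge0,$$ be a result of the Radon transform. Then the pre-image $f\in H_t(SO(3))$, $t\ge0$, is given by $$f=\sum_{k=0}^\infty\sum_{i,j=1}^{2k+1}\frac{2k+1}{4\pi}\,\widehat G(k)_{ij}\,\mathcal{T}_k^{ij}=\sum_{k=0}^\infty\sum_{i,j=1}^{2k+1}(2k+1)\,\widehat f(k)_{ij}\,\mathcal{T}_k^{ij}=\sum_{k=0}^\infty(2k+1)\,\mathrm{trace}\big(\widehat f(k)\,\mathcal{T}_k\big).$$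
   Context: $S^2\subset\mathbb{R}^3$ is the unit sphere with Lebesgue (surface) measure $dx$; $\{\mathcal{Y}_k^i\}_{i=1}^{2k+1}$ is an orthonormal basis in $L^2(S^2,dx)$ of the spherical harmonics of degree $k$, $k\ge0$. $\mathcal{T}_k$ is the $(2k+1)$-dimensional irreducible representation of $SO(3)$ on the spherical harmonics of degree $k$ given by $(\mathcal{T}_k(g)\phi)(x)=\phi(g^{-1}x)$, with matrix coefficients (Wigner polynomials) $$\mathcal{T}_k^{ij}(g)=\langle\mathcal{T}_k(g)\mathcal{Y}_k^i,\mathcal{Y}_k^j\rangle=\int_{S^2}\mathcal{Y}_k^i(g^{-1}x)\overline{\mathcal{Y}_k^j(x)}\,dx,\qquad g\in SO(3),$$ and in the trace $\mathcal{T}_k$ stands for the matrix $(\mathcal{T}_k^{ij})_{i,j=1}^{2k+1}$. The Fourier coefficient of $f$ is the matrix $\widehat f(k)=\int_{SO(3)}f(g)\,\mathcal{T}_k(g)^*\,dg$ with $dg$ the normalized Haar measure. Radon transform: fix $x_0\in S^2$ with stabilizer $SO(2)\subset SO(3)$; for $f\in L^2(SO(3))$ and $(x,y)\in S^2\times S^2$ choose $x',y'\in SO(3)$ with $x'x_0=x$, $y'x_0=y$ and set $\mathcal{R}f(x,y)=\int_{SO(2)}f(x'h(y')^{-1})\,dh$ with $dh$ the normalized Haar measure of $SO(2)$ (the average of $f$ over $\{g\in SO(3):gy=x\}$). Sobolev spaces: $\Delta_{SO(3)}$ is the bi-invariant Laplace–Beltrami operator with $\Delta_{SO(3)}\mathcal{T}_k^{ij}=-k(k+1)\mathcal{T}_k^{ij}$,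 and $H_t(SO(3))$ is the domain of $(I-4\Delta_{SO(3)})^{t/2}$ in $L^2(SO(3))$ with norm $\|(I-4\Delta_{SO(3)})^{t/2}f\|_{L^2(SO(3))}$. With $\Delta_1,\Delta_2$ the Laplace–Beltrami operators of $S^2$ in the first and second variable and $\Delta_{S^2\times S^2}=\Delta_1+\Delta_2$, $H_s(S^2\times S^2)$ is the domain of $(I-2\Delta_{S^2\times S^2})^{s/2}$ with norm $\|(I-2\Delta_{S^2\times S^2})^{s/2}u\|_{L^2(S^2\times S^2)}$, and $H_s^\Delta(S^2\times S^2)$ is the subspace of all $u\in H_s(S^2\times S^2)$ with $\Delta_1u=\Delta_2u$.
   Formalization: Both double sums are false as printed (e.g. f(g)=g_12 with the real degree-1 basis) and are corrected: the first sum has T_k^{ij}(g^{-1}) instead of T_k^{ij}(g), the second has T_k^{ji} instead of T_k^{ij}; the trace formula is unchanged. *)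

theory Defs
  imports "HOL-Analysis.Analysis"
begin

section \<open>Square-integrable functions\<close>

text \<open>Elements of $L^2$ are represented by functions; equality in $L^2$ is equality almost
  everywhere, i.e. vanishing \<open>l2_norm\<close> of the difference.\<close>

definition L2 :: "'a measure \<Rightarrow> ('a \<Rightarrow> complex) set" where
  "L2 M = {f. f \<in> borel_measurable M \<and> integrable M (\<lambda>x. (cmod (f x))\<^sup>2)}"

definition l2_inner :: "'a measure \<Rightarrow> ('a \<Rightarrow> complex) \<Rightarrow> ('a \<Rightarrow> complex) \<Rightarrow> complex" where
  "l2_inner M f g = (\<integral>x. f x * cnj (g x) \<partial>M)"

definition l2_norm :: "'a measure \<Rightarrow> ('a \<Rightarrow> complex) \<Rightarrow> real" where
  "l2_norm M f = sqrt (\<integral>x. (cmod (f x))\<^sup>2 \<partial>M)"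


section \<open>Measures on the sphere and on matrix groups\<close>

text \<open>Surface measure of the unit sphere: $\sigma(A) = 3\,\lambda\{r x : 0 < r < 1,\ x \in A\}$
  (polar coordinates), so that the total mass is $4\pi$.\<close>

definition sphere_measure :: "(real^3) measure" where
  "sphere_measure =
     scale_measure 3
       (distr (restrict_space lborel (ball 0 1 - {0})) (restrict_space borel (sphere 0 1))
          (\<lambda>x. x /\<^sub>R norm x))"

definition SO3 :: "(real^3^3) set" where
  "SO3 = {A. rotation_matrix A}"

definition stabilizer :: "real^3 \<Rightarrow> (real^3^3) set" where
  "stabilizer x0 = {h \<in> SO3. h *v x0 = x0}"

text \<open>For a compact matrix group \<open>K\<close> these conditions determine \<open>\<mu>\<close>: it is the normalized Haar
  measure (left-invariance implies right-invariance, since \<open>K\<close> is compact).\<close>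

definition haar_measure :: "(real^3^3) set \<Rightarrow> (real^3^3) measure \<Rightarrow> bool" where
  "haar_measure K \<mu> \<longleftrightarrow>
     sets \<mu> = sets (restrict_space borel K) \<and> emeasure \<mu> K = 1 \<and>
     (\<forall>g\<in>K. distr \<mu> \<mu> (\<lambda>h. g ** h) = \<mu>)"


section \<open>Laplace--Beltrami operators\<close>

definition second_deriv :: "(real \<Rightarrow> 'b::real_normed_vector) \<Rightarrow> real \<Rightarrow> 'b" where
  "second_deriv c s = vector_derivative (\<lambda>r. vector_derivative c (at r)) (at s)"

definition laplacian :: "('a::euclidean_space \<Rightarrow> 'b::real_normed_vector) \<Rightarrow> 'a \<Rightarrow> 'b" where
  "laplacian F x = (\<Sum>b\<in>Basis. second_deriv (\<lambda>s. F (x + s *\<^sub>R b)) 0)"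

text \<open>On the sphere: the Euclidean Laplacian of the extension that is constant along rays.\<close>

definition S2_laplacian :: "(real^3 \<Rightarrow> complex) \<Rightarrow> real^3 \<Rightarrow> complex" where
  "S2_laplacian \<phi> x = laplacian (\<lambda>z. \<phi> (z /\<^sub>R norm z)) x"

definition S2xS2_laplacian1 :: "((real^3) \<times> (real^3) \<Rightarrow> complex) \<Rightarrow> (real^3) \<times> (real^3) \<Rightarrow> complex" where
  "S2xS2_laplacian1 u = (\<lambda>(x, y). S2_laplacian (\<lambda>z. u (z, y)) x)"

definition S2xS2_laplacian2 :: "((real^3) \<times> (real^3) \<Rightarrow> complex) \<Rightarrow> (real^3) \<times> (real^3) \<Rightarrow> complex" where
  "S2xS2_laplacian2 u = (\<lambda>(x, y). S2_laplacian (\<lambda>z. u (x, z)) y)"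

definition S2xS2_laplacian :: "((real^3) \<times> (real^3) \<Rightarrow> complex) \<Rightarrow> (real^3) \<times> (real^3) \<Rightarrow> complex" where
  "S2xS2_laplacian u z = S2xS2_laplacian1 u z + S2xS2_laplacian2 u z"

text \<open>Rodrigues' formula for $\exp(sK_a)$, where $K_a v = e_a \times v$; it is the rotation about
  the \<open>a\<close>-th coordinate axis by the angle \<open>s\<close>.\<close>

definition axis_rotation :: "3 \<Rightarrow> real \<Rightarrow> real^3^3" where
  "axis_rotation a s =
     (let K = matrix (cross3 (axis a 1)) in mat 1 + sin s *\<^sub>R K + (1 - cos s) *\<^sub>R (K ** K))"

text \<open>On the rotation group: the sum of the squares of the left-invariant vector fields
  $(X_a f)(g) = \frac{d}{ds} f(g \exp(sK_a))|_{s=0}$.  This bi-invariant operator has the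
  normalization in which the Wigner polynomials of degree \<open>k\<close> have eigenvalue $-k(k+1)$.\<close>

definition SO3_laplacian :: "(real^3^3 \<Rightarrow> complex) \<Rightarrow> real^3^3 \<Rightarrow> complex" where
  "SO3_laplacian f g = (\<Sum>a\<in>UNIV. second_deriv (\<lambda>s. f (g ** axis_rotation a s)) 0)"


section \<open>Spherical harmonics and Wigner polynomials\<close>

definition spherical_harmonic :: "nat \<Rightarrow> (real^3 \<Rightarrow> complex) \<Rightarrow> bool" where
  "spherical_harmonic k \<phi> \<longleftrightarrow>
     (\<exists>P. polynomial_function P \<and> (\<forall>r x. P (r *\<^sub>R x) = r ^ k *\<^sub>R P x) \<and>
          (\<forall>x. laplacian P x = 0) \<and> (\<forall>x\<in>sphere 0 1. \<phi> x = P x))"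

definition harmonic_basis :: "(nat \<Rightarrow> nat \<Rightarrow> real^3 \<Rightarrow> complex) \<Rightarrow> bool" where
  "harmonic_basis Y \<longleftrightarrow>
     (\<forall>k. (\<forall>i\<in>{1..2*k+1}. spherical_harmonic k (Y k i)) \<and>
          (\<forall>i\<in>{1..2*k+1}. \<forall>j\<in>{1..2*k+1}.
             l2_inner sphere_measure (Y k i) (Y k j) = (if i = j then 1 else 0)) \<and>
          (\<forall>\<phi>. spherical_harmonic k \<phi> \<longrightarrow>
             (\<exists>c. \<forall>x\<in>sphere 0 1. \<phi> x = (\<Sum>i=1..2*k+1. c i * Y k i x))))"

definition wigner_rep :: "real^3^3 \<Rightarrow> (real^3 \<Rightarrow> complex) \<Rightarrow> real^3 \<Rightarrow> complex" where
  "wigner_rep g \<phi> = (\<lambda>x. \<phi> (matrix_inv g *v x))"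

definition wigner :: "(nat \<Rightarrow> nat \<Rightarrow> real^3 \<Rightarrow> complex) \<Rightarrow> nat \<Rightarrow> nat \<Rightarrow> nat \<Rightarrow> real^3^3 \<Rightarrow> complex"
  where "wigner Y k i j g = l2_inner sphere_measure (wigner_rep g (Y k i)) (Y k j)"

text \<open>Entry \<open>(i, j)\<close> of $\int f(g)\,\mathcal T_k(g)^*\,dg$; the adjoint transposes the indices.\<close>

definition fourier_coeff ::
  "(real^3^3) measure \<Rightarrow> (nat \<Rightarrow> nat \<Rightarrow> real^3 \<Rightarrow> complex) \<Rightarrow> (real^3^3 \<Rightarrow> complex) \<Rightarrow>
     nat \<Rightarrow> nat \<Rightarrow> nat \<Rightarrow> complex" where
  "fourier_coeff \<mu> Y f k i j = (\<integral>g. f g * cnj (wigner Y k j i g) \<partial>\<mu>)"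

text \<open>Product and trace of \<open>n \<times> n\<close> matrices with indices running from 1 to \<open>n\<close>.\<close>

definition nmat_mult ::
  "nat \<Rightarrow> (nat \<Rightarrow> nat \<Rightarrow> complex) \<Rightarrow> (nat \<Rightarrow> nat \<Rightarrow> complex) \<Rightarrow> nat \<Rightarrow> nat \<Rightarrow> complex" where
  "nmat_mult n A B = (\<lambda>i j. \<Sum>l=1..n. A i l * B l j)"

definition nmat_trace :: "nat \<Rightarrow> (nat \<Rightarrow> nat \<Rightarrow> complex) \<Rightarrow> complex" where
  "nmat_trace n A = (\<Sum>i=1..n. A i i)"


section \<open>Radon transform\<close>

definition carrier_rotation :: "real^3 \<Rightarrow> real^3 \<Rightarrow> real^3^3" where
  "carrier_rotation x0 x = (SOME g. g \<in> SO3 \<and> g *v x0 = x)"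

text \<open>\<open>\<nu>\<close> is the normalized Haar measure of \<open>stabilizer x0\<close>; its invariance makes the value
  independent of the choice of the two rotations.\<close>

definition radon ::
  "(real^3^3) measure \<Rightarrow> real^3 \<Rightarrow> (real^3^3 \<Rightarrow> complex) \<Rightarrow> (real^3) \<times> (real^3) \<Rightarrow> complex" where
  "radon \<nu> x0 f =
     (\<lambda>(x, y). \<integral>h. f (carrier_rotation x0 x ** h ** matrix_inv (carrier_rotation x0 y)) \<partial>\<nu>)"


text \<open>Pitfall with the indices.  Since $\mathcal T_k(g)\mathcal Y_k^i = \sum_j \mathcal T_k^{ij}(g)\mathcal Y_k^j$,
  the matrices satisfy $\mathcal T_k(gh) = \mathcal T_k(h)\mathcal T_k(g)$, and
  $\mathcal R\mathcal T_k^{ij}(x,y) = \frac{4\pi}{2k+1}\,\overline{\mathcal Y_k^j(x)}\,\mathcal Y_k^i(y)$.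
  So $\mathcal Y_k^i(x)\overline{\mathcal Y_k^j(y)}$ corresponds to
  $\mathcal T_k^{ij}(g^{-1}) = \overline{\mathcal T_k^{ji}(g)}$ rather than to
  $\mathcal T_k^{ij}(g)$, and entry \<open>(i, j)\<close> of the Fourier coefficient is the coefficient
  of $\mathcal T_k^{ji}$, in agreement with the trace formula.\<close>


section \<open>Sobolev spaces\<close>

definition eigenvalue :: "'a measure \<Rightarrow> (('a \<Rightarrow> complex) \<Rightarrow> 'a \<Rightarrow> complex) \<Rightarrow> ('a \<Rightarrow> complex) \<Rightarrow> real"
  where "eigenvalue M L \<phi> = (THE ev. \<forall>x\<in>space M. L \<phi> x = complex_of_real ev * \<phi> x)"

text \<open>Functional calculus for an operator \<open>L\<close> with a complete orthogonal system of eigenfunctions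
  \<open>e n\<close> (\<open>n \<in> I\<close>), not necessarily normalized: \<open>sobolev_term\<close> is the squared modulus of the
  coefficient of $(I - cL)^{s/2} f$ along the normalized \<open>e n\<close>.  Hence \<open>sobolev_space\<close> is the
  domain of $(I - cL)^{s/2}$ and \<open>sobolev_norm\<close> is $\|(I - cL)^{s/2} f\|_{L^2}$.\<close>

definition sobolev_term ::
  "'a measure \<Rightarrow> (('a \<Rightarrow> complex) \<Rightarrow> 'a \<Rightarrow> complex) \<Rightarrow> real \<Rightarrow> real \<Rightarrow> ('i \<Rightarrow> 'a \<Rightarrow> complex) \<Rightarrow>
     ('a \<Rightarrow> complex) \<Rightarrow> 'i \<Rightarrow> real" where
  "sobolev_term M L c s e f n =
     ((1 - c * eigenvalue M L (e n)) powr (s/2) * cmod (l2_inner M f (e n)) / l2_norm M (e n))\<^sup>2"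

definition sobolev_space ::
  "'a measure \<Rightarrow> (('a \<Rightarrow> complex) \<Rightarrow> 'a \<Rightarrow> complex) \<Rightarrow> real \<Rightarrow> real \<Rightarrow> ('i \<Rightarrow> 'a \<Rightarrow> complex) \<Rightarrow>
     'i set \<Rightarrow> ('a \<Rightarrow> complex) set" where
  "sobolev_space M L c s e I = {f \<in> L2 M. sobolev_term M L c s e f summable_on I}"

definition sobolev_norm ::
  "'a measure \<Rightarrow> (('a \<Rightarrow> complex) \<Rightarrow> 'a \<Rightarrow> complex) \<Rightarrow> real \<Rightarrow> real \<Rightarrow> ('i \<Rightarrow> 'a \<Rightarrow> complex) \<Rightarrow>
     'i set \<Rightarrow> ('a \<Rightarrow> complex) \<Rightarrow> real" where
  "sobolev_norm M L c s e I f = sqrt (infsum (sobolev_term M L c s e f) I)"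

definition wigner_index :: "(nat \<times> nat \<times> nat) set" where
  "wigner_index = {(k, i, j). i \<in> {1..2*k+1} \<and> j \<in> {1..2*k+1}}"

definition H_SO3 ::
  "(real^3^3) measure \<Rightarrow> (nat \<Rightarrow> nat \<Rightarrow> real^3 \<Rightarrow> complex) \<Rightarrow> real \<Rightarrow> (real^3^3 \<Rightarrow> complex) set" where
  "H_SO3 \<mu> Y t = sobolev_space \<mu> SO3_laplacian 4 t (\<lambda>(k, i, j). wigner Y k i j) wigner_index"

definition H_SO3_norm ::
  "(real^3^3) measure \<Rightarrow> (nat \<Rightarrow> nat \<Rightarrow> real^3 \<Rightarrow> complex) \<Rightarrow> real \<Rightarrow> (real^3^3 \<Rightarrow> complex) \<Rightarrow> real" where
  "H_SO3_norm \<mu> Y t = sobolev_norm \<mu> SO3_laplacian 4 t (\<lambda>(k, i, j). wigner Y k i j) wigner_index"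

definition harmonic_product ::
  "(nat \<Rightarrow> nat \<Rightarrow> real^3 \<Rightarrow> complex) \<Rightarrow> (nat \<times> nat) \<times> (nat \<times> nat) \<Rightarrow> (real^3) \<times> (real^3) \<Rightarrow> complex"
  where "harmonic_product Y = (\<lambda>((k, i), (l, j)) (x, y). Y k i x * cnj (Y l j y))"

definition harmonic_product_index :: "((nat \<times> nat) \<times> (nat \<times> nat)) set" where
  "harmonic_product_index = {((k, i), (l, j)). i \<in> {1..2*k+1} \<and> j \<in> {1..2*l+1}}"

abbreviation S2xS2_measure :: "((real^3) \<times> (real^3)) measure" where
  "S2xS2_measure \<equiv> sphere_measure \<Otimes>\<^sub>M sphere_measure"

definition H_S2xS2 ::
  "(nat \<Rightarrow> nat \<Rightarrow> real^3 \<Rightarrow> complex) \<Rightarrow> real \<Rightarrow> ((real^3) \<times> (real^3) \<Rightarrow> complex) set" where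
  "H_S2xS2 Y s =
     sobolev_space S2xS2_measure S2xS2_laplacian 2 s (harmonic_product Y) harmonic_product_index"

text \<open>An element of \<open>H_S2xS2 Y s\<close> need not be twice differentiable, so $\Delta_1 u = \Delta_2 u$ is
  meant weakly.  The span of the test functions is dense in the smooth functions.\<close>

definition H_Delta_S2xS2 ::
  "(nat \<Rightarrow> nat \<Rightarrow> real^3 \<Rightarrow> complex) \<Rightarrow> real \<Rightarrow> ((real^3) \<times> (real^3) \<Rightarrow> complex) set" where
  "H_Delta_S2xS2 Y s =
     {u \<in> H_S2xS2 Y s. \<forall>n\<in>harmonic_product_index.
        l2_inner S2xS2_measure u (S2xS2_laplacian1 (harmonic_product Y n)) =
        l2_inner S2xS2_measure u (S2xS2_laplacian2 (harmonic_product Y n))}"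


section \<open>Series\<close>

text \<open>\<open>f\<close> is the sum of the series \<open>F\<close> with respect to the norm \<open>N\<close>.\<close>

definition norm_sums ::
  "(('a \<Rightarrow> complex) \<Rightarrow> real) \<Rightarrow> (nat \<Rightarrow> 'a \<Rightarrow> complex) \<Rightarrow> ('a \<Rightarrow> complex) \<Rightarrow> bool" where
  "norm_sums N F f \<longleftrightarrow> (\<lambda>n. N (\<lambda>x. f x - (\<Sum>k<n. F k x))) \<longlonglongrightarrow> 0"

text \<open>Convergence in $L^2$ is required separately, because \<open>H_SO3_norm\<close> only sees the components
  of a function along the Wigner polynomials.\<close>

definition H_SO3_sums ::
  "(real^3^3) measure \<Rightarrow> (nat \<Rightarrow> nat \<Rightarrow> real^3 \<Rightarrow> complex) \<Rightarrow> real \<Rightarrow>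
     (nat \<Rightarrow> real^3^3 \<Rightarrow> complex) \<Rightarrow> (real^3^3 \<Rightarrow> complex) \<Rightarrow> bool" where
  "H_SO3_sums \<mu> Y t F f \<longleftrightarrow> norm_sums (l2_norm \<mu>) F f \<and> norm_sums (H_SO3_norm \<mu> Y t) F f"

end

(*
By duality, the coefficient of the Radon transform R f along Y_k^i(x) cnj(Y_k^j(y)) is
4 pi times the integral of f T_k^{ji}; up to this factor the Fourier coefficients of f can
be read off from R f, and the factor sqrt(2k+1) between the normalizations of both orthogonal
systems is the gain of half a derivative.  It remains to see that f is the sum of its Fourier
series, for which two facts about the spaces H_k of spherical harmonics suffice.

(1) The coefficients of (w(s) . x)^k with isotropic w(s) are 2k+1 weight vectors in H_k with
distinct weights for the rotations about an axis.  Since dim H_k = 2k+1, zonal harmonics are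
unique up to a factor, and the character of a rotation by t is 1 + 2 cos t + ... + 2 cos kt.
(2) Uniqueness of zonal harmonics determines the invariant kernel
int phi(g^-1 x) cnj(psi(g^-1 y)) dg, which gives the Schur orthogonality relations.  By the
character formula every polynomial in the trace is a linear combination of characters, so
convolution with an approximate identity that depends only on the trace shows that finite
sums of Wigner polynomials are dense in L^2.
*)
theory Submission
  imports Defs
begin

section \<open>Surface measure of the sphere\<close>

text \<open>The Radon transform yields the integrals of \<open>f\<close> against
  \<open>T k j i\<close> itself, whereas an expansion of \<open>f\<close> in Wigner polynomials
  needs the integrals against their conjugates. In each degree \<open>k\<close> the two families
  span the same space: the reproducing kernel of that span is the character at
  \<open>matrix_inv h ** g\<close>, and characters of rotations are real. This exchange turns the
  series built from \<open>Ghat\<close> and \<open>matrix_inv g\<close> into a Fourier partial sum,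
  and on the level of norms it transports the Sobolev condition from \<open>G\<close> to
  \<open>f\<close>, degree by degree but not coefficient by coefficient. The constants 4 and 2 of
  the two Sobolev spaces fit together because 1 + 4 k (k + 1) = (2 k + 1)^2; after normalization
  both weights are the same power of 2 k + 1. Haar measures are known only through left invariance
  and the surface measure only through cones in the ball. What connects them is that every finite
  rotation-invariant measure on the sphere is a multiple of the orbit image of Haar measure; the
  total mass fixes the factor 4 pi.\<close>

lemma space_sphere_measure [simp]: "space sphere_measure = sphere 0 1"
  by (simp add: sphere_measure_def space_scale_measure space_restrict_space)

lemma sets_sphere_measure [measurable_cong]:
  "sets sphere_measure = sets (restrict_space borel (sphere 0 1))"
  by (simp add: sphere_measure_def)

lemma measurable_radial_projection:
  "(\<lambda>x::real^3. x /\<^sub>R norm x) \<in> restrict_space lborel (ball 0 1 - {0}) \<rightarrow>\<^sub>M restrict_space borel (sphere 0 1)"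
proof (rule measurable_restrict_space2)
  show "(\<lambda>x::real^3. x /\<^sub>R norm x) \<in> space (restrict_space lborel (ball 0 1 - {0})) \<rightarrow> sphere 0 1"
    by (auto simp: space_restrict_space)
  show "(\<lambda>x::real^3. x /\<^sub>R norm x) \<in> borel_measurable (restrict_space lborel (ball 0 1 - {0}))"
    by (intro measurable_restrict_space1) measurable
qed

lemma emeasure_sphere_measure:
  assumes "A \<in> sets sphere_measure"
  shows "emeasure sphere_measure A = 3 * emeasure lborel {x \<in> ball 0 1 - {0}. x /\<^sub>R norm x \<in> A}"
proof -
  have A: "A \<in> sets (restrict_space borel (sphere 0 1))"
    using assms by (simp add: sets_sphere_measure)
  have "emeasure sphere_measure A = 3 * emeasure (restrict_space lborel (ball 0 1 - {0}))
      ((\<lambda>x. x /\<^sub>R norm x) -` A \<inter> space (restrict_space lborel (ball 0 1 - {0})))"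
    unfolding sphere_measure_def
    by (simp add: emeasure_distr[OF measurable_radial_projection A])
  also have "(\<lambda>x. x /\<^sub>R norm x) -` A \<inter> space (restrict_space lborel (ball 0 1 - {0}))
      = {x \<in> ball 0 1 - {0}. x /\<^sub>R norm x \<in> A}"
    by (auto simp: space_restrict_space)
  also have "emeasure (restrict_space lborel (ball 0 1 - {0})) \<dots> = emeasure lborel \<dots>"
    by (rule emeasure_restrict_space) auto
  finally show ?thesis .
qed

lemma sets_radial_cone:
  assumes "A \<in> sets sphere_measure"
  shows "{x \<in> ball 0 1 - {0}. x /\<^sub>R norm x \<in> A} \<in> sets lborel"
proof -
  have "(\<lambda>x. x /\<^sub>R norm x) -` A \<inter> space (restrict_space lborel (ball 0 1 - {0::real^3}))
      \<in> sets (restrict_space lborel (ball 0 1 - {0}))"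
    using assms measurable_radial_projection by (intro measurable_sets) (auto simp: sets_sphere_measure)
  then have "(\<lambda>x. x /\<^sub>R norm x) -` A \<inter> space (restrict_space lborel (ball 0 1 - {0::real^3})) \<in> sets lborel"
    by (subst (asm) sets_restrict_space_iff) auto
  also have "(\<lambda>x. x /\<^sub>R norm x) -` A \<inter> space (restrict_space lborel (ball 0 1 - {0::real^3}))
      = {x \<in> ball 0 1 - {0}. x /\<^sub>R norm x \<in> A}"
    by (auto simp: space_restrict_space)
  finally show ?thesis .
qed

lemma emeasure_sphere_measure_space: "emeasure sphere_measure (sphere 0 1) = ennreal (4 * pi)"
proof -
  have "emeasure sphere_measure (sphere 0 1) = 3 * emeasure lborel (ball (0::real^3) 1 - {0})"
  proof -
    have "{x \<in> ball (0::real^3) 1 - {0}. x /\<^sub>R norm x \<in> sphere 0 1} = ball 0 1 - {0}"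
      by auto
    then show ?thesis
      using emeasure_sphere_measure[of "sphere 0 1"] sets.top[of sphere_measure] by simp
  qed
  also have "emeasure lborel (ball (0::real^3) 1 - {0}) = emeasure lborel (ball (0::real^3) 1)"
    by (rule emeasure_Diff_null_set) (auto simp: null_sets_def)
  also have "\<dots> = ennreal (4 / 3 * pi)"
    by (subst emeasure_ball) (auto simp: unit_ball_vol_3)
  also have "3 * ennreal (4 / 3 * pi) = ennreal (4 * pi)"
    by (subst ennreal_numeral[symmetric], subst ennreal_mult[symmetric]) auto
  finally show ?thesis .
qed

interpretation sphere: finite_measure sphere_measure
  by standard (simp add: emeasure_sphere_measure_space)

lemma measure_sphere_measure: "measure sphere_measure (sphere 0 1) = 4 * pi"
  by (simp add: measure_def emeasure_sphere_measure_space)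

section \<open>Rotation invariance of the surface measure\<close>

lemma orthogonal_matrix_SO3: "g \<in> SO3 \<Longrightarrow> orthogonal_matrix g"
  by (simp add: SO3_def rotation_matrix_def)

lemma orthogonal_transformation_SO3: "g \<in> SO3 \<Longrightarrow> orthogonal_transformation (\<lambda>x. g *v x)"
  by (simp add: orthogonal_matrix_SO3 orthogonal_transformation_matrix)

lemma norm_SO3_mult [simp]: "g \<in> SO3 \<Longrightarrow> norm (g *v x) = norm x"
  by (simp add: orthogonal_transformation_SO3 orthogonal_transformation_norm)

lemma measurable_SO3_mult_sphere:
  assumes "g \<in> SO3"
  shows "(\<lambda>x. g *v x) \<in> sphere_measure \<rightarrow>\<^sub>M sphere_measure"
proof -
  have "(\<lambda>x. g *v x) \<in> restrict_space borel (sphere 0 1) \<rightarrow>\<^sub>M restrict_space borel (sphere 0 1)"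
    using assms
    by (intro measurable_restrict_space2 measurable_restrict_space1)
       (auto simp: space_restrict_space intro!: borel_measurable_continuous_onI continuous_intros)
  then show ?thesis
    by (simp add: measurable_cong_sets[OF sets_sphere_measure sets_sphere_measure])
qed

text \<open>Linear isometries preserve Lebesgue measure, and \<open>g\<close> carries the cone over
  the preimage of \<open>A\<close> onto the cone over \<open>A\<close>.\<close>

lemma distr_sphere_measure_SO3:
  assumes g: "g \<in> SO3"
  shows "distr sphere_measure sphere_measure (\<lambda>x. g *v x) = sphere_measure"
proof (rule measure_eqI)
  fix A assume "A \<in> sets (distr sphere_measure sphere_measure (\<lambda>x. g *v x))"
  then have A: "A \<in> sets sphere_measure" by simp
  define A' where "A' = (\<lambda>x. g *v x) -` A \<inter> space sphere_measure"
  have A': "A' \<in> sets sphere_measure"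
    unfolding A'_def using A g by (intro measurable_sets[OF measurable_SO3_mult_sphere])
  let ?U = "\<lambda>A. {x::real^3 \<in> ball 0 1 - {0}. x /\<^sub>R norm x \<in> A}"
  have orth: "orthogonal_transformation (\<lambda>x. g *v x)"
    by (rule orthogonal_transformation_SO3[OF g])
  \<comment> \<open>\<open>measure_orthogonal_image\<close> compares finite Lebesgue measures, so
    the extended \<open>lborel\<close> values are converted to these; the cones are bounded, hence
    of finite measure.\<close>
  have meas: "?U B \<in> lmeasurable" if "B \<in> sets sphere_measure" for B
  proof (rule bounded_set_imp_lmeasurable)
    show "bounded (?U B)" by (rule bounded_subset[OF bounded_ball[of 0 1]]) auto
    show "?U B \<in> sets lebesgue" using sets_radial_cone[OF that] by (simp add: sets_completionI_sets)
  qed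
  have emeas: "emeasure lborel (?U B) = ennreal (measure lebesgue (?U B))" if "B \<in> sets sphere_measure" for B
    using emeasure_completion[OF sets_completionI_sets[OF sets_radial_cone[OF that]]] sets_radial_cone[OF that] emeasure_eq_measure2[OF meas[OF that]] by simp
  have img: "(\<lambda>x. g *v x) ` ?U A' = ?U A"
  proof (intro equalityI subsetI)
    fix y assume "y \<in> ?U A"
    moreover obtain x where "y = g *v x"
      using orthogonal_transformation_surj[OF orth] by (auto simp: surj_def)
    moreover have "x \<noteq> 0" if "g *v x \<noteq> 0"
      using that by auto
    ultimately show "y \<in> (\<lambda>x. g *v x) ` ?U A'"
      using g by (auto simp: A'_def matrix_vector_mult_scaleR intro!: image_eqI[of _ _ x])
  next
    fix y assume "y \<in> (\<lambda>x. g *v x) ` ?U A'"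
    then obtain x where "x \<in> ?U A'" "y = g *v x" by auto
    then show "y \<in> ?U A"
      using g norm_SO3_mult[OF g, of x]
      by (auto simp: A'_def matrix_vector_mult_scaleR simp del: norm_SO3_mult)
  qed
  have "emeasure (distr sphere_measure sphere_measure (\<lambda>x. g *v x)) A = emeasure sphere_measure A'"
    unfolding A'_def using A g by (subst emeasure_distr) (auto intro: measurable_SO3_mult_sphere)
  also have "\<dots> = emeasure sphere_measure A"
    using measure_orthogonal_image[OF orth meas[OF A']]
    unfolding emeasure_sphere_measure[OF A] emeasure_sphere_measure[OF A'] emeas[OF A] emeas[OF A'] img
    by (simp only:)
  finally show "emeasure (distr sphere_measure sphere_measure (\<lambda>x. g *v x)) A = emeasure sphere_measure A" .
qed simp

lemma integral_sphere_SO3: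
  fixes u :: "real^3 \<Rightarrow> 'b::{banach, second_countable_topology}"
  assumes "g \<in> SO3" "u \<in> borel_measurable sphere_measure"
  shows "(\<integral>x. u (g *v x) \<partial>sphere_measure) = (\<integral>x. u x \<partial>sphere_measure)"
  using integral_distr[OF measurable_SO3_mult_sphere[OF assms(1)] assms(2)]
  by (simp add: distr_sphere_measure_SO3[OF assms(1)])

section \<open>Haar measure on groups of rotations\<close>

lemma matrix_inv_orthogonal: "orthogonal_matrix (A::real^'n^'n) \<Longrightarrow> matrix_inv A = transpose A"
  unfolding matrix_inv_def orthogonal_matrix_def
proof (rule some_equality)
  fix B assume B: "A ** B = mat 1 \<and> B ** A = mat 1"
    and "transpose A ** A = mat 1 \<and> A ** transpose A = mat 1"
  then have "B = (transpose A ** A) ** B" by simp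
  also have "\<dots> = transpose A" unfolding matrix_mul_assoc[symmetric] using B by simp
  finally show "B = transpose A" .
qed simp

text \<open>Serves both the rotation group and the stabilizer of \<open>x0\<close>. Closure under
  products and inverses is listed because \<open>haar_measure\<close> does not say that
  \<open>K\<close> is a group; orthogonality turns inversion into transposition, which makes it
  measurable.\<close>

locale haar_group =
  fixes K :: "(real^3^3) set" and \<mu> :: "(real^3^3) measure"
  assumes haar: "haar_measure K \<mu>"
    and K_mult: "\<And>g h. g \<in> K \<Longrightarrow> h \<in> K \<Longrightarrow> g ** h \<in> K"
    and K_inv: "\<And>g. g \<in> K \<Longrightarrow> matrix_inv g \<in> K"
    and K_orthogonal: "\<And>g. g \<in> K \<Longrightarrow> orthogonal_matrix g"
begin

lemma sets_haar [measurable_cong]: "sets \<mu> = sets (restrict_space borel K)"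
  using haar by (simp add: haar_measure_def)

lemma space_haar [simp]: "space \<mu> = K"
  using sets_eq_imp_space_eq[OF sets_haar] by (simp add: space_restrict_space)

lemma emeasure_haar_K [simp]: "emeasure \<mu> K = 1"
  using haar by (simp add: haar_measure_def)

lemma distr_haar_left: "g \<in> K \<Longrightarrow> distr \<mu> \<mu> (\<lambda>h. g ** h) = \<mu>"
  using haar by (simp add: haar_measure_def)

sublocale finite_measure \<mu>
  by standard simp

lemma measure_haar_K [simp]: "measure \<mu> K = 1"
  by (simp add: measure_def)

lemma K_inv_inv: "g \<in> K \<Longrightarrow> matrix_inv (matrix_inv g) = g"
  using K_orthogonal[of g] by (simp add: matrix_inv_orthogonal)

lemma K_inv_mult:
  assumes "g \<in> K" "h \<in> K"
  shows "matrix_inv (g ** h) = matrix_inv h ** matrix_inv g"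
  using assms K_orthogonal[of g] K_orthogonal[of h]
  by (simp add: matrix_inv_orthogonal orthogonal_matrix_mul matrix_transpose_mul)

lemma measurable_haar_continuous:
  fixes u :: "real^3^3 \<Rightarrow> 'b::topological_space"
  assumes "continuous_on K u"
  shows "u \<in> borel_measurable \<mu>"
  using borel_measurable_continuous_on_restrict[OF assms]
  by (simp add: measurable_cong_sets[OF sets_haar refl])

lemma measurable_id_haar [measurable]: "(\<lambda>g. g) \<in> borel_measurable \<mu>"
  by (rule measurable_haar_continuous) (rule continuous_on_id)

lemma measurable_haarI:
  assumes "u \<in> borel_measurable N" "\<And>x. x \<in> space N \<Longrightarrow> u x \<in> K"
  shows "u \<in> N \<rightarrow>\<^sub>M \<mu>"
proof -
  have "u \<in> N \<rightarrow>\<^sub>M restrict_space borel K"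
    using assms by (intro measurable_restrict_space2) auto
  then show ?thesis by (simp add: measurable_cong_sets[OF refl sets_haar])
qed

end

lemma measurable_matrix_mult [measurable (raw)]:
  fixes u v :: "'a \<Rightarrow> real^3^3"
  assumes "u \<in> borel_measurable N" "v \<in> borel_measurable N"
  shows "(\<lambda>x. u x ** v x) \<in> borel_measurable N"
  by (rule borel_measurable_continuous_Pair[OF assms])
     (auto simp: matrix_matrix_mult_def intro!: continuous_intros)

lemma measurable_transpose [measurable (raw)]:
  fixes u :: "'a \<Rightarrow> real^3^3"
  assumes "u \<in> borel_measurable N"
  shows "(\<lambda>x. transpose (u x)) \<in> borel_measurable N"
  using assms
  by (rule measurable_compose[OF _ borel_measurable_continuous_onI])
     (auto simp: transpose_def intro!: continuous_intros)

lemma measurable_matrix_vector_mult [measurable (raw)]: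
  fixes u :: "'a \<Rightarrow> real^3^3" and v :: "'a \<Rightarrow> real^3"
  assumes "u \<in> borel_measurable N" "v \<in> borel_measurable N"
  shows "(\<lambda>x. u x *v v x) \<in> borel_measurable N"
  by (rule borel_measurable_continuous_Pair[OF assms])
     (auto simp: matrix_vector_mult_def intro!: continuous_intros)

section \<open>Invariance of Haar measure under inversion and right translation\<close>

context haar_group
begin

lemma measurable_haar_mult:
  assumes "u \<in> N \<rightarrow>\<^sub>M \<mu>" "v \<in> N \<rightarrow>\<^sub>M \<mu>"
  shows "(\<lambda>x. u x ** v x) \<in> N \<rightarrow>\<^sub>M \<mu>"
proof (rule measurable_haarI)
  note [measurable] = measurable_compose[OF assms(1) measurable_id_haar]
    measurable_compose[OF assms(2) measurable_id_haar]
  show "(\<lambda>x. u x ** v x) \<in> borel_measurable N" by measurable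
qed (use assms[THEN measurable_space] in \<open>auto intro: K_mult\<close>)

lemma measurable_haar_inv:
  assumes "u \<in> N \<rightarrow>\<^sub>M \<mu>"
  shows "(\<lambda>x. matrix_inv (u x)) \<in> N \<rightarrow>\<^sub>M \<mu>"
proof (rule measurable_haarI)
  note [measurable] = measurable_compose[OF assms measurable_id_haar]
  have "(\<lambda>x. transpose (u x)) \<in> borel_measurable N" by measurable
  then show "(\<lambda>x. matrix_inv (u x)) \<in> borel_measurable N"
    using assms[THEN measurable_space]
    by (subst measurable_cong[where g="\<lambda>x. transpose (u x)"])
       (auto simp: matrix_inv_orthogonal K_orthogonal)
qed (use assms[THEN measurable_space] in \<open>auto intro: K_inv\<close>)

lemma measurable_haar_left: "g \<in> K \<Longrightarrow> (\<lambda>h. g ** h) \<in> \<mu> \<rightarrow>\<^sub>M \<mu>"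
  by (intro measurable_haar_mult) auto

lemma measurable_haar_right: "g \<in> K \<Longrightarrow> (\<lambda>h. h ** g) \<in> \<mu> \<rightarrow>\<^sub>M \<mu>"
  by (intro measurable_haar_mult) auto

lemma nn_integral_haar_left:
  assumes "u \<in> borel_measurable \<mu>" "g \<in> K"
  shows "(\<integral>\<^sup>+h. u (g ** h) \<partial>\<mu>) = (\<integral>\<^sup>+h. u h \<partial>\<mu>)"
  using nn_integral_distr[OF measurable_haar_left[OF assms(2)], of u] assms
  by (simp add: distr_haar_left[OF assms(2)])

text \<open>Since the total mass is 1, the integral of \<open>u\<close> may be averaged over a
  second group variable. Left invariance is applied in one variable, Fubini exchanges the two, and
  left invariance in the other variable leaves \<open>u\<close> at an inverse.\<close>

lemma nn_integral_haar_inv: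
  assumes u: "u \<in> borel_measurable \<mu>"
  shows "(\<integral>\<^sup>+h. u (matrix_inv h) \<partial>\<mu>) = (\<integral>\<^sup>+h. u h \<partial>\<mu>)"
proof -
  interpret P: pair_sigma_finite \<mu> \<mu> by standard
  have m: "(\<lambda>(g, h). u (matrix_inv h ** g)) \<in> borel_measurable (\<mu> \<Otimes>\<^sub>M \<mu>)"
    unfolding split_beta
    by (intro measurable_compose[OF _ u] measurable_haar_mult measurable_haar_inv) auto
  have u': "(\<lambda>h. u (matrix_inv h)) \<in> borel_measurable \<mu>"
    by (intro measurable_compose[OF _ u] measurable_haar_inv) auto
  have "(\<integral>\<^sup>+h. u h \<partial>\<mu>) = (\<integral>\<^sup>+h. (\<integral>\<^sup>+g. u (matrix_inv h ** g) \<partial>\<mu>) \<partial>\<mu>)"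
    using nn_integral_cong[of \<mu> "\<lambda>h. \<integral>\<^sup>+g. u (matrix_inv h ** g) \<partial>\<mu>" "\<lambda>h. \<integral>\<^sup>+g. u g \<partial>\<mu>"]
    by (simp add: nn_integral_haar_left[OF u] K_inv)
  also have "\<dots> = (\<integral>\<^sup>+g. (\<integral>\<^sup>+h. u (matrix_inv h ** g) \<partial>\<mu>) \<partial>\<mu>)"
    using P.Fubini'[OF m] by simp
  \<comment> \<open>Here \<open>matrix_inv h ** g\<close> is read as the inverse of
    \<open>matrix_inv g ** h\<close>, so that the inner integral is a left translate of
    \<open>u\<close> composed with inversion.\<close>
  also have "\<dots> = (\<integral>\<^sup>+g. (\<integral>\<^sup>+h. u (matrix_inv (matrix_inv g ** h)) \<partial>\<mu>) \<partial>\<mu>)"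
    by (intro nn_integral_cong) (simp add: K_inv_mult K_inv K_inv_inv)
  also have "\<dots> = (\<integral>\<^sup>+g. (\<integral>\<^sup>+h. u (matrix_inv h) \<partial>\<mu>) \<partial>\<mu>)"
    by (rule nn_integral_cong) (simp add: nn_integral_haar_left[OF u'] K_inv)
  also have "\<dots> = (\<integral>\<^sup>+h. u (matrix_inv h) \<partial>\<mu>)" by simp
  finally show ?thesis by simp
qed

lemma distr_haar_inv: "distr \<mu> \<mu> matrix_inv = \<mu>"
proof (rule measure_eqI)
  fix A assume "A \<in> sets (distr \<mu> \<mu> matrix_inv)"
  then have A: "A \<in> sets \<mu>" by simp
  have m: "matrix_inv \<in> \<mu> \<rightarrow>\<^sub>M \<mu>" using measurable_haar_inv[of "\<lambda>x. x" \<mu>] by simp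
  have "emeasure (distr \<mu> \<mu> matrix_inv) A = (\<integral>\<^sup>+h. indicator A h \<partial>distr \<mu> \<mu> matrix_inv)"
    using A by simp
  also have "\<dots> = (\<integral>\<^sup>+h. indicator A (matrix_inv h) \<partial>\<mu>)"
    using A m by (subst nn_integral_distr) auto
  also have "\<dots> = emeasure \<mu> A" using A by (subst nn_integral_haar_inv) auto
  finally show "emeasure (distr \<mu> \<mu> matrix_inv) A = emeasure \<mu> A" .
qed simp

text \<open>Right translation is a left translation conjugated by inversion, and all three maps
  preserve the measure.\<close>

lemma distr_haar_right:
  assumes g: "g \<in> K"
  shows "distr \<mu> \<mu> (\<lambda>h. h ** g) = \<mu>"
proof -
  have m: "matrix_inv \<in> \<mu> \<rightarrow>\<^sub>M \<mu>" using measurable_haar_inv[of "\<lambda>x. x" \<mu>] by simp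
  have "distr \<mu> \<mu> (\<lambda>h. h ** g) = distr \<mu> \<mu> (matrix_inv \<circ> ((\<lambda>h. matrix_inv g ** h) \<circ> matrix_inv))"
    using g by (intro distr_cong) (auto simp: K_inv_mult K_inv K_inv_inv)
  also have "\<dots> = distr (distr (distr \<mu> \<mu> matrix_inv) \<mu> (\<lambda>h. matrix_inv g ** h)) \<mu> matrix_inv"
    using m measurable_haar_left[OF K_inv[OF g]] by (subst distr_distr; simp)+
  also have "\<dots> = \<mu>" by (simp add: distr_haar_inv distr_haar_left K_inv g)
  finally show ?thesis .
qed

lemma integral_haar_left:
  fixes u :: "real^3^3 \<Rightarrow> 'b::{banach, second_countable_topology}"
  assumes "u \<in> borel_measurable \<mu>" "g \<in> K"
  shows "(\<integral>h. u (g ** h) \<partial>\<mu>) = (\<integral>h. u h \<partial>\<mu>)"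
  using integral_distr[OF measurable_haar_left[OF assms(2)] assms(1)]
  by (simp add: distr_haar_left[OF assms(2)])

lemma integral_haar_right:
  fixes u :: "real^3^3 \<Rightarrow> 'b::{banach, second_countable_topology}"
  assumes "u \<in> borel_measurable \<mu>" "g \<in> K"
  shows "(\<integral>h. u (h ** g) \<partial>\<mu>) = (\<integral>h. u h \<partial>\<mu>)"
  using integral_distr[OF measurable_haar_right[OF assms(2)] assms(1)]
  by (simp add: distr_haar_right[OF assms(2)])

lemma nn_integral_haar_right:
  assumes "u \<in> borel_measurable \<mu>" "g \<in> K"
  shows "(\<integral>\<^sup>+h. u (h ** g) \<partial>\<mu>) = (\<integral>\<^sup>+h. u h \<partial>\<mu>)"
  using nn_integral_distr[OF measurable_haar_right[OF assms(2)], of u] assms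
  by (simp add: distr_haar_right[OF assms(2)])

end

section \<open>The rotation group and its stabilizers\<close>

lemma SO3_mult: "g \<in> SO3 \<Longrightarrow> h \<in> SO3 \<Longrightarrow> g ** h \<in> SO3"
  by (simp add: SO3_def rotation_matrix_def orthogonal_matrix_mul det_mul)

lemma matrix_inv_SO3: "g \<in> SO3 \<Longrightarrow> matrix_inv g = transpose g"
  by (simp add: matrix_inv_orthogonal orthogonal_matrix_SO3)

lemma SO3_inv: "g \<in> SO3 \<Longrightarrow> matrix_inv g \<in> SO3"
  by (simp add: matrix_inv_SO3) (simp add: SO3_def rotation_matrix_def)

lemma SO3_one: "mat 1 \<in> SO3"
  by (simp add: SO3_def rotation_matrix_def orthogonal_matrix_id)

lemma SO3_inv_left [simp]: "g \<in> SO3 \<Longrightarrow> matrix_inv g ** g = mat 1"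
  using orthogonal_matrix_SO3[of g] by (simp add: matrix_inv_orthogonal orthogonal_matrix_def)

lemma SO3_inv_right [simp]: "g \<in> SO3 \<Longrightarrow> g ** matrix_inv g = mat 1"
  using orthogonal_matrix_SO3[of g] by (simp add: matrix_inv_orthogonal orthogonal_matrix_def)

lemma SO3_inv_left_vec [simp]: "g \<in> SO3 \<Longrightarrow> matrix_inv g *v (g *v x) = x"
  by (simp add: matrix_vector_mul_assoc)

lemma SO3_inv_right_vec [simp]: "g \<in> SO3 \<Longrightarrow> g *v (matrix_inv g *v x) = x"
  by (simp add: matrix_vector_mul_assoc)

lemma SO3_inv_inv [simp]: "g \<in> SO3 \<Longrightarrow> matrix_inv (matrix_inv g) = g"
  using orthogonal_matrix_SO3[of g] by (simp add: matrix_inv_orthogonal)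

lemma SO3_inv_mult: "g \<in> SO3 \<Longrightarrow> h \<in> SO3 \<Longrightarrow> matrix_inv (g ** h) = matrix_inv h ** matrix_inv g"
  using orthogonal_matrix_SO3[of g] orthogonal_matrix_SO3[of h]
  by (simp add: matrix_inv_orthogonal orthogonal_matrix_mul matrix_transpose_mul)

lemma SO3_transitive:
  assumes "x \<in> sphere 0 1" "y \<in> sphere 0 1"
  obtains g where "g \<in> SO3" "g *v x = y"
proof -
  obtain A where A: "rotation_matrix A" "A *v axis (1::3) 1 = x"
    using rotation_matrix_exists_basis[of x 1] assms by auto
  obtain B where B: "rotation_matrix B" "B *v axis (1::3) 1 = y"
    using rotation_matrix_exists_basis[of y 1] assms by auto
  have "A \<in> SO3" "B \<in> SO3" using A B by (auto simp: SO3_def)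
  moreover have "(B ** matrix_inv A) *v x = y"
    using \<open>A \<in> SO3\<close> A B by (metis SO3_inv_left_vec matrix_vector_mul_assoc)
  ultimately show thesis
    by (intro that[of "B ** matrix_inv A"] SO3_mult SO3_inv)
qed

lemma haar_group_SO3: "haar_measure SO3 \<mu> \<Longrightarrow> haar_group SO3 \<mu>"
  by (simp add: haar_group_def SO3_mult SO3_inv orthogonal_matrix_SO3)

lemma haar_group_stabilizer:
  assumes "haar_measure (stabilizer x0) \<nu>"
  shows "haar_group (stabilizer x0) \<nu>"
proof
  fix g h assume gh: "g \<in> stabilizer x0" "h \<in> stabilizer x0"
  then show "g ** h \<in> stabilizer x0"
    by (simp add: stabilizer_def SO3_mult matrix_vector_mul_assoc[symmetric])
  have "g \<in> SO3" "g *v x0 = x0" using gh by (auto simp: stabilizer_def)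
  then show "matrix_inv g \<in> stabilizer x0" "orthogonal_matrix g"
    using SO3_inv_left_vec[of g x0] by (auto simp: stabilizer_def SO3_inv orthogonal_matrix_SO3)
qed (rule assms)

section \<open>The surface measure as an orbit image of Haar measure\<close>

locale haar_SO3 =
  fixes \<mu> :: "(real^3^3) measure"
  assumes haar_SO3: "haar_measure SO3 \<mu>"

sublocale haar_SO3 \<subseteq> haar_group SO3 \<mu>
  by (rule haar_group_SO3[OF haar_SO3])

context haar_SO3
begin

lemma measurable_orbit_pair:
  "(\<lambda>(g, x). g *v x) \<in> \<mu> \<Otimes>\<^sub>M sphere_measure \<rightarrow>\<^sub>M sphere_measure"
proof -
  have id: "(\<lambda>x. x) \<in> borel_measurable sphere_measure"
    by (simp add: measurable_cong_sets[OF sets_sphere_measure refl] measurable_restrict_space1)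
  note [measurable] = measurable_compose[OF measurable_snd id]
  have "(\<lambda>(g, x). g *v x) \<in> \<mu> \<Otimes>\<^sub>M sphere_measure \<rightarrow>\<^sub>M restrict_space borel (sphere 0 1)"
    by (rule measurable_restrict_space2) (auto simp: space_pair_measure)
  then show ?thesis by (simp add: measurable_cong_sets[OF refl sets_sphere_measure])
qed

lemma measurable_orbit:
  assumes "x0 \<in> sphere 0 1"
  shows "(\<lambda>g. g *v x0) \<in> \<mu> \<rightarrow>\<^sub>M sphere_measure"
  using measurable_compose[OF _ measurable_orbit_pair, of "\<lambda>g. (g, x0)" \<mu>] assms by simp

text \<open>Averaging the indicator of \<open>A\<close> over all rotations does not change its
  surface integral. After Fubini the inner integral runs over an orbit; by right invariance and
  transitivity it does not depend on the starting point, so only the total mass 4 pi remains as a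
  factor.\<close>

lemma emeasure_sphere_eq_haar:
  assumes x0: "x0 \<in> sphere 0 1" and A: "A \<in> sets sphere_measure"
  shows "emeasure sphere_measure A = ennreal (4 * pi) * emeasure (distr \<mu> sphere_measure (\<lambda>g. g *v x0)) A"
proof -
  interpret P: pair_sigma_finite \<mu> sphere_measure by standard
  let ?i = "indicator A :: real^3 \<Rightarrow> ennreal"
  have i: "?i \<in> borel_measurable sphere_measure" using A by simp
  define m where "m = (\<integral>\<^sup>+g. ?i (g *v x0) \<partial>\<mu>)"
  have const: "(\<integral>\<^sup>+g. ?i (g *v x) \<partial>\<mu>) = m" if x: "x \<in> sphere 0 1" for x
  proof -
    obtain a where a: "a \<in> SO3" "a *v x0 = x" by (rule SO3_transitive[OF x0 x])
    have "(\<lambda>g. ?i (g *v x0)) \<in> borel_measurable \<mu>"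
      by (rule measurable_compose[OF measurable_orbit[OF x0] i])
    from nn_integral_haar_right[OF this a(1)] show ?thesis
      by (simp add: m_def a matrix_vector_mul_assoc[symmetric])
  qed
  have "emeasure sphere_measure A = (\<integral>\<^sup>+g. (\<integral>\<^sup>+x. ?i x \<partial>sphere_measure) \<partial>\<mu>)"
    using A by simp
  also have "\<dots> = (\<integral>\<^sup>+g. (\<integral>\<^sup>+x. ?i (g *v x) \<partial>sphere_measure) \<partial>\<mu>)"
    using nn_integral_distr[OF measurable_SO3_mult_sphere, of _ ?i] i
    by (intro nn_integral_cong[of \<mu>]) (simp add: distr_sphere_measure_SO3)
  also have "\<dots> = (\<integral>\<^sup>+x. (\<integral>\<^sup>+g. ?i (g *v x) \<partial>\<mu>) \<partial>sphere_measure)"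
    using measurable_compose[OF measurable_orbit_pair i]
    by (intro P.Fubini'[symmetric]) (simp add: split_beta')
  also have "\<dots> = (\<integral>\<^sup>+x. m \<partial>sphere_measure)"
    by (intro nn_integral_cong) (simp add: const)
  also have "\<dots> = ennreal (4 * pi) * m"
    by (simp add: emeasure_sphere_measure_space mult.commute)
  also have "m = (\<integral>\<^sup>+x. ?i x \<partial>distr \<mu> sphere_measure (\<lambda>g. g *v x0))"
    using i measurable_orbit[OF x0] by (simp add: m_def nn_integral_distr)
  also have "\<dots> = emeasure (distr \<mu> sphere_measure (\<lambda>g. g *v x0)) A"
    using A by simp
  finally show ?thesis .
qed

text \<open>As a density with a constant weight the identity transfers to integrals and to
  almost-everywhere statements alike.\<close>

lemma sphere_measure_eq_haar:
  assumes x0: "x0 \<in> sphere 0 1"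
  shows "sphere_measure = density (distr \<mu> sphere_measure (\<lambda>g. g *v x0)) (\<lambda>_. ennreal (4 * pi))"
  by (rule measure_eqI)
     (simp_all add: emeasure_density_const emeasure_sphere_eq_haar[OF x0])

lemma integral_sphere_eq_haar:
  fixes u :: "real^3 \<Rightarrow> complex"
  assumes x0: "x0 \<in> sphere 0 1" and u: "u \<in> borel_measurable sphere_measure"
  shows "(\<integral>x. u x \<partial>sphere_measure) = of_real (4 * pi) * (\<integral>g. u (g *v x0) \<partial>\<mu>)"
proof -
  have "(\<integral>x. u x \<partial>sphere_measure)
      = (\<integral>x. u x \<partial>density (distr \<mu> sphere_measure (\<lambda>g. g *v x0)) (\<lambda>_. ennreal (4 * pi)))"
    by (rule arg_cong[OF sphere_measure_eq_haar[OF x0]])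
  also have "\<dots> = (\<integral>x. (4 * pi) *\<^sub>R u x \<partial>distr \<mu> sphere_measure (\<lambda>g. g *v x0))"
    using u by (subst integral_density) auto
  also have "\<dots> = of_real (4 * pi) * (\<integral>g. u (g *v x0) \<partial>\<mu>)"
    using u measurable_orbit[OF x0] by (subst integral_distr) (auto simp: scaleR_conv_of_real)
  finally show ?thesis .
qed

text \<open>Needed because \<open>G\<close> agrees with the Radon transform only almost everywhere
  on the sphere variables, while the duality computation takes place on the group.\<close>

lemma AE_sphere_haar:
  assumes x0: "x0 \<in> sphere 0 1" and P: "AE x in sphere_measure. P x"
  shows "AE g in \<mu>. P (g *v x0)"
proof -
  have "AE x in distr \<mu> sphere_measure (\<lambda>g. g *v x0). P x"
  proof -
    have "AE x in density (distr \<mu> sphere_measure (\<lambda>g. g *v x0)) (\<lambda>_. ennreal (4 * pi)). P x"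
      using P by (rule back_subst[where P="\<lambda>M. AE x in M. P x"]) (rule sphere_measure_eq_haar[OF x0])
    then show ?thesis by (subst (asm) AE_density) auto
  qed
  then show ?thesis
    by (rule AE_distrD[OF measurable_orbit[OF x0]])
qed

end

section \<open>Polynomial calculus and the Casimir identity\<close>

definition dirderiv :: "real^3 \<Rightarrow> (real^3 \<Rightarrow> complex) \<Rightarrow> real^3 \<Rightarrow> complex" where
  "dirderiv v P x = frechet_derivative P (at x) v"

text \<open>Induction over the generation of polynomials by sums and products; the derivative must
  be carried along together with its polynomiality, since the product rule uses both.\<close>

lemma real_polynomial_function_derivative:
  fixes p :: "'a::real_normed_vector \<Rightarrow> real"
  assumes "real_polynomial_function p"
  shows "\<exists>D. (\<forall>x. (p has_derivative D x) (at x)) \<and> (\<forall>v. real_polynomial_function (\<lambda>x. D x v))"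
  using assms
proof induction
  case (linear f)
  then show ?case
    by (intro exI[of _ "\<lambda>_. f"]) (auto intro: bounded_linear_imp_has_derivative)
next
  case (const c)
  then show ?case by (intro exI[of _ "\<lambda>_ _. 0"]) auto
next
  case (add f g)
  then obtain F G where "\<And>x. (f has_derivative F x) (at x)" "\<And>v. real_polynomial_function (\<lambda>x. F x v)"
    "\<And>x. (g has_derivative G x) (at x)" "\<And>v. real_polynomial_function (\<lambda>x. G x v)" by auto
  then show ?case
    by (intro exI[of _ "\<lambda>x v. F x v + G x v"]) (auto intro: has_derivative_add real_polynomial_function.intros(3))
next
  case (mult f g)
  then obtain F G where "\<And>x. (f has_derivative F x) (at x)" "\<And>v. real_polynomial_function (\<lambda>x. F x v)"
    "\<And>x. (g has_derivative G x) (at x)" "\<And>v. real_polynomial_function (\<lambda>x. G x v)" by auto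
  with mult show ?case
    by (intro exI[of _ "\<lambda>x v. f x * G x v + F x v * g x"]) (auto intro!: has_derivative_mult real_polynomial_function.intros(3,4))
qed

lemma has_derivative_polynomial:
  assumes "polynomial_function P"
  shows "(P has_derivative (\<lambda>v. dirderiv v P x)) (at x)"
  using differentiable_at_polynomial_function[OF assms] frechet_derivative_works[of P "at x"]
  by (simp add: dirderiv_def[abs_def] eta_contract_eq)

lemma dirderivI: "(P has_derivative D) (at x) \<Longrightarrow> dirderiv v P x = D v"
  by (simp add: dirderiv_def frechet_derivative_at[symmetric])

lemma linear_dirderiv: "polynomial_function P \<Longrightarrow> linear (\<lambda>v. dirderiv v P x)"
  using has_derivative_polynomial has_derivative_linear by blast

lemma polynomial_function_dirderiv [intro]:
  assumes P: "polynomial_function P"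
  shows "polynomial_function (dirderiv v P)"
proof -
  have "real_polynomial_function (\<lambda>x. dirderiv v P x \<bullet> b)" if b: "b \<in> Basis" for b
  proof -
    have "real_polynomial_function (\<lambda>x. P x \<bullet> b)"
      using P b by (simp add: polynomial_function_iff_Basis_inner)
    then obtain D where D: "\<And>x. ((\<lambda>x. P x \<bullet> b) has_derivative D x) (at x)"
      "\<And>v. real_polynomial_function (\<lambda>x. D x v)"
      using real_polynomial_function_derivative by blast
    have "((\<lambda>x. P x \<bullet> b) has_derivative (\<lambda>v. dirderiv v P x \<bullet> b)) (at x)" for x
      by (intro has_derivative_inner_left has_derivative_polynomial P)
    then have "D x = (\<lambda>v. dirderiv v P x \<bullet> b)" for x
      using D(1) has_derivative_unique by blast
    then show ?thesis using D(2)[of v] by simp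
  qed
  then show ?thesis by (simp add: polynomial_function_iff_Basis_inner)
qed

lemma real_polynomial_function_nth [intro]: "real_polynomial_function (\<lambda>x::real^3. x $ i)"
  by (intro real_polynomial_function.intros(1) bounded_linear_vec_nth)

lemma polynomial_function_nth_scaleR [intro]:
  "polynomial_function P \<Longrightarrow> polynomial_function (\<lambda>x::real^3. x $ i *\<^sub>R (P x :: complex))"
  using real_polynomial_function_nth[of i] by (intro polynomial_function_mult) (simp add: real_polynomial_function_eq)

lemma polynomial_function_bounded_linear_comp:
  assumes h: "bounded_linear h" and P: "polynomial_function P"
  shows "polynomial_function (\<lambda>x. h (P x))"
  unfolding polynomial_function_def o_def
proof (intro allI impI)
  fix f :: "'b \<Rightarrow> real" assume "bounded_linear f"
  then have "bounded_linear (\<lambda>y. f (h y))" using h by (rule bounded_linear_compose)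
  then show "real_polynomial_function (\<lambda>x. f (h (P x)))"
    using P by (auto simp: polynomial_function_def o_def)
qed

lemma polynomial_function_cmult [intro]:
  fixes P :: "'a::real_normed_vector \<Rightarrow> complex"
  assumes "polynomial_function P"
  shows "polynomial_function (\<lambda>x. c * P x)"
  by (rule polynomial_function_bounded_linear_comp[OF bounded_linear_mult_right assms])

lemma polynomial_function_cnj [intro]:
  assumes "polynomial_function P"
  shows "polynomial_function (\<lambda>x. cnj (P x))"
  by (rule polynomial_function_bounded_linear_comp[OF bounded_linear_cnj assms])

lemma dirderiv_add:
  "polynomial_function P \<Longrightarrow> polynomial_function Q \<Longrightarrow>
     dirderiv v (\<lambda>x. P x + Q x) x = dirderiv v P x + dirderiv v Q x"
  by (intro dirderivI has_derivative_add has_derivative_polynomial)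

lemma dirderiv_diff:
  "polynomial_function P \<Longrightarrow> polynomial_function Q \<Longrightarrow>
     dirderiv v (\<lambda>x. P x - Q x) x = dirderiv v P x - dirderiv v Q x"
  by (intro dirderivI has_derivative_diff has_derivative_polynomial)

lemma dirderiv_cmult:
  "polynomial_function P \<Longrightarrow> dirderiv v (\<lambda>x. c * P x) x = c * dirderiv v P x"
  by (intro dirderivI has_derivative_mult_right has_derivative_polynomial)

lemma dirderiv_cnj:
  "polynomial_function P \<Longrightarrow> dirderiv v (\<lambda>x. cnj (P x)) x = cnj (dirderiv v P x)"
  by (intro dirderivI bounded_linear.has_derivative[OF bounded_linear_cnj] has_derivative_polynomial)

lemma dirderiv_nth_scaleR:
  assumes "polynomial_function P"
  shows "dirderiv v (\<lambda>x. x $ i *\<^sub>R P x) x = v $ i *\<^sub>R P x + x $ i *\<^sub>R dirderiv v P x"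
proof (rule dirderivI)
  show "((\<lambda>x. x $ i *\<^sub>R P x) has_derivative (\<lambda>v. v $ i *\<^sub>R P x + x $ i *\<^sub>R dirderiv v P x)) (at x)"
    using has_derivative_scaleR[OF bounded_linear_imp_has_derivative[OF bounded_linear_vec_nth]
        has_derivative_polynomial[OF assms]]
    by (simp add: add.commute)
qed

abbreviation pd :: "3 \<Rightarrow> (real^3 \<Rightarrow> complex) \<Rightarrow> real^3 \<Rightarrow> complex" where
  "pd i \<equiv> dirderiv (axis i 1)"

lemma dirderiv_expand:
  assumes "polynomial_function P"
  shows "dirderiv v P x = v $ 1 *\<^sub>R pd 1 P x + v $ 2 *\<^sub>R pd 2 P x + v $ 3 *\<^sub>R pd 3 P x"
proof -
  interpret linear "\<lambda>v. dirderiv v P x" by (rule linear_dirderiv[OF assms])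
  have "v = v $ 1 *\<^sub>R axis 1 1 + v $ 2 *\<^sub>R axis 2 1 + v $ 3 *\<^sub>R axis 3 1"
    by (simp add: vec_eq_iff forall_3 axis_def)
  then have "dirderiv v P x = dirderiv (v $ 1 *\<^sub>R axis 1 1 + v $ 2 *\<^sub>R axis 2 1 + v $ 3 *\<^sub>R axis 3 1) P x"
    by simp
  then show ?thesis by (simp add: add scale)
qed

lemma has_vector_derivative_polynomial_comp:
  assumes P: "polynomial_function P" and c: "(c has_vector_derivative v) (at s)"
  shows "((\<lambda>s. P (c s)) has_vector_derivative dirderiv v P (c s)) (at s)"
proof -
  interpret linear "\<lambda>v. dirderiv v P (c s)" by (rule linear_dirderiv[OF P])
  have "((\<lambda>s. P (c s)) has_derivative (\<lambda>h. dirderiv (h *\<^sub>R v) P (c s))) (at s)"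
    using has_derivative_compose[OF c[unfolded has_vector_derivative_def] has_derivative_polynomial[OF P]] .
  then show ?thesis by (simp add: has_vector_derivative_def scale)
qed

text \<open>\<open>second_deriv\<close> nests two choice-based derivatives. The outer one sees the
  inner one only near \<open>s\<close>, so the first derivative has to be known in a neighbourhood
  and not just at \<open>s\<close>.\<close>

lemma second_derivI:
  assumes "eventually (\<lambda>r. (c has_vector_derivative c' r) (at r)) (nhds s)"
    and "(c' has_vector_derivative c'') (at s)"
  shows "second_deriv c s = c''"
proof -
  have ev: "eventually (\<lambda>r. c' r = vector_derivative c (at r)) (nhds s)"
    using assms(1) by eventually_elim (simp add: vector_derivative_at)
  have "((\<lambda>r. vector_derivative c (at r)) has_vector_derivative c'') (at s)"
    by (rule has_vector_derivative_cong_ev[THEN iffD1, OF _ _ assms(2)])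
       (use ev eventually_nhds_x_imp_x[OF ev] in simp_all)
  then show ?thesis by (simp add: second_deriv_def vector_derivative_at)
qed

lemma second_deriv_polynomial_line:
  assumes "polynomial_function P"
  shows "second_deriv (\<lambda>s. P (x + s *\<^sub>R b)) 0 = dirderiv b (dirderiv b P) x"
proof (rule second_derivI)
  have line: "((\<lambda>s. x + s *\<^sub>R b) has_vector_derivative b) (at r)" for r
    by (auto intro!: derivative_eq_intros)
  show "\<forall>\<^sub>F r in nhds 0. ((\<lambda>s. P (x + s *\<^sub>R b)) has_vector_derivative dirderiv b P (x + r *\<^sub>R b)) (at r)"
    by (intro always_eventually allI has_vector_derivative_polynomial_comp assms line)
  show "((\<lambda>r. dirderiv b P (x + r *\<^sub>R b)) has_vector_derivative dirderiv b (dirderiv b P) x) (at 0)"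
    using has_vector_derivative_polynomial_comp[OF polynomial_function_dirderiv[OF assms] line, of b 0]
    by simp
qed

lemma sum_Basis_3: "(\<Sum>b\<in>Basis. f b) = f (axis 1 1) + f (axis 2 1) + f (axis (3::3) (1::real))"
proof -
  have "Basis = (\<lambda>i::3. axis i (1::real)) ` UNIV" by (auto simp: Basis_vec_def)
  moreover have "inj (\<lambda>i::3. axis i (1::real))" by (auto simp: inj_def axis_eq_axis)
  ultimately show ?thesis
    using sum.reindex[of "\<lambda>i::3. axis i (1::real)" UNIV f] by (metis comp_apply sum_3)
qed

lemma laplacian_polynomial:
  "polynomial_function P \<Longrightarrow> laplacian P x = pd 1 (pd 1 P) x + pd 2 (pd 2 P) x + pd 3 (pd 3 P) x"
  by (simp add: laplacian_def sum_Basis_3 second_deriv_polynomial_line)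

text \<open>The vector field generating the rotations about the \<open>a\<close>-th axis, i.e. a
  component of the angular momentum operator without the factor of the imaginary unit.\<close>

definition rot_deriv :: "3 \<Rightarrow> (real^3 \<Rightarrow> complex) \<Rightarrow> real^3 \<Rightarrow> complex" where
  "rot_deriv a P x = dirderiv (cross3 (axis a 1) x) P x"

lemma rot_deriv_expand:
  assumes "polynomial_function P"
  shows "rot_deriv 1 P = (\<lambda>x. x $ 2 *\<^sub>R pd 3 P x - x $ 3 *\<^sub>R pd 2 P x)"
    "rot_deriv 2 P = (\<lambda>x. x $ 3 *\<^sub>R pd 1 P x - x $ 1 *\<^sub>R pd 3 P x)"
    "rot_deriv 3 P = (\<lambda>x. x $ 1 *\<^sub>R pd 2 P x - x $ 2 *\<^sub>R pd 1 P x)"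
  unfolding fun_eq_iff rot_deriv_def
  by (intro allI, subst dirderiv_expand[OF assms, of "cross3 _ _"], simp add: cross3_simps axis_def)+

lemma polynomial_function_rot_deriv [intro]:
  assumes P: "polynomial_function P"
  shows "polynomial_function (rot_deriv a P)"
proof -
  have "\<forall>a. polynomial_function (rot_deriv a P)"
    unfolding forall_3 rot_deriv_expand[OF P]
    by (intro conjI polynomial_function_diff polynomial_function_nth_scaleR polynomial_function_dirderiv P)
  then show ?thesis by simp
qed

text \<open>Differentiation leaves the sphere, so the polynomial extension hidden in
  \<open>spherical_harmonic\<close> needs a name of its own.\<close>

definition harmonic_poly :: "nat \<Rightarrow> (real^3 \<Rightarrow> complex) \<Rightarrow> bool" where
  "harmonic_poly k P \<longleftrightarrow> polynomial_function P \<and> (\<forall>r x. P (r *\<^sub>R x) = r ^ k *\<^sub>R P x) \<and>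
     (\<forall>x. laplacian P x = 0)"

lemma spherical_harmonic_iff: "spherical_harmonic k \<phi> \<longleftrightarrow> (\<exists>P. harmonic_poly k P \<and> (\<forall>x\<in>sphere 0 1. \<phi> x = P x))"
  by (auto simp: spherical_harmonic_def harmonic_poly_def)

definition euler_op :: "(real^3 \<Rightarrow> complex) \<Rightarrow> real^3 \<Rightarrow> complex" where
  "euler_op P = (\<lambda>x. x $ 1 *\<^sub>R pd 1 P x + x $ 2 *\<^sub>R pd 2 P x + x $ 3 *\<^sub>R pd 3 P x)"

text \<open>Euler's identity: differentiate \<open>P (r *\<^sub>R x)\<close> at \<open>r = 1\<close>
  by the chain rule and by homogeneity.\<close>

lemma dirderiv_radial:
  assumes "polynomial_function P" "\<And>r x. P (r *\<^sub>R x) = r ^ k *\<^sub>R P x"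
  shows "dirderiv x P x = of_nat k * P x"
proof -
  have c: "((\<lambda>r. r *\<^sub>R x) has_vector_derivative x) (at 1)" by (auto intro!: derivative_eq_intros)
  have 1: "((\<lambda>r. P (r *\<^sub>R x)) has_vector_derivative dirderiv x P x) (at 1)"
    using has_vector_derivative_polynomial_comp[OF assms(1) c] by simp
  have "((\<lambda>r. r ^ k *\<^sub>R P x) has_vector_derivative (of_nat k *\<^sub>R P x)) (at 1)"
    by (auto intro!: derivative_eq_intros simp: has_real_derivative_iff_has_vector_derivative[symmetric])
  then have 2: "((\<lambda>r. P (r *\<^sub>R x)) has_vector_derivative (of_nat k *\<^sub>R P x)) (at 1)"
    by (simp add: assms(2))
  show ?thesis using vector_derivative_unique_at[OF 1 2] by (simp add: scaleR_conv_of_real)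
qed

lemma euler_op_harmonic:
  assumes "harmonic_poly k P"
  shows "euler_op P = (\<lambda>x. of_nat k * P x)"
  using assms dirderiv_radial[of P k]
  by (auto simp: euler_op_def harmonic_poly_def fun_eq_iff dirderiv_expand[symmetric])

lemmas poly_intros = polynomial_function_diff polynomial_function_add polynomial_function_nth_scaleR
  polynomial_function_dirderiv polynomial_function_cmult

text \<open>\<open>sum_a L_a^2 = |x|^2 Laplacian - E (E + 1)\<close> with the Euler operator \<open>E\<close>.\<close>

lemma casimir:
  assumes P: "harmonic_poly k P"
  shows "rot_deriv 1 (rot_deriv 1 P) x + rot_deriv 2 (rot_deriv 2 P) x + rot_deriv 3 (rot_deriv 3 P) x
     = - of_nat (k * (k + 1)) * P x"
proof -
  have p: "polynomial_function P" using P by (simp add: harmonic_poly_def)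
  have pd: "polynomial_function (pd i P)" for i using p by auto
  have lap: "pd 1 (pd 1 P) x + pd 2 (pd 2 P) x + pd 3 (pd 3 P) x = 0"
    using P laplacian_polynomial[OF p] by (simp add: harmonic_poly_def)
  have E: "euler_op P x = of_nat k * P x" by (simp add: euler_op_harmonic[OF P])
  have EE: "euler_op (euler_op P) x = of_nat k * (of_nat k * P x)"
  proof -
    have "euler_op (euler_op P) x = euler_op (\<lambda>x. of_nat k * P x) x" by (simp add: euler_op_harmonic[OF P])
    also have "\<dots> = of_nat k * euler_op P x"
      by (simp add: euler_op_def dirderiv_cmult[OF p] algebra_simps)
    finally show ?thesis by (simp add: E)
  qed
  have ax: "axis i (1::real) $ j = (if i = j then 1 else 0)" for i j :: 3 by (simp add: axis_def)
  have "rot_deriv 1 (rot_deriv 1 P) x + rot_deriv 2 (rot_deriv 2 P) x + rot_deriv 3 (rot_deriv 3 P) x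
    = (x $ 1 * x $ 1 + x $ 2 * x $ 2 + x $ 3 * x $ 3) *\<^sub>R (pd 1 (pd 1 P) x + pd 2 (pd 2 P) x + pd 3 (pd 3 P) x)
       - euler_op (euler_op P) x - euler_op P x"
    unfolding rot_deriv_expand[OF polynomial_function_rot_deriv[OF p]]
    unfolding rot_deriv_expand[OF p] euler_op_def
    \<comment> \<open>Both sides contain each mixed derivative once in either order, so the identity
      follows by comparing the coefficients of \<open>pd i P x\<close> and
      \<open>pd i (pd j P) x\<close>.\<close>
    apply (simp add: dirderiv_add dirderiv_diff dirderiv_nth_scaleR poly_intros p pd ax)
    apply (simp add: scaleR_conv_of_real algebra_simps)
    done
  also have "\<dots> = - of_nat (k * (k + 1)) * P x"
    unfolding lap EE E by (simp add: algebra_simps)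
  finally show ?thesis .
qed

section \<open>Spherical harmonics\<close>

lemma harmonic_poly_polynomial: "harmonic_poly k P \<Longrightarrow> polynomial_function P"
  by (simp add: harmonic_poly_def)

lemma laplacian_add:
  fixes P Q :: "real^3 \<Rightarrow> complex"
  assumes "polynomial_function P" "polynomial_function Q"
  shows "laplacian (\<lambda>x. P x + Q x) x = laplacian P x + laplacian Q x"
proof -
  have p: "\<And>i. polynomial_function (pd i P)" "\<And>i. polynomial_function (pd i Q)"
    using assms by auto
  have pd: "pd i (\<lambda>x. P x + Q x) = (\<lambda>x. pd i P x + pd i Q x)" for i
    by (rule ext) (rule dirderiv_add[OF assms])
  show ?thesis
    by (simp add: laplacian_polynomial poly_intros assms p pd dirderiv_add)
qed

lemma laplacian_cmult:
  fixes P :: "real^3 \<Rightarrow> complex"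
  assumes "polynomial_function P"
  shows "laplacian (\<lambda>x. c * P x) x = c * laplacian P x"
proof -
  have p: "\<And>i. polynomial_function (pd i P)" using assms by auto
  have pd: "pd i (\<lambda>x. c * P x) = (\<lambda>x. c * pd i P x)" for i
    by (rule ext) (rule dirderiv_cmult[OF assms])
  show ?thesis
    by (simp add: laplacian_polynomial poly_intros assms p pd dirderiv_cmult algebra_simps)
qed

lemma harmonic_poly_add:
  "harmonic_poly k P \<Longrightarrow> harmonic_poly k Q \<Longrightarrow> harmonic_poly k (\<lambda>x. P x + Q x)"
  by (auto simp: harmonic_poly_def scaleR_add_right laplacian_add)

lemma harmonic_poly_cmult: "harmonic_poly k P \<Longrightarrow> harmonic_poly k (\<lambda>x. c * P x)"
  by (auto simp: harmonic_poly_def laplacian_cmult)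

lemma harmonic_poly_cnj:
  assumes "harmonic_poly k P"
  shows "harmonic_poly k (\<lambda>x. cnj (P x))"
proof -
  have p: "polynomial_function P" "\<And>i. polynomial_function (pd i P)"
    using assms by (auto simp: harmonic_poly_def)
  have pd: "pd i (\<lambda>x. cnj (P x)) = (\<lambda>x. cnj (pd i P x))" for i
    by (rule ext) (rule dirderiv_cnj[OF p(1)])
  have "laplacian (\<lambda>x. cnj (P x)) x = cnj (laplacian P x)" for x
    by (simp add: laplacian_polynomial polynomial_function_cnj p pd dirderiv_cnj)
  then show ?thesis using assms by (auto simp: harmonic_poly_def)
qed

section \<open>Rotation invariance of the Laplacian and of the spherical harmonics\<close>

lemma polynomial_function_matrix_comp:
  assumes "polynomial_function P"
  shows "polynomial_function (\<lambda>x::real^3. P ((A::real^3^3) *v x))"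
  using polynomial_function_compose[OF polynomial_function_bounded_linear[of "\<lambda>x. A *v x"] assms]
  by (simp add: o_def matrix_vector_mul_bounded_linear)

lemma dirderiv_matrix_comp:
  assumes "polynomial_function P"
  shows "dirderiv v (\<lambda>x. P (A *v x)) x = dirderiv (A *v v) P (A *v x)"
  by (intro dirderivI has_derivative_compose[OF bounded_linear_imp_has_derivative[OF matrix_vector_mul_bounded_linear]
        has_derivative_polynomial[OF assms]])

text \<open>The second derivatives are taken along the columns of \<open>A\<close>; in their sum the
  coefficient of \<open>pd l (pd m P)\<close> is the inner product of rows \<open>l\<close> and
  \<open>m\<close>, which is the Kronecker delta.\<close>

lemma laplacian_orthogonal_comp:
  fixes P :: "real^3 \<Rightarrow> complex" and A :: "real^3^3"
  assumes P: "polynomial_function P" and A: "orthogonal_matrix A"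
  shows "laplacian (\<lambda>x. P (A *v x)) x = laplacian P (A *v x)"
proof -
  let ?y = "A *v x"
  have pd: "polynomial_function (pd i P)" for i using P by auto
  have D: "pd i (\<lambda>x. P (A *v x)) = (\<lambda>x. dirderiv (A *v axis i 1) P (A *v x))" for i
    by (rule ext) (rule dirderiv_matrix_comp[OF P])
  have DD: "pd i (pd i (\<lambda>x. P (A *v x))) x = dirderiv (A *v axis i 1) (dirderiv (A *v axis i 1) P) ?y" for i
    unfolding D by (rule dirderiv_matrix_comp) (use P in auto)
  have col: "(A *v axis i 1) $ j = A $ j $ i" for i j
    by (simp add: matrix_vector_mult_basis column_def)
  have ex: "dirderiv v P = (\<lambda>x. v $ 1 *\<^sub>R pd 1 P x + v $ 2 *\<^sub>R pd 2 P x + v $ 3 *\<^sub>R pd 3 P x)" for v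
    by (rule ext) (rule dirderiv_expand[OF P])
  have scale: "dirderiv v (\<lambda>x. c *\<^sub>R Q x) x = c *\<^sub>R dirderiv v Q x"
    "polynomial_function (\<lambda>x. c *\<^sub>R Q x)" if "polynomial_function Q" for c v Q x
    using dirderiv_cmult[OF that, of v "of_real c"] that by (auto simp: scaleR_conv_of_real)
  have ex2: "dirderiv (A *v axis i 1) (dirderiv (A *v axis i 1) P) ?y
      = (\<Sum>l\<in>UNIV. \<Sum>m\<in>UNIV. (A $ l $ i * A $ m $ i) *\<^sub>R pd l (pd m P) ?y)" for i
    unfolding dirderiv_expand[OF polynomial_function_dirderiv[OF P], of "A *v axis i 1"]
    unfolding ex[of "A *v axis i 1"] col
    by (simp add: dirderiv_add scale poly_intros pd sum_3 scaleR_add_right ac_simps)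
  have rows: "A $ l $ 1 * A $ m $ 1 + A $ l $ 2 * A $ m $ 2 + A $ l $ 3 * A $ m $ 3 = (if l = m then 1 else 0)" for l m
  proof -
    have "(A ** transpose A) $ l $ m = mat 1 $ l $ m" using A by (simp add: orthogonal_matrix_def)
    then show ?thesis by (simp add: matrix_matrix_mult_def transpose_def mat_def sum_3)
  qed
  have "laplacian (\<lambda>x. P (A *v x)) x
      = (\<Sum>l\<in>UNIV. \<Sum>m\<in>UNIV. (A $ l $ 1 * A $ m $ 1 + A $ l $ 2 * A $ m $ 2 + A $ l $ 3 * A $ m $ 3) *\<^sub>R pd l (pd m P) ?y)"
    unfolding laplacian_polynomial[OF polynomial_function_matrix_comp[OF P]] DD ex2
    by (simp add: sum.distrib[symmetric] scaleR_add_left)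
  also have "\<dots> = (\<Sum>l\<in>UNIV. \<Sum>m\<in>UNIV. if l = m then pd l (pd m P) ?y else 0)"
    unfolding rows by (intro sum.cong) auto
  also have "\<dots> = laplacian P ?y" by (simp add: laplacian_polynomial[OF P] sum_3)
  finally show ?thesis .
qed

lemma harmonic_poly_rotate:
  assumes "harmonic_poly k P" "g \<in> SO3"
  shows "harmonic_poly k (\<lambda>x. P (g *v x))"
  using assms
  by (simp add: harmonic_poly_def polynomial_function_matrix_comp laplacian_orthogonal_comp
      orthogonal_matrix_SO3 matrix_vector_mult_scaleR)

lemma spherical_harmonic_add:
  "spherical_harmonic k \<phi> \<Longrightarrow> spherical_harmonic k \<psi> \<Longrightarrow> spherical_harmonic k (\<lambda>x. \<phi> x + \<psi> x)"
  unfolding spherical_harmonic_iff by (metis harmonic_poly_add)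

lemma spherical_harmonic_cmult: "spherical_harmonic k \<phi> \<Longrightarrow> spherical_harmonic k (\<lambda>x. c * \<phi> x)"
  unfolding spherical_harmonic_iff by (metis harmonic_poly_cmult)

lemma spherical_harmonic_zero: "spherical_harmonic k (\<lambda>x. 0)"
proof -
  have "pd i (\<lambda>x. 0) = (\<lambda>x. 0)" for i
    by (rule ext) (rule dirderivI[OF has_derivative_const])
  then have "laplacian (\<lambda>x::real^3. 0::complex) x = 0" for x
    by (subst laplacian_polynomial) simp_all
  then show ?thesis unfolding spherical_harmonic_def by (intro exI[of _ "\<lambda>x. 0"]) auto
qed

lemma spherical_harmonic_sum:
  assumes "\<And>i. i \<in> I \<Longrightarrow> spherical_harmonic k (\<phi> i)"
  shows "spherical_harmonic k (\<lambda>x. \<Sum>i\<in>I. c i * \<phi> i x)"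
  using assms
proof (induction I rule: infinite_finite_induct)
  case (insert i I)
  then have "spherical_harmonic k (\<lambda>x. c i * \<phi> i x)" "spherical_harmonic k (\<lambda>x. \<Sum>i\<in>I. c i * \<phi> i x)"
    by (auto intro: spherical_harmonic_cmult)
  from spherical_harmonic_add[OF this] show ?case using insert by simp
qed (simp_all add: spherical_harmonic_zero)

lemma spherical_harmonic_cnj: "spherical_harmonic k \<phi> \<Longrightarrow> spherical_harmonic k (\<lambda>x. cnj (\<phi> x))"
  unfolding spherical_harmonic_iff by (metis harmonic_poly_cnj)

lemma spherical_harmonic_rotate:
  assumes "spherical_harmonic k \<phi>" "g \<in> SO3"
  shows "spherical_harmonic k (\<lambda>x. \<phi> (g *v x))"
proof -
  obtain P where P: "harmonic_poly k P" "\<forall>x\<in>sphere 0 1. \<phi> x = P x"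
    using assms by (auto simp: spherical_harmonic_iff)
  show ?thesis unfolding spherical_harmonic_iff
    using harmonic_poly_rotate[OF P(1) assms(2)] P(2) assms(2)
    by (intro exI[of _ "\<lambda>x. P (g *v x)"]) auto
qed

lemma spherical_harmonic_cong:
  "(\<And>x. x \<in> sphere 0 1 \<Longrightarrow> \<phi> x = \<psi> x) \<Longrightarrow> spherical_harmonic k \<phi> = spherical_harmonic k \<psi>"
  unfolding spherical_harmonic_def by simp

section \<open>Bounded functions and inner products on the sphere\<close>

lemma continuous_on_polynomial: "polynomial_function (P :: real^3 \<Rightarrow> complex) \<Longrightarrow> continuous_on S P"
  by (simp add: continuous_at_imp_continuous_on continuous_polymonial_function)

text \<open>A class closed under products, conjugation and rotation on which every integral over the
  finite surface measure exists.\<close>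

definition bounded_sphere :: "(real^3 \<Rightarrow> complex) \<Rightarrow> bool" where
  "bounded_sphere \<phi> \<longleftrightarrow> \<phi> \<in> borel_measurable sphere_measure \<and> (\<exists>B. \<forall>x\<in>sphere 0 1. cmod (\<phi> x) \<le> B)"

lemma bounded_sphere_measurable: "bounded_sphere \<phi> \<Longrightarrow> \<phi> \<in> borel_measurable sphere_measure"
  by (simp add: bounded_sphere_def)

lemma bounded_sphere_continuous:
  assumes "continuous_on (sphere 0 1) \<phi>"
  shows "bounded_sphere \<phi>"
proof -
  have "compact (\<phi> ` sphere 0 1)" by (intro compact_continuous_image assms compact_sphere)
  then obtain B where "\<forall>x\<in>sphere 0 1. cmod (\<phi> x) \<le> B"
    using bounded_iff[of "\<phi> ` sphere 0 1"] compact_imp_bounded by auto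
  then show ?thesis unfolding bounded_sphere_def
    using borel_measurable_continuous_on_restrict[OF assms]
    by (auto simp: measurable_cong_sets[OF sets_sphere_measure refl])
qed

lemma bounded_sphere_polynomial: "polynomial_function P \<Longrightarrow> bounded_sphere P"
  by (intro bounded_sphere_continuous continuous_on_polynomial)

lemma spherical_harmonic_continuous: "spherical_harmonic k \<phi> \<Longrightarrow> continuous_on (sphere 0 1) \<phi>"
  unfolding spherical_harmonic_def using continuous_on_polynomial continuous_on_cong by metis

lemma spherical_harmonic_bounded: "spherical_harmonic k \<phi> \<Longrightarrow> bounded_sphere \<phi>"
  by (intro bounded_sphere_continuous spherical_harmonic_continuous)

lemma bounded_sphere_mult:
  assumes "bounded_sphere \<phi>" "bounded_sphere \<psi>"
  shows "bounded_sphere (\<lambda>x. \<phi> x * \<psi> x)"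
proof -
  obtain B C where "\<forall>x\<in>sphere 0 1. cmod (\<phi> x) \<le> B" "\<forall>x\<in>sphere 0 1. cmod (\<psi> x) \<le> C"
    using assms by (auto simp: bounded_sphere_def)
  then have "\<forall>x\<in>sphere 0 1. cmod (\<phi> x * \<psi> x) \<le> B * C"
    unfolding norm_mult by (metis mult_mono norm_ge_zero order_trans)
  then show ?thesis using assms unfolding bounded_sphere_def by (intro conjI exI[of _ "B * C"] borel_measurable_times) auto
qed

lemma measurable_cnj [measurable (raw)]:
  "f \<in> borel_measurable M \<Longrightarrow> (\<lambda>x. cnj (f x)) \<in> borel_measurable M"
  by (rule measurable_compose[OF _ borel_measurable_continuous_onI[of cnj]])
     (auto intro: continuous_intros)

lemma bounded_sphere_cnj: "bounded_sphere \<phi> \<Longrightarrow> bounded_sphere (\<lambda>x. cnj (\<phi> x))"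
  by (auto simp: bounded_sphere_def intro: measurable_cnj)

lemma bounded_sphere_rotate:
  assumes "bounded_sphere \<phi>" "g \<in> SO3"
  shows "bounded_sphere (\<lambda>x. \<phi> (g *v x))"
proof -
  obtain B where "\<forall>x\<in>sphere 0 1. cmod (\<phi> x) \<le> B" using assms by (auto simp: bounded_sphere_def)
  then have "\<forall>x\<in>sphere 0 1. cmod (\<phi> (g *v x)) \<le> B" using assms(2) by simp
  then show ?thesis
    using measurable_compose[OF measurable_SO3_mult_sphere[OF assms(2)] bounded_sphere_measurable[OF assms(1)]]
    by (auto simp: bounded_sphere_def)
qed

lemma bounded_sphere_integrable: "bounded_sphere \<phi> \<Longrightarrow> integrable sphere_measure \<phi>"
  unfolding bounded_sphere_def
  by (auto intro!: sphere.integrable_const_bound AE_I2)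

lemma integrable_inner_sphere:
  "bounded_sphere \<phi> \<Longrightarrow> bounded_sphere \<psi> \<Longrightarrow> integrable sphere_measure (\<lambda>x. \<phi> x * cnj (\<psi> x))"
  by (intro bounded_sphere_integrable bounded_sphere_mult bounded_sphere_cnj)

abbreviation sinner :: "(real^3 \<Rightarrow> complex) \<Rightarrow> (real^3 \<Rightarrow> complex) \<Rightarrow> complex" where
  "sinner \<equiv> l2_inner sphere_measure"

lemma sinner_cong:
  "(\<And>x. x \<in> sphere 0 1 \<Longrightarrow> \<phi> x = \<phi>' x) \<Longrightarrow> (\<And>x. x \<in> sphere 0 1 \<Longrightarrow> \<psi> x = \<psi>' x) \<Longrightarrow>
    sinner \<phi> \<psi> = sinner \<phi>' \<psi>'"
  unfolding l2_inner_def by (rule Bochner_Integration.integral_cong) auto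

lemma sinner_rotate:
  assumes "bounded_sphere \<phi>" "bounded_sphere \<psi>" "g \<in> SO3"
  shows "sinner (\<lambda>x. \<phi> (g *v x)) (\<lambda>x. \<psi> (g *v x)) = sinner \<phi> \<psi>"
  unfolding l2_inner_def
  by (rule integral_sphere_SO3[OF assms(3), of "\<lambda>x. \<phi> x * cnj (\<psi> x)"])
     (intro bounded_sphere_measurable bounded_sphere_mult bounded_sphere_cnj assms)

lemma sinner_rotate_left:
  assumes "bounded_sphere \<phi>" "bounded_sphere \<psi>" "g \<in> SO3"
  shows "sinner (\<lambda>x. \<phi> (g *v x)) \<psi> = sinner \<phi> (\<lambda>x. \<psi> (matrix_inv g *v x))"
  using sinner_rotate[OF assms(1) bounded_sphere_rotate[OF assms(2) SO3_inv[OF assms(3)]] assms(3)] assms(3)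
  by simp

lemma sinner_cnj: "sinner \<phi> \<psi> = cnj (sinner \<psi> \<phi>)"
  using Bochner_Integration.integral_cnj[of sphere_measure "\<lambda>x. \<psi> x * cnj (\<phi> x)"]
  by (simp add: l2_inner_def mult.commute)

lemma sinner_sum_left:
  assumes "\<And>i. i \<in> I \<Longrightarrow> bounded_sphere (\<phi> i)" "bounded_sphere \<psi>"
  shows "sinner (\<lambda>x. \<Sum>i\<in>I. c i * \<phi> i x) \<psi> = (\<Sum>i\<in>I. c i * sinner (\<phi> i) \<psi>)"
proof -
  have "sinner (\<lambda>x. \<Sum>i\<in>I. c i * \<phi> i x) \<psi> = (\<integral>x. (\<Sum>i\<in>I. c i * (\<phi> i x * cnj (\<psi> x))) \<partial>sphere_measure)"
    unfolding l2_inner_def by (simp add: sum_distrib_right mult.assoc)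
  also have "\<dots> = (\<Sum>i\<in>I. \<integral>x. c i * (\<phi> i x * cnj (\<psi> x)) \<partial>sphere_measure)"
    using assms by (intro Bochner_Integration.integral_sum integrable_mult_right integrable_inner_sphere)
  also have "\<dots> = (\<Sum>i\<in>I. c i * sinner (\<phi> i) \<psi>)"
    unfolding l2_inner_def using assms by (simp add: integral_mult_right integrable_inner_sphere)
  finally show ?thesis .
qed

section \<open>Eigenvalues of the Laplace--Beltrami operators\<close>

lemma linear_cross_axis: "linear (cross3 u)"
  by (rule linearI) (simp_all add: cross_add_right cross_mult_right)

lemma matrix_cross: "matrix (cross3 u) *v v = cross3 u v"
  by (simp add: vec_eq_iff forall_3 matrix_def matrix_vector_mult_def sum_3 cross3_simps axis_def)

lemma axis_rotation_vec:
  "axis_rotation a s *v v =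
     v + sin s *\<^sub>R cross3 (axis a 1) v + (1 - cos s) *\<^sub>R cross3 (axis a 1) (cross3 (axis a 1) v)"
  by (simp add: axis_rotation_def Let_def matrix_vector_mult_add_rdistrib scaleR_matrix_vector_assoc[symmetric]
      matrix_vector_mul_assoc[symmetric] matrix_cross)

text \<open>The relation K^3 = -K for a unit axis; it makes Rodrigues' formula a solution of the
  differential equation of the rotation flow.\<close>

lemma cross_axis_cube:
  "cross3 (axis a 1) (cross3 (axis a 1) (cross3 (axis a 1) v)) = - cross3 (axis a 1) (v::real^3)"
proof -
  have "\<forall>a::3. cross3 (axis a 1) (cross3 (axis a 1) (cross3 (axis a 1) v)) = - cross3 (axis a 1) v"
    unfolding forall_3 by (simp add: cross3_simps axis_def vec_eq_iff forall_3)
  then show ?thesis by simp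
qed

lemma axis_rotation_entries:
  "axis_rotation 1 s = vector [vector [1, 0, 0], vector [0, cos s, - sin s], vector [0, sin s, cos s]]"
  "axis_rotation 2 s = vector [vector [cos s, 0, sin s], vector [0, 1, 0], vector [- sin s, 0, cos s]]"
  "axis_rotation 3 s = vector [vector [cos s, - sin s, 0], vector [sin s, cos s, 0], vector [0, 0, 1]]"
  by (simp_all add: axis_rotation_def Let_def vec_eq_iff forall_3 matrix_def matrix_matrix_mult_def sum_3
      cross3_simps axis_def mat_def)

lemma axis_rotation_SO3 [simp]: "axis_rotation a s \<in> SO3"
proof -
  have "\<forall>a. axis_rotation a s \<in> SO3"
    unfolding forall_3 SO3_def rotation_matrix_def orthogonal_matrix_def axis_rotation_entries
    by (simp add: vec_eq_iff forall_3 matrix_matrix_mult_def transpose_def mat_def sum_3 det_3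
        power2_eq_square[symmetric])
  then show ?thesis by simp
qed

lemma axis_rotation_inv: "matrix_inv (axis_rotation a s) = axis_rotation a (- s)"
proof -
  have "\<forall>a. transpose (axis_rotation a s) = axis_rotation a (- s)"
    unfolding forall_3 axis_rotation_entries
    by (simp add: vec_eq_iff forall_3 transpose_def)
  then show ?thesis by (simp add: matrix_inv_SO3)
qed

lemma axis_rotation_0 [simp]: "axis_rotation a 0 = mat 1"
  by (simp add: axis_rotation_def Let_def)

text \<open>Stated for the angle \<open>- s\<close> because the representation acts on functions
  through the inverse rotation.\<close>

lemma has_vector_derivative_axis_rotation:
  "((\<lambda>s. axis_rotation a (- s) *v v) has_vector_derivative
      - cross3 (axis a 1) (axis_rotation a (- s) *v v)) (at s)"
proof -
  let ?K = "cross3 (axis a 1)"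
  have "((\<lambda>s. v + sin (- s) *\<^sub>R ?K v + (1 - cos (- s)) *\<^sub>R ?K (?K v)) has_vector_derivative
      (- cos s *\<^sub>R ?K v + sin s *\<^sub>R ?K (?K v))) (at s)"
    by (auto intro!: derivative_eq_intros simp: has_real_derivative_iff_has_vector_derivative[symmetric])
  moreover have "- ?K (v + sin (- s) *\<^sub>R ?K v + (1 - cos (- s)) *\<^sub>R ?K (?K v))
      = - cos s *\<^sub>R ?K v + sin s *\<^sub>R ?K (?K v)"
    unfolding linear_add[OF linear_cross_axis] linear_cmul[OF linear_cross_axis] cross_axis_cube
    by (simp add: scaleR_diff_left)
  ultimately show ?thesis unfolding axis_rotation_vec by simp
qed

text \<open>The mean value inequality bounds all difference quotients by \<open>B\<close>, so
  dominated convergence on the finite measure space passes to the limit under the integral.\<close>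

lemma has_vector_derivative_integral:
  fixes u u' :: "real \<Rightarrow> 'a \<Rightarrow> complex"
  assumes "finite_measure M" and int: "\<And>s. integrable M (u s)" and meas: "\<And>s. u' s \<in> borel_measurable M"
    and deriv: "\<And>s x. x \<in> space M \<Longrightarrow> ((\<lambda>s. u s x) has_vector_derivative u' s x) (at s)"
    and bound: "\<And>s x. x \<in> space M \<Longrightarrow> cmod (u' s x) \<le> B"
  shows "((\<lambda>s. \<integral>x. u s x \<partial>M) has_vector_derivative (\<integral>x. u' s x \<partial>M)) (at s)"
proof -
  interpret finite_measure M by fact
  let ?F = "\<lambda>s. \<integral>x. u s x \<partial>M"
  define q where "q h x = (u (s + h) x - u s x) /\<^sub>R h" for h x
  have lip: "cmod (q h x) \<le> B" if "x \<in> space M" "h \<noteq> 0" for h x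
  proof -
    have "cmod (u (s + h) x - u s x) \<le> B * norm ((s + h) - s)"
    proof (rule differentiable_bound[OF convex_UNIV])
      show "((\<lambda>s. u s x) has_derivative (\<lambda>h. h *\<^sub>R u' r x)) (at r within UNIV)" for r
        using deriv[OF that(1)] by (simp add: has_vector_derivative_def)
      show "onorm (\<lambda>h. h *\<^sub>R u' r x) \<le> B" for r
        using bound[OF that(1), of r] norm_ge_zero[of "u' r x"]
        by (intro onorm_le) (auto simp: mult.commute[of B] intro!: mult_left_mono)
    qed auto
    then have le: "cmod (u (s + h) x - u s x) \<le> B * \<bar>h\<bar>" by simp
    have "cmod (q h x) = cmod (u (s + h) x - u s x) / \<bar>h\<bar>"
      by (simp add: q_def divide_inverse)
    also have "\<dots> \<le> B" using le that(2) by (subst pos_divide_le_eq) auto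
    finally show ?thesis .
  qed
  have ptw: "((\<lambda>h. q h x) \<longlongrightarrow> u' s x) (at 0)" if "x \<in> space M" for x
  proof -
    have "((\<lambda>h. cmod (u (s + h) x - u s x - h *\<^sub>R u' s x) / norm h) \<longlongrightarrow> 0) (at 0)"
      using deriv[OF that, of s] by (simp add: has_vector_derivative_def has_derivative_at)
    then have "((\<lambda>h. cmod (q h x - u' s x)) \<longlongrightarrow> 0) (at 0)"
    proof (rule Lim_transform_eventually)
      show "\<forall>\<^sub>F h in at 0. cmod (u (s + h) x - u s x - h *\<^sub>R u' s x) / norm h = cmod (q h x - u' s x)"
        unfolding eventually_at_filter
      proof (intro always_eventually allI impI)
        fix h :: real assume h: "h \<noteq> 0"
        have "q h x - u' s x = (u (s + h) x - u s x - h *\<^sub>R u' s x) /\<^sub>R h"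
          using h by (simp add: q_def scaleR_diff_right)
        then show "cmod (u (s + h) x - u s x - h *\<^sub>R u' s x) / norm h = cmod (q h x - u' s x)"
          by (simp add: divide_inverse mult.commute)
      qed
    qed
    then show ?thesis by (simp add: tendsto_norm_zero_iff LIM_zero_iff)
  qed
  have "((\<lambda>h. \<integral>x. q h x \<partial>M) \<longlongrightarrow> (\<integral>x. u' s x \<partial>M)) (at 0)"
    \<comment> \<open>Dominated convergence speaks of sequences, hence the sequential form of the
      limit at 0.\<close>
    unfolding tendsto_at_iff_sequentially o_def
  proof (intro allI impI)
    fix X :: "nat \<Rightarrow> real" assume X: "\<forall>i. X i \<in> UNIV - {0}" "X \<longlonglongrightarrow> 0"
    show "(\<lambda>n. \<integral>x. q (X n) x \<partial>M) \<longlonglongrightarrow> (\<integral>x. u' s x \<partial>M)"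
    proof (rule integral_dominated_convergence[where w="\<lambda>_. B"])
      show "AE x in M. (\<lambda>n. q (X n) x) \<longlonglongrightarrow> u' s x"
        using ptw X by (intro AE_I2) (auto simp: tendsto_at_iff_sequentially o_def)
      show "\<And>n. AE x in M. cmod (q (X n) x) \<le> B"
        using lip X by (intro AE_I2) auto
      show "\<And>n. q (X n) \<in> borel_measurable M"
        unfolding q_def using int by measurable
    qed (use meas in auto)
  qed
  moreover have "(\<integral>x. q h x \<partial>M) = (?F (s + h) - ?F s) /\<^sub>R h" for h
    unfolding q_def using int by simp
  ultimately have "((\<lambda>h. (?F (s + h) - ?F s) /\<^sub>R h) \<longlongrightarrow> (\<integral>x. u' s x \<partial>M)) (at 0)"
    by simp
  from tendsto_norm_zero[OF LIM_zero[OF this]]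
  have lim: "((\<lambda>h. cmod ((?F (s + h) - ?F s) /\<^sub>R h - (\<integral>x. u' s x \<partial>M))) \<longlongrightarrow> 0) (at 0)"
    .
  show ?thesis
    unfolding has_vector_derivative_def has_derivative_at
  proof (intro conjI bounded_linear_scaleR_left, rule Lim_transform_eventually[OF lim])
    let ?D = "\<integral>x. u' s x \<partial>M"
    show "\<forall>\<^sub>F h in at 0. cmod ((?F (s + h) - ?F s) /\<^sub>R h - ?D) = cmod (?F (s + h) - ?F s - h *\<^sub>R ?D) / norm h"
      unfolding eventually_at_filter
    proof (intro always_eventually allI impI)
      fix h :: real assume h: "h \<noteq> 0"
      have "(?F (s + h) - ?F s) /\<^sub>R h - ?D = (?F (s + h) - ?F s - h *\<^sub>R ?D) /\<^sub>R h"
        using h by (simp add: scaleR_diff_right)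
      then show "cmod ((?F (s + h) - ?F s) /\<^sub>R h - ?D) = cmod (?F (s + h) - ?F s - h *\<^sub>R ?D) / norm h"
        by (simp add: divide_inverse mult.commute)
    qed
  qed
qed

text \<open>Wigner polynomials with arbitrary functions in place of basis elements: differentiating
  along the group replaces \<open>\<phi>\<close> by \<open>rot_deriv a \<phi>\<close>, which is no
  basis element.\<close>

definition matcoef :: "(real^3 \<Rightarrow> complex) \<Rightarrow> (real^3 \<Rightarrow> complex) \<Rightarrow> real^3^3 \<Rightarrow> complex" where
  "matcoef \<phi> \<psi> g = sinner (\<lambda>x. \<phi> (matrix_inv g *v x)) \<psi>"

text \<open>Multiplying \<open>g\<close> on the right by a rotation moves the argument of
  \<open>P\<close> by the inverse rotation. Differentiation under the integral therefore produces
  the angular derivative of \<open>P\<close> with a minus sign, which disappears in the second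
  derivative.\<close>

lemma has_vector_derivative_matcoef:
  assumes P: "polynomial_function P" and \<psi>: "bounded_sphere \<psi>" and g: "g \<in> SO3"
  shows "((\<lambda>s. matcoef P \<psi> (g ** axis_rotation a s)) has_vector_derivative
      - matcoef (rot_deriv a P) \<psi> (g ** axis_rotation a s)) (at s)"
proof -
  have inv: "matrix_inv (g ** axis_rotation a s) *v x = axis_rotation a (- s) *v (matrix_inv g *v x)" for s x
    using g by (simp add: SO3_inv_mult axis_rotation_inv matrix_vector_mul_assoc)
  have gR: "g ** axis_rotation a s \<in> SO3" for s using g by (simp add: SO3_mult)
  let ?u = "\<lambda>s x. P (axis_rotation a (- s) *v (matrix_inv g *v x)) * cnj (\<psi> x)"
  let ?u' = "\<lambda>s x. - rot_deriv a P (axis_rotation a (- s) *v (matrix_inv g *v x)) * cnj (\<psi> x)"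
  have bs: "bounded_sphere (\<lambda>x. Q (axis_rotation a (- s) *v (matrix_inv g *v x)) * cnj (\<psi> x))"
    if "polynomial_function Q" for Q s
    using bounded_sphere_mult[OF bounded_sphere_rotate[OF bounded_sphere_polynomial[OF that] SO3_inv[OF gR]]
        bounded_sphere_cnj[OF \<psi>], of s]
    by (simp add: inv)
  have pr: "polynomial_function (rot_deriv a P)" using P by auto
  obtain B1 where B1: "\<forall>x\<in>sphere 0 1. cmod (rot_deriv a P x) \<le> B1"
    using bounded_sphere_polynomial[OF pr] by (auto simp: bounded_sphere_def)
  obtain B2 where B2: "\<forall>x\<in>sphere 0 1. cmod (\<psi> x) \<le> B2"
    using \<psi> by (auto simp: bounded_sphere_def)
  have "((\<lambda>s. \<integral>x. ?u s x \<partial>sphere_measure) has_vector_derivative (\<integral>x. ?u' s x \<partial>sphere_measure)) (at s)"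
  proof (rule has_vector_derivative_integral)
    show "finite_measure sphere_measure" by (rule sphere.finite_measure_axioms)
    show "integrable sphere_measure (?u s)" for s by (rule bounded_sphere_integrable[OF bs[OF P]])
    show "?u' s \<in> borel_measurable sphere_measure" for s
      using bounded_sphere_measurable[OF bs[OF pr], of s] by simp
    show "((\<lambda>s. ?u s x) has_vector_derivative ?u' s x) (at s)" for s x
    proof -
      let ?y = "axis_rotation a (- s) *v (matrix_inv g *v x)"
      have 1: "((\<lambda>s. P (axis_rotation a (- s) *v (matrix_inv g *v x))) has_vector_derivative
          dirderiv (- cross3 (axis a 1) ?y) P ?y) (at s)"
        by (rule has_vector_derivative_polynomial_comp[OF P has_vector_derivative_axis_rotation])
      have 2: "dirderiv (- cross3 (axis a 1) ?y) P ?y = - rot_deriv a P ?y"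
        using linear_neg[OF linear_dirderiv[OF P]] by (simp add: rot_deriv_def)
      show ?thesis using has_vector_derivative_mult_left[OF 1, of "cnj (\<psi> x)"] by (simp add: 2)
    qed
    show "cmod (?u' s x) \<le> B1 * B2" if "x \<in> space sphere_measure" for s x
    proof -
      have "cmod (rot_deriv a P (axis_rotation a (- s) *v (matrix_inv g *v x))) \<le> B1"
        using B1 that by (simp add: SO3_inv g)
      moreover have "cmod (\<psi> x) \<le> B2" using B2 that by simp
      ultimately have "cmod (rot_deriv a P (axis_rotation a (- s) *v (matrix_inv g *v x))) * cmod (\<psi> x) \<le> B1 * B2"
        by (intro mult_mono) (auto intro: order_trans[OF norm_ge_zero])
      then show ?thesis by (simp add: norm_mult)
    qed
  qed
  then show ?thesis by (simp add: matcoef_def l2_inner_def inv)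
qed

lemma second_deriv_matcoef:
  assumes P: "polynomial_function P" and \<psi>: "bounded_sphere \<psi>" and g: "g \<in> SO3"
  shows "second_deriv (\<lambda>s. matcoef P \<psi> (g ** axis_rotation a s)) 0 = matcoef (rot_deriv a (rot_deriv a P)) \<psi> g"
proof (rule second_derivI)
  show "\<forall>\<^sub>F s in nhds 0. ((\<lambda>s. matcoef P \<psi> (g ** axis_rotation a s)) has_vector_derivative
      - matcoef (rot_deriv a P) \<psi> (g ** axis_rotation a s)) (at s)"
    by (intro always_eventually allI has_vector_derivative_matcoef assms)
  show "((\<lambda>s. - matcoef (rot_deriv a P) \<psi> (g ** axis_rotation a s)) has_vector_derivative
      matcoef (rot_deriv a (rot_deriv a P)) \<psi> g) (at 0)"
    using has_vector_derivative_minus[OF has_vector_derivative_matcoef[OF polynomial_function_rot_deriv[OF P] \<psi> g],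
        of a a 0]
    by simp
qed

lemma matcoef_casimir:
  assumes P: "harmonic_poly k P" and \<psi>: "bounded_sphere \<psi>" and g: "g \<in> SO3"
  shows "(\<Sum>a\<in>UNIV. matcoef (rot_deriv a (rot_deriv a P)) \<psi> g) = - of_nat (k * (k + 1)) * matcoef P \<psi> g"
proof -
  have p: "polynomial_function P" by (rule harmonic_poly_polynomial[OF P])
  have bs: "bounded_sphere (\<lambda>x. Q (matrix_inv g *v x))" if "polynomial_function Q" for Q
    by (rule bounded_sphere_rotate[OF bounded_sphere_polynomial[OF that] SO3_inv[OF g]])
  have bsr: "bounded_sphere (\<lambda>x. rot_deriv a (rot_deriv a P) (matrix_inv g *v x))" for a
    by (intro bs polynomial_function_rot_deriv p)
  have "(\<Sum>a\<in>UNIV. matcoef (rot_deriv a (rot_deriv a P)) \<psi> g)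
      = (\<Sum>a\<in>UNIV. 1 * sinner (\<lambda>x. rot_deriv a (rot_deriv a P) (matrix_inv g *v x)) \<psi>)"
    by (simp add: matcoef_def)
  also have "\<dots> = sinner (\<lambda>x. \<Sum>a\<in>UNIV. 1 * rot_deriv a (rot_deriv a P) (matrix_inv g *v x)) \<psi>"
    by (rule sinner_sum_left[OF bsr \<psi>, symmetric])
  \<comment> \<open>The sum over one index brings the scalar factor into the shape of
    \<open>sinner_sum_left\<close>.\<close>
  also have "\<dots> = sinner (\<lambda>x. \<Sum>i\<in>{0::nat}. - of_nat (k * (k + 1)) * P (matrix_inv g *v x)) \<psi>"
    using casimir[OF P] by (simp add: sum_3)
  also have "\<dots> = - of_nat (k * (k + 1)) * matcoef P \<psi> g"
    using sinner_sum_left[OF bs[OF p] \<psi>, where I="{0::nat}" and c="\<lambda>_. - of_nat (k * (k + 1))"]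
    by (simp add: matcoef_def)
  finally show ?thesis .
qed

lemma SO3_laplacian_matcoef:
  assumes \<phi>: "spherical_harmonic k \<phi>" and \<psi>: "bounded_sphere \<psi>" and g: "g \<in> SO3"
  shows "SO3_laplacian (matcoef \<phi> \<psi>) g = - of_nat (k * (k + 1)) * matcoef \<phi> \<psi> g"
proof -
  obtain P where P: "harmonic_poly k P" "\<forall>x\<in>sphere 0 1. \<phi> x = P x"
    using \<phi> by (auto simp: spherical_harmonic_iff)
  have eq: "matcoef \<phi> \<psi> h = matcoef P \<psi> h" if "h \<in> SO3" for h
    unfolding matcoef_def using P(2) that by (intro sinner_cong) (auto simp: SO3_inv)
  show ?thesis unfolding SO3_laplacian_def using matcoef_casimir[OF P(1) \<psi> g] g
    by (simp add: eq SO3_mult second_deriv_matcoef[OF harmonic_poly_polynomial[OF P(1)] \<psi> g])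
qed

text \<open>Symmetry of the Casimir operator: the second derivatives of one matrix coefficient at
  the identity are computed once with the rotation acting on \<open>P\<close> and once with it moved
  to \<open>Q\<close>. The results carry the eigenvalues of the degrees \<open>k\<close> and
  \<open>l\<close>, which differ.\<close>

lemma spherical_harmonic_orthogonal:
  assumes "spherical_harmonic k \<phi>" "spherical_harmonic l \<psi>" "k \<noteq> l"
  shows "sinner \<phi> \<psi> = 0"
proof -
  obtain P where P: "harmonic_poly k P" "\<forall>x\<in>sphere 0 1. \<phi> x = P x"
    using assms by (auto simp: spherical_harmonic_iff)
  obtain Q where Q: "harmonic_poly l Q" "\<forall>x\<in>sphere 0 1. \<psi> x = Q x"
    using assms by (auto simp: spherical_harmonic_iff)
  have p: "polynomial_function P" "polynomial_function Q" using P Q harmonic_poly_polynomial by auto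
  have b: "bounded_sphere P" "bounded_sphere Q" using p bounded_sphere_polynomial by auto
  \<comment> \<open>Unitarity moves the rotation to the other argument, at the price of the opposite
    angle and a conjugation.\<close>
  have flip: "matcoef P Q (axis_rotation a s) = cnj (matcoef Q P (axis_rotation a (- s)))" for a s
    using sinner_rotate_left[OF b, of "axis_rotation a (- s)"] sinner_cnj[of P "\<lambda>x. Q (axis_rotation a s *v x)"]
    by (simp add: matcoef_def axis_rotation_inv)
  have d2: "second_deriv (\<lambda>s. matcoef P Q (axis_rotation a s)) 0 = cnj (matcoef (rot_deriv a (rot_deriv a Q)) P (mat 1))" for a
    unfolding flip
  proof (rule second_derivI)
    have D: "((\<lambda>s. matcoef R P (axis_rotation a s)) has_vector_derivative - matcoef (rot_deriv a R) P (axis_rotation a s)) (at s)"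
      if "polynomial_function R" for R s
      using has_vector_derivative_matcoef[OF that b(1) SO3_one, of a s] by simp
    have N: "((\<lambda>s. cnj (matcoef R P (axis_rotation a (- s)))) has_vector_derivative
        cnj (matcoef (rot_deriv a R) P (axis_rotation a (- s)))) (at s)" if "polynomial_function R" for R s
    proof -
      have m: "((\<lambda>s::real. - s) has_vector_derivative - 1) (at s)" by (auto intro!: derivative_eq_intros)
      have "((\<lambda>s. matcoef R P (axis_rotation a (- s))) has_vector_derivative
          matcoef (rot_deriv a R) P (axis_rotation a (- s))) (at s)"
        using vector_diff_chain_at[OF m D[OF that]] by (simp add: o_def)
      then show ?thesis by (rule bounded_linear.has_vector_derivative[OF bounded_linear_cnj])
    qed
    show "\<forall>\<^sub>F s in nhds 0. ((\<lambda>s. cnj (matcoef Q P (axis_rotation a (- s)))) has_vector_derivative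
        cnj (matcoef (rot_deriv a Q) P (axis_rotation a (- s)))) (at s)"
      by (intro always_eventually allI N p)
    show "((\<lambda>s. cnj (matcoef (rot_deriv a Q) P (axis_rotation a (- s)))) has_vector_derivative
        cnj (matcoef (rot_deriv a (rot_deriv a Q)) P (mat 1))) (at 0)"
      using N[OF polynomial_function_rot_deriv[OF p(2)], of a 0] by simp
  qed
  have "- of_nat (k * (k + 1)) * matcoef P Q (mat 1) = (\<Sum>a\<in>UNIV. second_deriv (\<lambda>s. matcoef P Q (axis_rotation a s)) 0)"
    using matcoef_casimir[OF P(1) b(2) SO3_one] second_deriv_matcoef[OF p(1) b(2) SO3_one] by simp
  also have "\<dots> = cnj (- of_nat (l * (l + 1)) * matcoef Q P (mat 1))"
    unfolding d2 using matcoef_casimir[OF Q(1) b(1) SO3_one] by (simp flip: cnj_sum)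
  also have "matcoef Q P (mat 1) = cnj (matcoef P Q (mat 1))"
    using flip[of _ 0] by simp
  finally have "(of_nat (l * (l + 1)) - of_nat (k * (k + 1))) * matcoef P Q (mat 1) = 0"
    by (simp add: algebra_simps)
  moreover have "of_nat (l * (l + 1)) \<noteq> (of_nat (k * (k + 1)) :: complex)"
  proof
    assume "of_nat (l * (l + 1)) = (of_nat (k * (k + 1)) :: complex)"
    then have "l * (l + 1) = k * (k + 1)" by (simp only: of_nat_eq_iff)
    moreover have "l * (l + 1) < k * (k + 1)" if "l < k" using that by (intro mult_strict_mono) auto
    moreover have "k * (k + 1) < l * (l + 1)" if "k < l" using that by (intro mult_strict_mono) auto
    ultimately show False using assms(3) by (cases "l < k") auto
  qed
  ultimately have "matcoef P Q (mat 1) = 0" by simp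
  moreover have "matrix_inv (mat 1 :: real^3^3) = mat 1"
    using matrix_inv_SO3[OF SO3_one] by simp
  moreover have "sinner \<phi> \<psi> = sinner P Q" using P Q by (intro sinner_cong) auto
  ultimately show ?thesis by (simp add: matcoef_def)
qed

text \<open>The extension of \<open>\<phi>\<close> that is constant along rays is |z|^(-k) P(z). Its
  second derivatives along the three coordinate lines add up by Euler's identity and harmonicity,
  and -k (3 - (k + 2)) - 2 k^2 = -k (k + 1).\<close>

lemma S2_laplacian_harmonic:
  assumes \<phi>: "spherical_harmonic k \<phi>" and x: "x \<in> sphere 0 1"
  shows "S2_laplacian \<phi> x = - of_nat (k * (k + 1)) * \<phi> x"
proof -
  obtain P where P: "harmonic_poly k P" "\<forall>x\<in>sphere 0 1. \<phi> x = P x"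
    using \<phi> by (auto simp: spherical_harmonic_iff)
  have p: "polynomial_function P" by (rule harmonic_poly_polynomial[OF P(1)])
  \<comment> \<open>Half the exponent, since the radial factor is written as a power of
    \<open>z \<bullet> z\<close>, which is quadratic along each line and easy to
    differentiate.\<close>
  let ?e = "- real k / 2"
  have ext: "\<phi> (z /\<^sub>R norm z) = ((z \<bullet> z) powr ?e) *\<^sub>R P z" if "z \<noteq> 0" for z
  proof -
    have "\<phi> (z /\<^sub>R norm z) = inverse (norm z) ^ k *\<^sub>R P z"
      using P that by (simp add: harmonic_poly_def)
    also have "inverse (norm z) ^ k = (norm z) powr (- real k)"
      using that by (simp add: powr_minus powr_realpow power_inverse)
    also have "\<dots> = (z \<bullet> z) powr ?e"
      using that by (simp add: power2_norm_eq_inner[symmetric] powr_powr flip: powr_numeral)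
    finally show ?thesis .
  qed
  have sd: "second_deriv (\<lambda>s. \<phi> ((x + s *\<^sub>R b) /\<^sub>R norm (x + s *\<^sub>R b))) 0
      = (- real k * (1 - (real k + 2) * (x \<bullet> b)\<^sup>2)) *\<^sub>R P x - (2 * real k * (x \<bullet> b)) *\<^sub>R dirderiv b P x
        + dirderiv b (dirderiv b P) x" if b: "norm b = 1" for b
  proof (rule second_derivI)
    define z where "z s = x + s *\<^sub>R b" for s
    have z0: "z 0 = x" by (simp add: z_def)
    have zd: "(z has_vector_derivative b) (at s)" for s
      unfolding z_def by (auto intro!: derivative_eq_intros)
    have Pd: "((\<lambda>s. Q (z s)) has_vector_derivative dirderiv b Q (z s)) (at s)" if "polynomial_function Q" for Q s
      by (rule has_vector_derivative_polynomial_comp[OF that zd])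
    have rd: "((\<lambda>s. z s \<bullet> z s) has_real_derivative 2 * (z s \<bullet> b)) (at s)" for s
      unfolding z_def using b
      by (auto intro!: derivative_eq_intros simp: inner_simps inner_commute algebra_simps has_real_derivative_iff_has_vector_derivative)
    have bd: "((\<lambda>s. z s \<bullet> b) has_real_derivative 1) (at s)" for s
      unfolding z_def using b
      by (auto intro!: derivative_eq_intros simp: inner_simps norm_eq_1 )
    have powd: "((\<lambda>s. (z s \<bullet> z s) powr e) has_real_derivative (e * (z s \<bullet> z s) powr (e - 1) * (2 * (z s \<bullet> b)))) (at s)"
      if "z s \<noteq> 0" for s e
      using DERIV_powr[OF rd _ DERIV_const, of s e] that
      by (simp add: field_simps powr_diff)
    define A where "A s = ?e * (z s \<bullet> z s) powr (?e - 1) * (2 * (z s \<bullet> b))" for s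
    \<comment> \<open>\<open>x\<close> and \<open>b\<close> are unit vectors, so the line can meet
      the origin only for parameters of modulus 1. This gives the neighbourhood that
      \<open>second_derivI\<close> asks for.\<close>
    have nz: "z s \<noteq> 0" if "\<bar>s\<bar> < 1" for s
    proof
      assume "z s = 0"
      then have "x = - (s *\<^sub>R b)" by (simp add: z_def eq_neg_iff_add_eq_0)
      then have "norm x = \<bar>s\<bar>" using b by simp
      then show False using x that by simp
    qed
    have ev: "\<forall>\<^sub>F s in nhds 0. \<bar>s\<bar> < (1::real)"
      using eventually_nhds_in_open[of "{-1<..<1::real}" 0] by (auto elim!: eventually_mono)
    show "\<forall>\<^sub>F s in nhds 0. ((\<lambda>s. \<phi> ((x + s *\<^sub>R b) /\<^sub>R norm (x + s *\<^sub>R b))) has_vector_derivative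
       (A s *\<^sub>R P (z s) + ((z s \<bullet> z s) powr ?e) *\<^sub>R dirderiv b P (z s))) (at s)"
      using ev
    proof eventually_elim
      case (elim s)
      have op: "open {-1<..<1::real}" by simp
      have "((\<lambda>s. ((z s \<bullet> z s) powr ?e) *\<^sub>R P (z s)) has_vector_derivative
          (((z s \<bullet> z s) powr ?e) *\<^sub>R dirderiv b P (z s) + A s *\<^sub>R P (z s))) (at s)"
        unfolding A_def by (rule has_vector_derivative_scaleR[OF powd[OF nz[OF elim]] Pd[OF p]])
      then have "((\<lambda>s. \<phi> ((x + s *\<^sub>R b) /\<^sub>R norm (x + s *\<^sub>R b))) has_vector_derivative
          (((z s \<bullet> z s) powr ?e) *\<^sub>R dirderiv b P (z s) + A s *\<^sub>R P (z s))) (at s)"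
        by (rule has_vector_derivative_transform_within_open[OF _ op])
           (use elim ext nz in \<open>auto simp: z_def\<close>)
      then show ?case by (simp add: add.commute)
    qed
    have xx: "x \<bullet> x = 1" using x by (simp add: norm_eq_1[symmetric])
    have z0': "z 0 \<noteq> 0" using nz[of 0] by simp
    have Ad: "(A has_real_derivative (- real k * (1 - (real k + 2) * (x \<bullet> b)\<^sup>2))) (at 0)"
    proof -
      have "(A has_real_derivative (?e * ((?e - 1) * (z 0 \<bullet> z 0) powr (?e - 1 - 1) * (2 * (z 0 \<bullet> b))) * (2 * (z 0 \<bullet> b))
          + 2 * 1 * (?e * (z 0 \<bullet> z 0) powr (?e - 1)))) (at 0)"
        unfolding A_def by (intro DERIV_mult DERIV_cmult powd z0' bd)
      moreover have "?e * ((?e - 1) * (z 0 \<bullet> z 0) powr (?e - 1 - 1) * (2 * (z 0 \<bullet> b))) * (2 * (z 0 \<bullet> b))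
          + 2 * 1 * (?e * (z 0 \<bullet> z 0) powr (?e - 1)) = - real k * (1 - (real k + 2) * (x \<bullet> b)\<^sup>2)"
        unfolding z0 xx by (simp add: algebra_simps power2_eq_square)
      ultimately show ?thesis by simp
    qed
    have A0: "A 0 = - real k * (x \<bullet> b)" by (simp add: A_def z0 xx)
    have "((\<lambda>s. A s *\<^sub>R P (z s) + ((z s \<bullet> z s) powr ?e) *\<^sub>R dirderiv b P (z s)) has_vector_derivative
        ((A 0 *\<^sub>R dirderiv b P (z 0) + (- real k * (1 - (real k + 2) * (x \<bullet> b)\<^sup>2)) *\<^sub>R P (z 0))
        + (((z 0 \<bullet> z 0) powr ?e) *\<^sub>R dirderiv b (dirderiv b P) (z 0) + A 0 *\<^sub>R dirderiv b P (z 0)))) (at 0)"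
    proof (rule has_vector_derivative_add)
      show "((\<lambda>s. A s *\<^sub>R P (z s)) has_vector_derivative
         (A 0 *\<^sub>R dirderiv b P (z 0) + (- real k * (1 - (real k + 2) * (x \<bullet> b)\<^sup>2)) *\<^sub>R P (z 0))) (at 0)"
        by (rule has_vector_derivative_scaleR[OF Ad Pd[OF p]])
      show "((\<lambda>s. ((z s \<bullet> z s) powr ?e) *\<^sub>R dirderiv b P (z s)) has_vector_derivative
         (((z 0 \<bullet> z 0) powr ?e) *\<^sub>R dirderiv b (dirderiv b P) (z 0) + A 0 *\<^sub>R dirderiv b P (z 0))) (at 0)"
        unfolding A_def
        by (rule has_vector_derivative_scaleR[OF powd[OF z0'] Pd[OF polynomial_function_dirderiv[OF p]]])
    qed
    then show "((\<lambda>s. A s *\<^sub>R P (z s) + ((z s \<bullet> z s) powr ?e) *\<^sub>R dirderiv b P (z s)) has_vector_derivative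
      (- real k * (1 - (real k + 2) * (x \<bullet> b)\<^sup>2)) *\<^sub>R P x - (2 * real k * (x \<bullet> b)) *\<^sub>R dirderiv b P x
        + dirderiv b (dirderiv b P) x) (at 0)"
      unfolding z0 xx A0 by (simp add: algebra_simps scaleR_conv_of_real)
  qed
  have nx: "x $ 1 * x $ 1 + x $ 2 * x $ 2 + x $ 3 * x $ 3 = 1"
    using x norm_eq_1[of x] by (simp add: inner_vec_def sum_3)
  have E: "x $ 1 *\<^sub>R pd 1 P x + x $ 2 *\<^sub>R pd 2 P x + x $ 3 *\<^sub>R pd 3 P x = of_nat k * P x"
    using euler_op_harmonic[OF P(1)] by (simp add: euler_op_def fun_eq_iff)
  have L: "pd 1 (pd 1 P) x + pd 2 (pd 2 P) x + pd 3 (pd 3 P) x = 0"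
    using P(1) laplacian_polynomial[OF p] by (simp add: harmonic_poly_def)
  have "S2_laplacian \<phi> x = (- real k * (3 - (real k + 2) * (x $ 1 * x $ 1 + x $ 2 * x $ 2 + x $ 3 * x $ 3))) *\<^sub>R P x
      - (2 * real k) *\<^sub>R (x $ 1 *\<^sub>R pd 1 P x + x $ 2 *\<^sub>R pd 2 P x + x $ 3 *\<^sub>R pd 3 P x)
      + (pd 1 (pd 1 P) x + pd 2 (pd 2 P) x + pd 3 (pd 3 P) x)"
    unfolding S2_laplacian_def laplacian_def sum_Basis_3
    by (simp add: sd inner_axis power2_eq_square) (simp add: scaleR_conv_of_real algebra_simps)
  also have "\<dots> = - of_nat (k * (k + 1)) * P x"
    unfolding nx E L by (simp add: scaleR_conv_of_real algebra_simps)
  finally show ?thesis using P(2) x by simp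
qed

section \<open>Matrix coefficients of the rotation representations\<close>

definition idx :: "nat \<Rightarrow> nat set" where
  "idx k = {1..2 * k + 1}"

lemma finite_idx [simp]: "finite (idx k)"
  by (simp add: idx_def)

lemma card_idx [simp]: "card (idx k) = 2 * k + 1"
  by (simp add: idx_def)

lemma wigner_matcoef: "wigner Y k i j g = matcoef (Y k i) (Y k j) g"
  by (simp add: wigner_def wigner_rep_def matcoef_def)

locale sphere_basis =
  fixes Y :: "nat \<Rightarrow> nat \<Rightarrow> real^3 \<Rightarrow> complex"
  assumes harmonic_basis: "harmonic_basis Y"
begin

lemma Y_harmonic: "i \<in> idx k \<Longrightarrow> spherical_harmonic k (Y k i)"
  using harmonic_basis unfolding harmonic_basis_def idx_def by blast

lemma Y_bounded: "i \<in> idx k \<Longrightarrow> bounded_sphere (Y k i)"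
  using Y_harmonic spherical_harmonic_bounded by blast

lemma Y_inner: "i \<in> idx k \<Longrightarrow> j \<in> idx k \<Longrightarrow> sinner (Y k i) (Y k j) = (if i = j then 1 else 0)"
  using harmonic_basis unfolding harmonic_basis_def idx_def by blast

lemma Y_inner_degree:
  "i \<in> idx k \<Longrightarrow> j \<in> idx l \<Longrightarrow> sinner (Y k i) (Y l j) = (if k = l \<and> i = j then 1 else 0)"
  using spherical_harmonic_orthogonal[OF Y_harmonic Y_harmonic, of i k j l]
  by (cases "k = l") (auto simp: Y_inner)

lemma sum_Y_inner:
  assumes "j \<in> idx k"
  shows "sinner (\<lambda>x. \<Sum>i\<in>idx k. c i * Y k i x) (Y k j) = c j"
  using assms by (simp add: sinner_sum_left Y_bounded Y_inner mult_delta_right)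

lemma harmonic_expand:
  assumes "spherical_harmonic k \<phi>" "x \<in> sphere 0 1"
  shows "\<phi> x = (\<Sum>i\<in>idx k. sinner \<phi> (Y k i) * Y k i x)"
proof -
  obtain c where c: "\<forall>x\<in>sphere 0 1. \<phi> x = (\<Sum>i\<in>idx k. c i * Y k i x)"
    using harmonic_basis assms(1) unfolding harmonic_basis_def idx_def by blast
  have "sinner \<phi> (Y k j) = c j" if "j \<in> idx k" for j
    using sum_Y_inner[OF that, of c] sinner_cong[of \<phi> "\<lambda>x. \<Sum>i\<in>idx k. c i * Y k i x"] c by simp
  then show ?thesis using c assms(2) by simp
qed

lemma Y_coeff_unique:
  assumes "\<And>x. x \<in> sphere 0 1 \<Longrightarrow> (\<Sum>i\<in>idx k. c i * Y k i x) = (\<Sum>i\<in>idx k. d i * Y k i x)" "j \<in> idx k"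
  shows "c j = d j"
  using sum_Y_inner[OF assms(2), of c] sum_Y_inner[OF assms(2), of d]
    sinner_cong[OF assms(1), of "\<lambda>x. x" "Y k j" "Y k j"]
  by simp

abbreviation T :: "nat \<Rightarrow> nat \<Rightarrow> nat \<Rightarrow> real^3^3 \<Rightarrow> complex" where
  "T \<equiv> wigner Y"

lemma Y_rotate_inv:
  assumes "i \<in> idx k" "g \<in> SO3" "x \<in> sphere 0 1"
  shows "Y k i (matrix_inv g *v x) = (\<Sum>j\<in>idx k. T k i j g * Y k j x)"
  using harmonic_expand[OF spherical_harmonic_rotate[OF Y_harmonic[OF assms(1)] SO3_inv[OF assms(2)]] assms(3)]
  by (simp add: wigner_matcoef matcoef_def)

lemma T_eqI:
  assumes "i \<in> idx k" "g \<in> SO3" "j \<in> idx k"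
    "\<And>x. x \<in> sphere 0 1 \<Longrightarrow> Y k i (matrix_inv g *v x) = (\<Sum>j\<in>idx k. c j * Y k j x)"
  shows "T k i j g = c j"
  by (rule Y_coeff_unique[OF _ assms(3)]) (simp add: assms(4) Y_rotate_inv[OF assms(1,2), symmetric])

lemma T_one: "i \<in> idx k \<Longrightarrow> j \<in> idx k \<Longrightarrow> T k i j (mat 1) = (if i = j then 1 else 0)"
  by (rule T_eqI) (auto simp: SO3_one matrix_inv_SO3 if_distrib[of "\<lambda>c. c * _"] cong: if_cong)

lemma T_mult:
  assumes i: "i \<in> idx k" and j: "j \<in> idx k" and g: "g \<in> SO3" and h: "h \<in> SO3"
  shows "T k i j (g ** h) = (\<Sum>m\<in>idx k. T k i m h * T k m j g)"
proof (rule T_eqI[OF i SO3_mult[OF g h] j])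
  fix x :: "real^3" assume x: "x \<in> sphere 0 1"
  have "Y k i (matrix_inv (g ** h) *v x) = Y k i (matrix_inv h *v (matrix_inv g *v x))"
    by (simp add: SO3_inv_mult g h matrix_vector_mul_assoc)
  also have "\<dots> = (\<Sum>m\<in>idx k. T k i m h * (\<Sum>j\<in>idx k. T k m j g * Y k j x))"
    using x g by (simp add: Y_rotate_inv[OF i h] SO3_inv Y_rotate_inv[OF _ g x])
  also have "\<dots> = (\<Sum>j\<in>idx k. (\<Sum>m\<in>idx k. T k i m h * T k m j g) * Y k j x)"
    by (simp add: sum_distrib_left sum_distrib_right mult.assoc) (rule sum.swap)
  finally show "Y k i (matrix_inv (g ** h) *v x) = (\<Sum>j\<in>idx k. (\<Sum>m\<in>idx k. T k i m h * T k m j g) * Y k j x)" .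
qed

lemma T_inv:
  assumes "i \<in> idx k" "j \<in> idx k" "g \<in> SO3"
  shows "T k i j (matrix_inv g) = cnj (T k j i g)"
  using sinner_rotate_left[OF Y_bounded[OF assms(1)] Y_bounded[OF assms(2)] assms(3)] assms
    sinner_cnj[of "Y k i" "\<lambda>x. Y k j (matrix_inv g *v x)"]
  by (simp add: wigner_matcoef matcoef_def)

lemma T_unitary_rows:
  assumes "i \<in> idx k" "j \<in> idx k" "g \<in> SO3"
  shows "(\<Sum>m\<in>idx k. T k i m g * cnj (T k j m g)) = (if i = j then 1 else 0)"
  using T_mult[OF assms(1,2) SO3_inv[OF assms(3)] assms(3)] assms by (simp add: T_inv T_one)

lemma T_unitary_columns:
  assumes "i \<in> idx k" "j \<in> idx k" "g \<in> SO3"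
  shows "(\<Sum>m\<in>idx k. cnj (T k m i g) * T k m j g) = (if i = j then 1 else 0)"
  using T_mult[OF assms(1,2) assms(3) SO3_inv[OF assms(3)]] assms by (simp add: T_inv T_one)

lemma T_bound:
  assumes "i \<in> idx k" "j \<in> idx k" "g \<in> SO3"
  shows "cmod (T k i j g) \<le> 1"
proof -
  have "complex_of_real (\<Sum>m\<in>idx k. (cmod (T k i m g))\<^sup>2) = complex_of_real 1"
    unfolding of_real_sum complex_norm_square using T_unitary_rows[OF assms(1,1,3)] by simp
  then have "(\<Sum>m\<in>idx k. (cmod (T k i m g))\<^sup>2) = 1" by (simp only: of_real_eq_iff)
  moreover have "(cmod (T k i j g))\<^sup>2 \<le> (\<Sum>m\<in>idx k. (cmod (T k i m g))\<^sup>2)"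
    using assms by (intro member_le_sum) auto
  ultimately show ?thesis using power2_le_imp_le[of "cmod (T k i j g)" 1] by simp
qed

text \<open>The reproducing kernel of the harmonics of degree \<open>k\<close>; as a function of its
  first argument it is the zonal harmonic with pole \<open>y\<close>. Unitarity of the Wigner
  matrices makes it invariant under a simultaneous rotation.\<close>

definition Z :: "nat \<Rightarrow> real^3 \<Rightarrow> real^3 \<Rightarrow> complex" where
  "Z k x y = (\<Sum>i\<in>idx k. Y k i x * cnj (Y k i y))"

lemma Z_rotate:
  assumes g: "g \<in> SO3" and x: "x \<in> sphere 0 1" and y: "y \<in> sphere 0 1"
  shows "Z k (matrix_inv g *v x) (matrix_inv g *v y) = Z k x y"
proof -
  have "Z k (matrix_inv g *v x) (matrix_inv g *v y)
      = (\<Sum>i\<in>idx k. \<Sum>j\<in>idx k. \<Sum>m\<in>idx k. (cnj (T k i m g) * T k i j g) * (Y k j x * cnj (Y k m y)))"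
    unfolding Z_def
    by (intro sum.cong refl) (simp add: Y_rotate_inv[OF _ g x] Y_rotate_inv[OF _ g y] sum_product mult_ac)
  also have "\<dots> = (\<Sum>j\<in>idx k. \<Sum>i\<in>idx k. \<Sum>m\<in>idx k. (cnj (T k i m g) * T k i j g) * (Y k j x * cnj (Y k m y)))"
    by (rule sum.swap)
  also have "\<dots> = (\<Sum>j\<in>idx k. \<Sum>m\<in>idx k. \<Sum>i\<in>idx k. (cnj (T k i m g) * T k i j g) * (Y k j x * cnj (Y k m y)))"
    by (rule sum.cong[OF refl]) (rule sum.swap)
  also have "\<dots> = (\<Sum>j\<in>idx k. \<Sum>m\<in>idx k. (if m = j then Y k j x * cnj (Y k m y) else 0))"
    by (intro sum.cong refl) (simp add: sum_distrib_right[symmetric] T_unitary_columns g)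
  also have "\<dots> = Z k x y" unfolding Z_def by simp
  finally show ?thesis .
qed

lemma Z_harmonic: "spherical_harmonic k (\<lambda>x. Z k x y)"
  using spherical_harmonic_sum[of "idx k" k "Y k" "\<lambda>i. cnj (Y k i y)"] Y_harmonic
  by (simp add: Z_def mult.commute)

text \<open>Invariance and transitivity make the diagonal constant, and its integral counts the 2 k
  + 1 orthonormal basis elements.\<close>

lemma Z_diag:
  assumes x: "x \<in> sphere 0 1"
  shows "Z k x x = of_nat (2 * k + 1) / of_real (4 * pi)"
proof -
  have const: "Z k y y = Z k x x" if y: "y \<in> sphere 0 1" for y
  proof -
    obtain g where g: "g \<in> SO3" "g *v x = y" by (rule SO3_transitive[OF x y])
    then show ?thesis using Z_rotate[OF SO3_inv[OF g(1)] x x] by simp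
  qed
  have "of_real (4 * pi) * Z k x x = (\<integral>y. Z k x x \<partial>sphere_measure)"
    by (simp add: measure_sphere_measure scaleR_conv_of_real)
  also have "\<dots> = (\<integral>y. Z k y y \<partial>sphere_measure)"
    by (rule Bochner_Integration.integral_cong) (simp_all add: const)
  also have "\<dots> = (\<Sum>i\<in>idx k. sinner (Y k i) (Y k i))"
    unfolding Z_def l2_inner_def
    by (rule Bochner_Integration.integral_sum) (auto intro: integrable_inner_sphere Y_bounded)
  also have "\<dots> = of_nat (2 * k + 1)" by (simp add: Y_inner)
  finally show ?thesis by (simp add: field_simps)
qed

lemma harmonic_parseval:
  assumes "spherical_harmonic k \<phi>" "spherical_harmonic k \<psi>"
  shows "sinner \<phi> \<psi> = (\<Sum>i\<in>idx k. sinner \<phi> (Y k i) * cnj (sinner \<psi> (Y k i)))"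
proof -
  have "sinner \<phi> \<psi> = sinner (\<lambda>x. \<Sum>i\<in>idx k. sinner \<phi> (Y k i) * Y k i x) \<psi>"
    by (rule sinner_cong) (simp_all add: harmonic_expand[OF assms(1)])
  also have "\<dots> = (\<Sum>i\<in>idx k. sinner \<phi> (Y k i) * sinner (Y k i) \<psi>)"
    by (rule sinner_sum_left) (auto intro: Y_bounded spherical_harmonic_bounded assms)
  finally show ?thesis by (simp add: sinner_cnj[of \<psi>])
qed

end

section \<open>Weight vectors\<close>

text \<open>A square matrix with orthonormal rows is unitary, for arbitrary index sets of equal
  size. \<open>D\<close> is the orthogonal projection onto the span of the conjugated rows; the
  squared Hilbert-Schmidt norm of its complement \<open>E\<close> equals the trace of
  \<open>E\<close>, that is \<open>card I - card J\<close>.\<close>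

lemma orthonormal_rows_imp_columns:
  fixes c :: "'a \<Rightarrow> 'b \<Rightarrow> complex"
  assumes fin: "finite I" "finite J" and card: "card I = card J"
    and rows: "\<And>j m. j \<in> J \<Longrightarrow> m \<in> J \<Longrightarrow> (\<Sum>i\<in>I. c j i * cnj (c m i)) = (if j = m then 1 else 0)"
    and im: "i \<in> I" "m \<in> I"
  shows "(\<Sum>j\<in>J. cnj (c j i) * c j m) = (if i = m then 1 else 0)"
proof -
  define D where "D i m = (\<Sum>j\<in>J. cnj (c j i) * c j m)" for i m
  define E where "E i m = (if i = m then 1 else 0) - D i m" for i m
  have cnjD: "cnj (D i m) = D m i" for i m
    by (simp add: D_def mult.commute)
  have DD: "(\<Sum>m\<in>I. D i m * cnj (D i m)) = D i i" for i
  proof -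
    have "(\<Sum>m\<in>I. D i m * cnj (D i m)) = (\<Sum>m\<in>I. \<Sum>j\<in>J. \<Sum>l\<in>J. (cnj (c j i) * c l i) * (c j m * cnj (c l m)))"
      by (simp add: D_def sum_product mult_ac)
    also have "\<dots> = (\<Sum>j\<in>J. \<Sum>m\<in>I. \<Sum>l\<in>J. (cnj (c j i) * c l i) * (c j m * cnj (c l m)))"
      by (rule sum.swap)
    also have "\<dots> = (\<Sum>j\<in>J. \<Sum>l\<in>J. \<Sum>m\<in>I. (cnj (c j i) * c l i) * (c j m * cnj (c l m)))"
      by (rule sum.cong[OF refl]) (rule sum.swap)
    also have "\<dots> = (\<Sum>j\<in>J. \<Sum>l\<in>J. if j = l then cnj (c j i) * c l i else 0)"
      by (intro sum.cong refl) (simp add: sum_distrib_left[symmetric] rows)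
    also have "\<dots> = D i i" using fin by (simp add: D_def)
    finally show ?thesis .
  qed
  have EE: "(\<Sum>m\<in>I. E i m * cnj (E i m)) = 1 - D i i" if "i \<in> I" for i
  proof -
    have "(\<Sum>m\<in>I. E i m * cnj (E i m))
        = (\<Sum>m\<in>I. (if i = m then 1 - D i m - cnj (D i m) else 0) + D i m * cnj (D i m))"
      by (rule sum.cong) (auto simp: E_def algebra_simps)
    also have "\<dots> = 1 - D i i"
      using that fin by (simp add: sum.distrib DD[unfolded cnjD] cnjD)
    finally show ?thesis .
  qed
  have "(\<Sum>i\<in>I. D i i) = (\<Sum>j\<in>J. \<Sum>i\<in>I. c j i * cnj (c j i))"
    unfolding D_def by (subst sum.swap) (simp add: mult.commute)
  also have "\<dots> = of_nat (card J)" by (simp add: rows)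
  \<comment> \<open>Equal cardinalities enter here. A vanishing sum of squared moduli forces every
    entry of \<open>E\<close> to vanish.\<close>
  finally have "(\<Sum>i\<in>I. \<Sum>m\<in>I. E i m * cnj (E i m)) = 0"
    by (simp add: EE sum_subtractf card)
  then have "complex_of_real (\<Sum>i\<in>I. \<Sum>m\<in>I. (cmod (E i m))\<^sup>2) = 0"
    unfolding of_real_sum complex_norm_square .
  then have "(\<Sum>i\<in>I. \<Sum>m\<in>I. (cmod (E i m))\<^sup>2) = 0" by (simp only: of_real_eq_0_iff)
  then have "(\<Sum>m\<in>I. (cmod (E i m))\<^sup>2) = 0"
    using im fin by (subst (asm) sum_nonneg_eq_0_iff) (auto intro: sum_nonneg)
  then have "(cmod (E i m))\<^sup>2 = 0"
    using im fin by (subst (asm) sum_nonneg_eq_0_iff) auto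
  then show ?thesis by (simp add: E_def D_def)
qed

text \<open>The value of \<open>weight_poly x\<close> at \<open>s\<close> is \<open>w \<bullet> x\<close> for the isotropic vector
  \<open>w = (1 - s\<^sup>2, \<i> (1 + s\<^sup>2), 2 s)\<close>.  Powers of isotropic linear forms are harmonic, hence so are the
  coefficients of \<open>weight_poly x ^ k\<close>; they are weight vectors for the rotations about the third axis.\<close>

definition weight_poly :: "real^3 \<Rightarrow> complex poly" where
  "weight_poly x = [:Complex (x $ 1) (x $ 2), of_real (2 * x $ 3), - Complex (x $ 1) (- x $ 2):]"

definition weight_harmonic :: "nat \<Rightarrow> nat \<Rightarrow> real^3 \<Rightarrow> complex" where
  "weight_harmonic k j x = coeff (weight_poly x ^ k) j"

lemma degree_weight_poly_power: "degree (weight_poly x ^ k) \<le> 2 * k"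
proof -
  have "degree (weight_poly x) \<le> 2"
    unfolding weight_poly_def by (auto intro: order_trans[OF degree_pCons_le] simp: numeral_2_eq_2)
  then show ?thesis
    using degree_power_le[of "weight_poly x" k] mult_le_mono1[of "degree (weight_poly x)" 2 k] by linarith
qed

lemma poly_weight_poly_power:
  "poly (weight_poly x ^ k) s = (\<Sum>j\<in>{..2*k}. s ^ j * weight_harmonic k j x)"
proof -
  have "poly (weight_poly x ^ k) s = (\<Sum>j\<le>degree (weight_poly x ^ k). coeff (weight_poly x ^ k) j * s ^ j)"
    by (rule poly_altdef)
  also have "\<dots> = (\<Sum>j\<in>{..2*k}. coeff (weight_poly x ^ k) j * s ^ j)"
    using degree_weight_poly_power[of x k]
    by (intro sum.mono_neutral_left) (auto simp: coeff_eq_0)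
  finally show ?thesis by (simp add: weight_harmonic_def mult.commute)
qed

lemma polynomial_function_times:
  fixes P Q :: "'a::real_normed_vector \<Rightarrow> complex"
  assumes "polynomial_function P" "polynomial_function Q"
  shows "polynomial_function (\<lambda>x. P x * Q x)"
proof -
  have c: "polynomial_function F \<longleftrightarrow> real_polynomial_function (\<lambda>x. Re (F x)) \<and> real_polynomial_function (\<lambda>x. Im (F x))"
    for F :: "'a \<Rightarrow> complex"
    by (auto simp: polynomial_function_iff_Basis_inner Basis_complex_def inner_complex_def)
  show ?thesis using assms unfolding c by (auto intro!: real_polynomial_function_diff real_polynomial_function.intros(3,4))
qed

lemma polynomial_function_of_real_nth: "polynomial_function (\<lambda>x::real^3. complex_of_real (x $ i))"
  by (intro polynomial_function_bounded_linear bounded_linear_compose[OF bounded_linear_of_real bounded_linear_vec_nth])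

lemma polynomial_function_weight_harmonic: "polynomial_function (weight_harmonic k j)"
proof (induction k arbitrary: j)
  case 0
  show ?case by (simp add: weight_harmonic_def[abs_def])
next
  case (Suc k)
  have q: "polynomial_function (\<lambda>x. coeff (weight_poly x) i)" for i
  proof -
    have C: "Complex a b = of_real a + \<i> * of_real b" for a b by (simp add: complex_eq_iff)
    note intros = polynomial_function_add polynomial_function_minus polynomial_function_cmult
      polynomial_function_of_real_nth
    have m: "polynomial_function (\<lambda>x::real^3. of_real (x $ 1) + \<i> * of_real (x $ 2) :: complex)"
      "polynomial_function (\<lambda>x::real^3. of_real (2 * x $ 3) :: complex)"
      "polynomial_function (\<lambda>x::real^3. - (of_real (x $ 1) + \<i> * of_real (- x $ 2)) :: complex)"
      unfolding of_real_mult of_real_minus by (intro intros)+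
    show ?thesis
    proof (cases "i < 3")
      case True
      then consider "i = 0" | "i = 1" | "i = 2" by linarith
      then show ?thesis using m
        by cases (simp_all add: weight_poly_def C numeral_2_eq_2)
    next
      case False
      then have "coeff (weight_poly x) i = 0" for x
        using degree_weight_poly_power[of x 1] by (intro coeff_eq_0) simp
      then show ?thesis by simp
    qed
  qed
  have "weight_harmonic (Suc k) j = (\<lambda>x. \<Sum>i\<le>j. coeff (weight_poly x) i * weight_harmonic k (j - i) x)"
    by (simp add: weight_harmonic_def fun_eq_iff coeff_mult)
  then show ?case
    using Suc.IH q by (auto intro!: polynomial_function_sum polynomial_function_times)
qed

lemma weight_poly_scale: "weight_poly (r *\<^sub>R x) = smult (of_real r) (weight_poly x)"
  by (simp add: weight_poly_def complex_eq_iff)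

lemma weight_harmonic_scale: "weight_harmonic k j (r *\<^sub>R x) = r ^ k *\<^sub>R weight_harmonic k j x"
  unfolding weight_harmonic_def weight_poly_scale smult_power by (simp add: scaleR_conv_of_real)

lemma weight_poly_rotate:
  "weight_poly (axis_rotation 3 \<theta> *v x) = smult (cis \<theta>) (pcompose (weight_poly x) [:0, cis (- \<theta>):])"
proof -
  have "cos \<theta> * cos \<theta> + sin \<theta> * sin \<theta> = 1" by simp
  then show ?thesis
    apply (simp del: sin_cos_squared_add3 add: weight_poly_def axis_rotation_entries matrix_vector_mult_def sum_3 pcompose_pCons complex_eq_iff)
    apply (intro conjI; algebra)
    done
qed

text \<open>Rotating \<open>x\<close> substitutes \<open>cis (- \<theta>)\<close> times the variable
  into \<open>weight_poly x\<close> and multiplies it by \<open>cis \<theta>\<close>. The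
  \<open>k\<close>-th power and the \<open>j\<close>-th coefficient contribute \<open>k\<close> and
  \<open>- j\<close> to the weight.\<close>

lemma weight_harmonic_rotate:
  "weight_harmonic k j (axis_rotation 3 \<theta> *v x) = cis ((real k - real j) * \<theta>) * weight_harmonic k j x"
proof -
  have p: "pcompose p [:0, c:] ^ k = pcompose (p ^ k) [:0, c:]" for p :: "complex poly" and c
    by (induction k) (simp_all add: pcompose_mult pcompose_1)
  have "weight_harmonic k j (axis_rotation 3 \<theta> *v x)
      = cis \<theta> ^ k * (cis (- \<theta>) ^ j * weight_harmonic k j x)"
    unfolding weight_harmonic_def weight_poly_rotate smult_power p by (simp add: coeff_pcompose_linear)
  also have "cis \<theta> ^ k * (cis (- \<theta>) ^ j * weight_harmonic k j x) = (cis \<theta> ^ k * cis (- \<theta>) ^ j) * weight_harmonic k j x"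
    by simp
  also have "cis \<theta> ^ k * cis (- \<theta>) ^ j = cis ((real k - real j) * \<theta>)"
    by (simp only: Complex.DeMoivre cis_mult) (simp add: algebra_simps)
  finally show ?thesis .
qed

text \<open>Each second derivative is the same function times the square of the corresponding
  component of \<open>w\<close>, and these squares add up to zero.\<close>

lemma laplacian_isotropic_power:
  assumes w: "w 1 * w 1 + w 2 * w 2 + w 3 * w 3 = (0::complex)"
  defines "l \<equiv> \<lambda>x::real^3. of_real (x $ 1) * w 1 + of_real (x $ 2) * w 2 + of_real (x $ 3) * w (3::3)"
  shows "laplacian (\<lambda>x. l x ^ k) x = 0"
proof -
  have ld: "(l has_derivative l) (at x)" for x
  proof -
    have "bounded_linear l" unfolding l_def
      by (intro bounded_linear_add bounded_linear_compose[OF bounded_linear_mult_left]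
          bounded_linear_compose[OF bounded_linear_of_real bounded_linear_vec_nth])
    then show ?thesis by (rule bounded_linear_imp_has_derivative)
  qed
  have lp: "polynomial_function (\<lambda>x. l x ^ n)" for n
  proof (induction n)
    case (Suc n)
    have "polynomial_function l"
      using ld[of 0] by (intro polynomial_function_bounded_linear has_derivative_bounded_linear)
    from polynomial_function_times[OF this Suc] show ?case by simp
  qed simp
  have la: "l (axis i 1) = w i" for i
    unfolding l_def using exhaust_3[of i] by (auto simp: axis_def)
  have d: "dirderiv (axis i 1) (\<lambda>x. l x ^ n) = (\<lambda>x. of_nat n * w i * l x ^ (n - 1))" for i n
  proof
    fix x
    have "((\<lambda>x. l x ^ n) has_derivative (\<lambda>v. of_nat n * l v * l x ^ (n - 1))) (at x)"
      by (rule has_derivative_power[OF ld])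
    from dirderivI[OF this] show "dirderiv (axis i 1) (\<lambda>x. l x ^ n) x = of_nat n * w i * l x ^ (n - 1)"
      by (simp add: la)
  qed
  have dd: "pd i (pd i (\<lambda>x. l x ^ k)) x = (of_nat k * of_nat (k - 1) * l x ^ (k - 1 - 1)) * (w i * w i)" for i
  proof -
    have "pd i (pd i (\<lambda>x. l x ^ k)) x = of_nat k * w i * pd i (\<lambda>x. l x ^ (k - 1)) x"
      unfolding d[of i k] by (rule dirderiv_cmult[OF lp])
    then show ?thesis by (simp add: d)
  qed
  show ?thesis
    unfolding laplacian_polynomial[OF lp] dd distrib_left[symmetric] w by simp
qed

lemma laplacian_sum:
  fixes P :: "'i \<Rightarrow> real^3 \<Rightarrow> complex"
  assumes "\<And>i. i \<in> I \<Longrightarrow> polynomial_function (P i)"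
  shows "laplacian (\<lambda>x. \<Sum>i\<in>I. c i * P i x) x = (\<Sum>i\<in>I. c i * laplacian (P i) x)"
proof -
  have z: "laplacian (\<lambda>x::real^3. 0::complex) x = 0"
    using laplacian_cmult[of "\<lambda>x. 0" 0 x] by simp
  show ?thesis using assms
  proof (induction I rule: infinite_finite_induct)
    case (insert i I)
    have "polynomial_function (\<lambda>x. \<Sum>i\<in>I. c i * P i x)"
      using insert by (intro polynomial_function_sum polynomial_function_cmult) auto
    with insert show ?case by (simp add: laplacian_add laplacian_cmult polynomial_function_cmult)
  qed (simp_all add: z)
qed

text \<open>For every \<open>s\<close> the sum over \<open>j\<close> is a power of an isotropic
  linear form and hence harmonic. The Laplacians are thus the coefficients of a polynomial in
  \<open>s\<close> that vanishes identically.\<close>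

lemma weight_harmonic_laplacian:
  assumes "j \<le> 2 * k"
  shows "laplacian (weight_harmonic k j) x = 0"
proof -
  have "(\<Sum>j\<le>2*k. laplacian (weight_harmonic k j) x * s ^ j) = 0" for s
  proof -
    define w :: "3 \<Rightarrow> complex" where "w i = (if i = 1 then 1 - s\<^sup>2 else if i = 2 then \<i> * (1 + s\<^sup>2) else 2 * s)" for i
    have w: "w 1 * w 1 + w 2 * w 2 + w 3 * w 3 = 0"
      by (simp add: w_def power2_eq_square algebra_simps)
    have C: "Complex a b = of_real a + \<i> * of_real b" for a b by (simp add: complex_eq_iff)
    have eq: "poly (weight_poly x ^ k) s = (of_real (x $ 1) * w 1 + of_real (x $ 2) * w 2 + of_real (x $ 3) * w 3) ^ k" for x
      by (simp add: weight_poly_def w_def C power2_eq_square algebra_simps)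
    have "(\<Sum>j\<le>2*k. s ^ j * laplacian (weight_harmonic k j) x)
        = laplacian (\<lambda>x. \<Sum>j\<le>2*k. s ^ j * weight_harmonic k j x) x"
      by (rule laplacian_sum[symmetric]) (rule polynomial_function_weight_harmonic)
    also have "\<dots> = laplacian (\<lambda>x. poly (weight_poly x ^ k) s) x"
      by (simp only: poly_weight_poly_power)
    also have "\<dots> = 0" unfolding eq by (rule laplacian_isotropic_power[of w, OF w])
    finally show ?thesis by (simp add: mult.commute)
  qed
  then show ?thesis using polyfun_eq_0[of "\<lambda>j. laplacian (weight_harmonic k j) x" "2 * k"] assms by auto
qed

lemma harmonic_poly_weight_harmonic: "j \<le> 2 * k \<Longrightarrow> harmonic_poly k (weight_harmonic k j)"
  by (simp add: harmonic_poly_def polynomial_function_weight_harmonic weight_harmonic_scale weight_harmonic_laplacian)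

text \<open>On the vectors (1, 0, c) the form is 1 + 2 c s - s^2, so the value is a polynomial in
  \<open>c\<close> with coefficients \<open>A b\<close>. The coefficient for \<open>b = j\<close>
  (if \<open>j \<le> k\<close>) or \<open>b = 2 * k - j\<close> (otherwise) is nonzero, hence some
  real \<open>c\<close> is not a root; rescaling reaches the sphere.\<close>

lemma weight_harmonic_nonzero:
  assumes j: "j \<le> 2 * k"
  shows "\<exists>x\<in>sphere 0 1. weight_harmonic k j x \<noteq> 0"
proof -
  define A :: "nat \<Rightarrow> complex" where
    "A b = of_nat (k choose b) * coeff ([:0, 2:] ^ b * [:1, 0, - 1:] ^ (k - b)) j" for b
  have A: "A b = (if j < b then 0 else of_nat (k choose b) * (2 ^ b * coeff ([:1, 0, - 1:] ^ (k - b)) (j - b)))" for b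
  proof -
    have "[:0, 2:] ^ b = monom (2 ^ b :: complex) b"
    proof -
      have "[:0, 2:] = monom (2 :: complex) 1" by (simp add: monom_altdef)
      then show ?thesis by (simp add: monom_power)
    qed
    then show ?thesis by (simp add: A_def coeff_monom_mult)
  qed
  have wp: "weight_poly (vector [1, 0, c]) = smult (of_real c) [:0, 2:] + [:1, 0, - 1:]" for c
    by (simp add: weight_poly_def complex_eq_iff)
  have W: "weight_harmonic k j (vector [1, 0, c]) = (\<Sum>b\<le>k. A b * of_real c ^ b)" for c
    unfolding weight_harmonic_def wp binomial_ring smult_power coeff_sum A_def
    by (intro sum.cong refl) (simp add: of_nat_poly mult_ac)
  have "\<exists>b\<le>k. A b \<noteq> 0"
  proof (cases "j \<le> k")
    case True
    have "coeff ([:1, 0, - 1:] ^ n) 0 = (1::complex)" for n by (simp add: coeff_0_power)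
    then show ?thesis using True by (intro exI[of _ j]) (simp add: A)
  next
    case False
    \<comment> \<open>With \<open>b = 2 * k - j\<close> the index \<open>j - b\<close> is exactly
      the degree of the remaining power of 1 - s^2, so \<open>A b\<close> involves its leading
      coefficient.\<close>
    have deg: "degree ([:1, 0, - 1 :: complex:] ^ (j - k)) = 2 * (j - k)"
      using degree_power_eq[of "[:1, 0, - 1 :: complex:]" "j - k"] by simp
    have "lead_coeff ([:1, 0, - 1 :: complex:] ^ (j - k)) \<noteq> 0" by simp
    then have "coeff ([:1, 0, - 1 :: complex:] ^ (j - k)) (2 * (j - k)) \<noteq> 0"
      by (simp only: deg not_False_eq_True)
    moreover have "k - (2 * k - j) = j - k" "j - (2 * k - j) = 2 * (j - k)" "\<not> j < 2 * k - j" "2 * k - j \<le> k"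
      using False j by auto
    ultimately show ?thesis by (intro exI[of _ "2 * k - j"]) (simp add: A)
  qed
  then obtain b where "b \<le> k" "A b \<noteq> 0" by blast
  then have "finite {z. (\<Sum>b\<le>k. A b * z ^ b) = 0}"
    using Transcendental.polyfun_rootbound[of A b k] by blast
  moreover have "infinite (range complex_of_real)"
    using finite_imageD[of complex_of_real UNIV] by (auto simp: inj_on_def infinite_UNIV_char_0)
  ultimately have "\<not> range complex_of_real \<subseteq> {z. (\<Sum>b\<le>k. A b * z ^ b) = 0}"
    using finite_subset by blast
  then obtain c where "(\<Sum>b\<le>k. A b * of_real c ^ b) \<noteq> 0" by blast
  then have nz: "weight_harmonic k j (vector [1, 0, c]) \<noteq> 0" by (simp add: W)
  define v :: "real^3" where "v = vector [1, 0, c]"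
  have "v \<noteq> 0" by (simp add: v_def vec_eq_iff forall_3)
  then show ?thesis using nz weight_harmonic_scale[of k j "inverse (norm v)" v]
    by (intro bexI[of _ "v /\<^sub>R norm v"]) (auto simp: v_def[symmetric])
qed

section \<open>Zonal harmonics and characters\<close>

lemma spherical_harmonic_weight: "j \<le> 2 * k \<Longrightarrow> spherical_harmonic k (weight_harmonic k j)"
  using harmonic_poly_weight_harmonic unfolding spherical_harmonic_iff by blast

lemma weight_harmonic_bounded: "j \<le> 2 * k \<Longrightarrow> bounded_sphere (weight_harmonic k j)"
  using spherical_harmonic_weight spherical_harmonic_bounded by blast

lemma axis_rotation_3_stabilizer: "axis_rotation 3 \<theta> \<in> stabilizer (axis 3 1)"
  by (simp add: stabilizer_def axis_rotation_vec cross3_simps axis_def)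

lemma weight_orthogonal:
  assumes j: "j \<le> 2 * k" and \<phi>: "bounded_sphere \<phi>"
    and inv: "\<And>\<theta> x. x \<in> sphere 0 1 \<Longrightarrow> \<phi> (axis_rotation 3 \<theta> *v x) = cis ((real k - real m) * \<theta>) * \<phi> x"
    and "j \<noteq> m"
  shows "sinner \<phi> (weight_harmonic k j) = 0"
proof -
  \<comment> \<open>With this angle, rotating both arguments multiplies the inner product by
    \<open>cis pi\<close>, so it equals its own negative.\<close>
  define \<theta> where "\<theta> = pi / (real j - real m)"
  have "sinner \<phi> (weight_harmonic k j)
      = sinner (\<lambda>x. \<phi> (axis_rotation 3 \<theta> *v x)) (\<lambda>x. weight_harmonic k j (axis_rotation 3 \<theta> *v x))"
    by (rule sinner_rotate[symmetric]) (simp_all add: \<phi> weight_harmonic_bounded j)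
  also have "\<dots> = sinner (\<lambda>x. \<Sum>i\<in>{()}. (cis ((real k - real m) * \<theta>) * cis (- ((real k - real j) * \<theta>))) * \<phi> x)
      (weight_harmonic k j)"
    unfolding l2_inner_def
    by (rule Bochner_Integration.integral_cong) (simp_all add: inv weight_harmonic_rotate cis_cnj)
  also have "\<dots> = (cis ((real k - real m) * \<theta>) * cis (- ((real k - real j) * \<theta>))) * sinner \<phi> (weight_harmonic k j)"
    using sinner_sum_left[of "{()}" "\<lambda>_. \<phi>"] \<phi> weight_harmonic_bounded[OF j] by simp
  also have "cis ((real k - real m) * \<theta>) * cis (- ((real k - real j) * \<theta>)) = cis pi"
  proof -
    have "(real k - real m) * \<theta> + - ((real k - real j) * \<theta>) = (real j - real m) * \<theta>"
      by (simp add: algebra_simps)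
    also have "\<dots> = pi" using \<open>j \<noteq> m\<close> by (simp add: \<theta>_def)
    finally show ?thesis by (simp only: cis_mult)
  qed
  finally show ?thesis by simp
qed

context sphere_basis
begin

lemma weight_norm_positive:
  assumes "j \<le> 2 * k"
  shows "\<exists>r>0. sinner (weight_harmonic k j) (weight_harmonic k j) = complex_of_real (r\<^sup>2)"
proof -
  let ?h = "weight_harmonic k j"
  let ?s = "\<Sum>i\<in>idx k. (cmod (sinner ?h (Y k i)))\<^sup>2"
  have sh: "spherical_harmonic k ?h" by (rule spherical_harmonic_weight[OF assms])
  have eq: "sinner ?h ?h = complex_of_real ?s"
    unfolding of_real_sum complex_norm_square by (rule harmonic_parseval[OF sh sh])
  have "?s \<noteq> 0"
  proof
    assume "?s = 0"
    then have "\<forall>i\<in>idx k. sinner ?h (Y k i) = 0" by (simp add: sum_nonneg_eq_0_iff)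
    then have "\<forall>x\<in>sphere 0 1. ?h x = 0" using harmonic_expand[OF sh] by simp
    then show False using weight_harmonic_nonzero[OF assms] by blast
  qed
  then have "?s > 0" by (simp add: less_le sum_nonneg)
  then show ?thesis using eq by (intro exI[of _ "sqrt ?s"]) simp
qed

definition weight_norm :: "nat \<Rightarrow> nat \<Rightarrow> real" where
  "weight_norm k j = (SOME r. r > 0 \<and> sinner (weight_harmonic k j) (weight_harmonic k j) = complex_of_real (r\<^sup>2))"

lemma weight_norm:
  assumes "j \<le> 2 * k"
  shows "weight_norm k j > 0"
    "sinner (weight_harmonic k j) (weight_harmonic k j) = complex_of_real ((weight_norm k j)\<^sup>2)"
  unfolding weight_norm_def using someI_ex[OF weight_norm_positive[OF assms]] by auto

text \<open>The change-of-basis matrix from the \<open>Y k i\<close> to the normalized weight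
  vectors.\<close>

definition weight_coeff :: "nat \<Rightarrow> nat \<Rightarrow> nat \<Rightarrow> complex" where
  "weight_coeff k j i = sinner (weight_harmonic k j) (Y k i) / of_real (weight_norm k j)"

lemma weight_coeff_rows:
  assumes "j \<in> {..2*k}" "m \<in> {..2*k}"
  shows "(\<Sum>i\<in>idx k. weight_coeff k j i * cnj (weight_coeff k m i)) = (if j = m then 1 else 0)"
proof -
  have "(\<Sum>i\<in>idx k. weight_coeff k j i * cnj (weight_coeff k m i))
      = sinner (weight_harmonic k j) (weight_harmonic k m) / of_real (weight_norm k j * weight_norm k m)"
    using assms
    by (simp add: weight_coeff_def sum_divide_distrib
        harmonic_parseval[OF spherical_harmonic_weight spherical_harmonic_weight, of j k m])
  also have "\<dots> = (if j = m then 1 else 0)"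
  proof (cases "j = m")
    case True
    then show ?thesis using weight_norm[of j k] assms by (simp add: power2_eq_square)
  next
    case False
    then have "sinner (weight_harmonic k j) (weight_harmonic k m) = 0"
      using assms by (intro weight_orthogonal[where m=j]) (auto simp: weight_harmonic_rotate weight_harmonic_bounded)
    with False show ?thesis by simp
  qed
  finally show ?thesis .
qed

text \<open>The dimension count enters here: there are as many weights as basis elements, so the
  orthonormal rows form a unitary matrix and the weight vectors span all harmonics of degree
  \<open>k\<close>.\<close>

lemma weight_coeff_columns:
  assumes "i \<in> idx k" "m \<in> idx k"
  shows "(\<Sum>j\<in>{..2*k}. cnj (weight_coeff k j i) * weight_coeff k j m) = (if i = m then 1 else 0)"
  by (rule orthonormal_rows_imp_columns[of "idx k"]) (use assms weight_coeff_rows in auto)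

lemma Y_weight_expand:
  assumes "i \<in> idx k" "x \<in> sphere 0 1"
  shows "Y k i x = (\<Sum>j\<in>{..2*k}. cnj (weight_coeff k j i) / of_real (weight_norm k j) * weight_harmonic k j x)"
proof -
  have "(\<Sum>j\<in>{..2*k}. cnj (weight_coeff k j i) / of_real (weight_norm k j) * weight_harmonic k j x)
      = (\<Sum>j\<in>{..2*k}. \<Sum>m\<in>idx k. cnj (weight_coeff k j i) * weight_coeff k j m * Y k m x)"
    using assms(2) by (intro sum.cong refl)
      (simp add: harmonic_expand[OF spherical_harmonic_weight, of _ k x] weight_coeff_def sum_distrib_left sum_divide_distrib mult_ac)
  also have "\<dots> = (\<Sum>m\<in>idx k. (\<Sum>j\<in>{..2*k}. cnj (weight_coeff k j i) * weight_coeff k j m) * Y k m x)"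
    by (subst sum.swap) (simp add: sum_distrib_right)
  also have "\<dots> = (\<Sum>m\<in>idx k. if i = m then Y k m x else 0)"
    by (intro sum.cong refl) (simp add: weight_coeff_columns assms)
  finally show ?thesis using assms by simp
qed

text \<open>Invariance under all rotations about the third axis means weight zero, which is the
  index \<open>k\<close> among \<open>0..2 * k\<close>. Orthogonality of different weights removes
  every other coefficient.\<close>

lemma zonal_multiple:
  assumes \<phi>: "spherical_harmonic k \<phi>"
    and inv: "\<And>h x. h \<in> stabilizer (axis 3 1) \<Longrightarrow> x \<in> sphere 0 1 \<Longrightarrow> \<phi> (h *v x) = \<phi> x"
  obtains c where "\<And>x. x \<in> sphere 0 1 \<Longrightarrow> \<phi> x = c * weight_harmonic k k x"
proof -
  have b: "bounded_sphere \<phi>" by (rule spherical_harmonic_bounded[OF \<phi>])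
  let ?d = "\<lambda>j. (\<Sum>i\<in>idx k. sinner \<phi> (Y k i) * cnj (weight_coeff k j i)) / of_real (weight_norm k j)"
  have d0: "?d j = 0" if "j \<in> {..2*k}" "j \<noteq> k" for j
  proof -
    have "sinner \<phi> (weight_harmonic k j) = 0"
      using that b by (intro weight_orthogonal[where m=k]) (auto simp: inv axis_rotation_3_stabilizer)
    moreover have "(\<Sum>i\<in>idx k. sinner \<phi> (Y k i) * cnj (weight_coeff k j i))
        = sinner \<phi> (weight_harmonic k j) / of_real (weight_norm k j)"
      using that by (simp add: weight_coeff_def harmonic_parseval[OF \<phi>] spherical_harmonic_weight sum_divide_distrib)
    ultimately show ?thesis by simp
  qed
  show thesis
  proof (rule that[of "?d k"])
    fix x :: "real^3" assume x: "x \<in> sphere 0 1"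
    have "\<phi> x = (\<Sum>i\<in>idx k. \<Sum>j\<in>{..2*k}. sinner \<phi> (Y k i) * (cnj (weight_coeff k j i) / of_real (weight_norm k j) * weight_harmonic k j x))"
      using harmonic_expand[OF \<phi> x] by (simp add: Y_weight_expand[OF _ x] sum_distrib_left)
    also have "\<dots> = (\<Sum>j\<in>{..2*k}. ?d j * weight_harmonic k j x)"
      by (subst sum.swap) (simp add: sum_divide_distrib sum_distrib_left mult_ac)
    also have "\<dots> = (\<Sum>j\<in>{k}. ?d j * weight_harmonic k j x)"
      using d0 by (intro sum.mono_neutral_right) auto
    finally show "\<phi> x = ?d k * weight_harmonic k k x" by simp
  qed
qed

text \<open>Multiplicity one of the trivial representation of the stabilizer: this is where the
  irreducibility of the spaces of spherical harmonics enters.\<close>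

lemma zonal_unique_axis:
  assumes \<phi>: "spherical_harmonic k \<phi>"
    and inv: "\<And>h x. h \<in> stabilizer (axis 3 1) \<Longrightarrow> x \<in> sphere 0 1 \<Longrightarrow> \<phi> (h *v x) = \<phi> x"
    and x: "x \<in> sphere 0 1"
  shows "\<phi> x = \<phi> (axis 3 1) / Z k (axis 3 1) (axis 3 1) * Z k x (axis 3 1)"
proof -
  let ?e = "axis 3 1 :: real^3"
  have e: "?e \<in> sphere 0 1" by simp
  obtain c where c: "\<And>x. x \<in> sphere 0 1 \<Longrightarrow> \<phi> x = c * weight_harmonic k k x"
    using zonal_multiple[OF \<phi> inv] by blast
  have Zinv: "Z k (h *v x) ?e = Z k x ?e" if h: "h \<in> stabilizer ?e" and x: "x \<in> sphere 0 1" for h x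
  proof -
    have hS: "h \<in> SO3" "h *v ?e = ?e" using h by (auto simp: stabilizer_def)
    show ?thesis using Z_rotate[OF SO3_inv[OF hS(1)] x e] hS by simp
  qed
  obtain d where d: "\<And>x. x \<in> sphere 0 1 \<Longrightarrow> Z k x ?e = d * weight_harmonic k k x"
    using zonal_multiple[OF Z_harmonic Zinv] by blast
  have "Z k ?e ?e \<noteq> 0"
    unfolding Z_diag[OF e] by (simp only: divide_eq_0_iff of_nat_eq_0_iff of_real_eq_0_iff) simp
  then have "d \<noteq> 0" "weight_harmonic k k ?e \<noteq> 0" using d[OF e] by auto
  then show ?thesis using c[OF x] c[OF e] d[OF x] d[OF e] by simp
qed

text \<open>A rotation taking the third axis to \<open>y\<close> conjugates the two stabilizers,
  which reduces the claim to \<open>zonal_unique_axis\<close>.\<close>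

lemma zonal_unique:
  assumes \<phi>: "spherical_harmonic k \<phi>" and y: "y \<in> sphere 0 1"
    and inv: "\<And>h x. h \<in> stabilizer y \<Longrightarrow> x \<in> sphere 0 1 \<Longrightarrow> \<phi> (h *v x) = \<phi> x"
    and x: "x \<in> sphere 0 1"
  shows "\<phi> x = \<phi> y / Z k y y * Z k x y"
proof -
  let ?e = "axis 3 1 :: real^3"
  have e: "?e \<in> sphere 0 1" by simp
  obtain a where a: "a \<in> SO3" "a *v ?e = y" by (rule SO3_transitive[OF e y])
  have "(\<lambda>x. \<phi> (a *v x)) (matrix_inv a *v x)
      = \<phi> (a *v ?e) / Z k ?e ?e * Z k (matrix_inv a *v x) ?e"
  proof (rule zonal_unique_axis[OF spherical_harmonic_rotate[OF \<phi> a(1)]])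
    fix h z assume h: "h \<in> stabilizer ?e" and z: "z \<in> sphere (0::real^3) 1"
    have hS: "h \<in> SO3" "h *v ?e = ?e" using h by (auto simp: stabilizer_def)
    have "a ** h ** matrix_inv a \<in> stabilizer y"
      using a hS by (auto simp: stabilizer_def SO3_mult SO3_inv simp flip: matrix_vector_mul_assoc)
    from inv[OF this, of "a *v z"] show "\<phi> (a *v (h *v z)) = \<phi> (a *v z)"
      using a(1) z by (simp flip: matrix_vector_mul_assoc)
  qed (use x a in \<open>simp add: SO3_inv\<close>)
  moreover have "Z k ?e ?e = Z k y y" by (simp only: Z_diag e y)
  moreover have "Z k (matrix_inv a *v x) ?e = Z k x y"
    using Z_rotate[OF a(1) x y] a by auto
  ultimately show ?thesis using a by simp
qed

section \<open>Characters and their dependence on the trace\<close>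

definition char :: "nat \<Rightarrow> real^3^3 \<Rightarrow> complex" where
  "char k g = (\<Sum>i\<in>idx k. T k i i g)"

lemma char_conj:
  assumes "a \<in> SO3" "g \<in> SO3"
  shows "char k (a ** g ** matrix_inv a) = char k g"
proof -
  have "char k (a ** g ** matrix_inv a)
      = (\<Sum>i\<in>idx k. \<Sum>m\<in>idx k. \<Sum>n\<in>idx k. (cnj (T k m i a) * T k n i a) * T k m n g)"
    using assms
    by (simp add: char_def T_mult SO3_mult SO3_inv T_inv sum_distrib_left mult_ac)
  also have "\<dots> = (\<Sum>m\<in>idx k. \<Sum>i\<in>idx k. \<Sum>n\<in>idx k. (cnj (T k m i a) * T k n i a) * T k m n g)"
    by (rule sum.swap)
  also have "\<dots> = (\<Sum>m\<in>idx k. \<Sum>n\<in>idx k. \<Sum>i\<in>idx k. (cnj (T k m i a) * T k n i a) * T k m n g)"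
    by (rule sum.cong[OF refl]) (rule sum.swap)
  also have "\<dots> = (\<Sum>m\<in>idx k. \<Sum>n\<in>idx k. if n = m then T k m n g else 0)"
    using assms(1) T_unitary_rows
    by (intro sum.cong refl) (simp add: sum_distrib_right[symmetric] mult.commute[of "cnj _"])
  also have "\<dots> = char k g" by (simp add: char_def)
  finally show ?thesis .
qed

text \<open>The trace is evaluated in the weight basis, where rotations about the third axis are
  diagonal.\<close>

lemma char_axis_rotation:
  "char k (axis_rotation 3 \<theta>) = (\<Sum>j\<in>{..2*k}. cis ((real j - real k) * \<theta>))"
proof -
  let ?w = "\<lambda>j. cis ((real j - real k) * \<theta>)"
  have T: "T k i i (axis_rotation 3 \<theta>) = (\<Sum>j\<in>{..2*k}. cnj (weight_coeff k j i) * weight_coeff k j i * ?w j)"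
    if i: "i \<in> idx k" for i
  proof -
    have "T k i i (axis_rotation 3 \<theta>) = sinner (\<lambda>x. Y k i (axis_rotation 3 (- \<theta>) *v x)) (Y k i)"
      by (simp add: wigner_matcoef matcoef_def axis_rotation_inv)
    also have "\<dots> = sinner (\<lambda>x. \<Sum>j\<in>{..2*k}. (cnj (weight_coeff k j i) / of_real (weight_norm k j) * ?w j) * weight_harmonic k j x) (Y k i)"
    proof (rule sinner_cong)
      fix x :: "real^3" assume "x \<in> sphere 0 1"
      then have "axis_rotation 3 (- \<theta>) *v x \<in> sphere 0 1" by simp
      from Y_weight_expand[OF i this]
      show "Y k i (axis_rotation 3 (- \<theta>) *v x)
          = (\<Sum>j\<in>{..2*k}. (cnj (weight_coeff k j i) / of_real (weight_norm k j) * ?w j) * weight_harmonic k j x)"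
        by (simp add: weight_harmonic_rotate algebra_simps)
    qed simp
    also have "\<dots> = (\<Sum>j\<in>{..2*k}. (cnj (weight_coeff k j i) / of_real (weight_norm k j) * ?w j) * sinner (weight_harmonic k j) (Y k i))"
      by (rule sinner_sum_left) (auto intro: weight_harmonic_bounded Y_bounded[OF i])
    finally show ?thesis by (simp add: weight_coeff_def mult_ac)
  qed
  have "char k (axis_rotation 3 \<theta>) = (\<Sum>j\<in>{..2*k}. (\<Sum>i\<in>idx k. weight_coeff k j i * cnj (weight_coeff k j i)) * ?w j)"
    unfolding char_def using T by (simp, subst sum.swap) (simp add: sum_distrib_left mult.commute)
  also have "\<dots> = (\<Sum>j\<in>{..2*k}. ?w j)"
    by (intro sum.cong refl) (simp add: weight_coeff_rows)
  finally show ?thesis .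
qed

end

text \<open>The Dirichlet kernel. Its values are real numbers by type, and this is the source of
  \<open>char_real\<close>.\<close>

fun xchar :: "nat \<Rightarrow> real \<Rightarrow> real" where
  "xchar 0 \<theta> = 1"
| "xchar (Suc k) \<theta> = xchar k \<theta> + 2 * cos (real (Suc k) * \<theta>)"

lemma sum_cis_xchar: "(\<Sum>j\<in>{..2*k}. cis ((real j - real k) * \<theta>)) = complex_of_real (xchar k \<theta>)"
proof -
  have "(\<Sum>j\<in>{..2*k}. cis ((real j - real k) * \<theta>)) = (\<Sum>m\<in>{- int k..int k}. cis (real_of_int m * \<theta>))"
    by (rule sum.reindex_bij_witness[where i="\<lambda>m. nat (m + int k)" and j="\<lambda>j. int j - int k"]) auto
  also have "\<dots> = complex_of_real (xchar k \<theta>)"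
  proof (induction k)
    case (Suc k)
    have "{- int (Suc k)..int (Suc k)} = insert (int (Suc k)) (insert (- int (Suc k)) {- int k..int k})"
      by auto
    then have "(\<Sum>m\<in>{- int (Suc k)..int (Suc k)}. cis (real_of_int m * \<theta>))
        = cis (real (Suc k) * \<theta>) + cis (- (real (Suc k) * \<theta>)) + complex_of_real (xchar k \<theta>)"
      using Suc.IH by (simp add: algebra_simps)
    also have "cis (real (Suc k) * \<theta>) + cis (- (real (Suc k) * \<theta>)) = of_real (2 * cos (real (Suc k) * \<theta>))"
      by (simp add: complex_eq_iff)
    finally show ?case by (simp add: algebra_simps)
  qed simp
  finally show ?thesis .
qed

lemma xchar_recurrence: "2 * cos \<theta> * xchar (Suc k) \<theta> = xchar (Suc (Suc k)) \<theta> + xchar k \<theta>"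
proof (induction k)
  case 0
  have "cos (2 * \<theta>) = 2 * (cos \<theta> * cos \<theta>) - 1" by (simp add: cos_double_cos power2_eq_square)
  then show ?case by (simp add: algebra_simps)
next
  case (Suc k)
  have "2 * cos \<theta> * cos (real (Suc (Suc k)) * \<theta>) = cos (real (Suc (Suc (Suc k))) * \<theta>) + cos (real (Suc k) * \<theta>)"
    using cos_times_cos[of "real (Suc (Suc k)) * \<theta>" \<theta>] by (simp add: algebra_simps)
  with Suc.IH show ?case by (simp add: algebra_simps)
qed

definition mtrace :: "real^3^3 \<Rightarrow> real" where
  "mtrace g = g $ 1 $ 1 + g $ 2 $ 2 + g $ 3 $ 3"

lemma mtrace_mult_commute: "mtrace (A ** B) = mtrace (B ** A)"
  by (simp add: mtrace_def matrix_matrix_mult_def sum_3 mult_ac)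

text \<open>Euler's rotation theorem: in odd dimension the determinant of \<open>g - mat 1\<close>
  equals its own negative, so 1 is an eigenvalue.\<close>

lemma SO3_axis:
  assumes g: "g \<in> SO3"
  obtains v where "v \<in> sphere 0 1" "g *v v = v"
proof -
  have gT: "transpose g ** g = mat 1" "g ** transpose g = mat 1" and dg: "det g = 1"
    using g by (auto simp: SO3_def rotation_matrix_def orthogonal_matrix_def)
  have "g ** (mat 1 - transpose g) = g ** mat 1 - g ** transpose g"
    by (simp add: matrix_matrix_mult_def vec_eq_iff right_diff_distrib sum_subtractf)
  then have "g - mat 1 = g ** (mat 1 - transpose g)" by (simp add: gT)
  then have "det (g - mat 1) = det (mat 1 - transpose g)"
    by (simp add: det_mul dg)
  also have "mat 1 - transpose g = transpose (mat 1 - g)"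
    by (simp add: transpose_def vec_eq_iff mat_def)
  also have "det \<dots> = det ((-1) *\<^sub>R (g - mat 1))"
    by (simp add: det_transpose)
  \<comment> \<open>The sign is (-1)^3.\<close>
  also have "\<dots> = - det (g - mat 1)"
    by (simp add: det_3 algebra_simps)
  finally have "det (g - mat 1) = 0" by simp
  then have "\<not> invertible (g - mat 1)" by (simp add: invertible_det_nz)
  then obtain w where w: "(g - mat 1) *v w = 0" "w \<noteq> 0"
    using invertible_left_inverse matrix_left_invertible_ker by blast
  then have "g *v w = w" by (simp add: matrix_vector_mult_diff_rdistrib)
  with w(2) show thesis
    by (intro that[of "w /\<^sub>R norm w"]) (auto simp: matrix_vector_mult_scaleR)
qed

lemma stabilizer_axis_3:
  assumes "h \<in> stabilizer (axis 3 1)"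
  obtains \<theta> where "h = axis_rotation 3 \<theta>"
proof -
  have h: "h \<in> SO3" "h *v axis 3 1 = axis 3 1" using assms by (auto simp: stabilizer_def)
  have hT: "transpose h *v axis 3 1 = axis 3 1"
    using SO3_inv_left_vec[OF h(1), of "axis 3 1"] h by (simp add: matrix_inv_SO3)
  have c: "h $ 1 $ 3 = 0" "h $ 2 $ 3 = 0" "h $ 3 $ 3 = 1"
    using h(2) by (auto simp: vec_eq_iff forall_3 matrix_vector_mult_def sum_3 axis_def)
  have r: "h $ 3 $ 1 = 0" "h $ 3 $ 2 = 0"
    using hT by (auto simp: vec_eq_iff forall_3 matrix_vector_mult_def sum_3 axis_def transpose_def)
  have o: "transpose h ** h = mat 1" "det h = 1"
    using h(1) by (auto simp: SO3_def rotation_matrix_def orthogonal_matrix_def)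
  have e: "h $ 1 $ 1 * h $ 1 $ 1 + h $ 2 $ 1 * h $ 2 $ 1 = 1"
    "h $ 1 $ 1 * h $ 1 $ 2 + h $ 2 $ 1 * h $ 2 $ 2 = 0"
    "h $ 1 $ 2 * h $ 1 $ 2 + h $ 2 $ 2 * h $ 2 $ 2 = 1"
    using o(1) r by (auto simp: vec_eq_iff forall_3 matrix_matrix_mult_def transpose_def sum_3 mat_def)
  have d: "h $ 1 $ 1 * h $ 2 $ 2 - h $ 1 $ 2 * h $ 2 $ 1 = 1"
    using o(2) c r by (simp add: det_3)
  have "h $ 1 $ 2 = - h $ 2 $ 1" "h $ 2 $ 2 = h $ 1 $ 1"
    using e d by algebra+
  moreover obtain \<theta> where "h $ 1 $ 1 = cos \<theta>" "h $ 2 $ 1 = sin \<theta>"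
    using e(1) sincos_total_2pi[of "h $ 1 $ 1" "h $ 2 $ 1"] by (auto simp: power2_eq_square)
  ultimately show thesis
    using c r by (intro that[of \<theta>]) (simp add: axis_rotation_entries vec_eq_iff forall_3)
qed

context sphere_basis
begin

text \<open>Every rotation is conjugate to one about the third axis, and trace and characters are
  conjugation invariant. The angle is independent of \<open>k\<close>, so one angle describes the
  trace and all characters of \<open>g\<close> together.\<close>

lemma char_xchar:
  assumes g: "g \<in> SO3"
  obtains \<theta> where "mtrace g = 1 + 2 * cos \<theta>" "\<And>k. char k g = of_real (xchar k \<theta>)"
proof -
  let ?e = "axis 3 1 :: real^3"
  obtain v where v: "v \<in> sphere 0 1" "g *v v = v" using SO3_axis[OF g] by blast
  obtain a where a: "a \<in> SO3" "a *v ?e = v" using SO3_transitive[of ?e v] v by auto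
  define h where "h = matrix_inv a ** g ** a"
  have "h \<in> stabilizer ?e"
    using a g v unfolding h_def stabilizer_def
    by (auto simp: SO3_mult SO3_inv simp flip: matrix_vector_mul_assoc)
  then obtain \<theta> where \<theta>: "h = axis_rotation 3 \<theta>" using stabilizer_axis_3 by blast
  have gh: "g = a ** h ** matrix_inv a"
  proof -
    have "a ** h ** matrix_inv a = (a ** matrix_inv a) ** g ** (a ** matrix_inv a)"
      unfolding h_def by (simp only: matrix_mul_assoc)
    then show ?thesis using a by simp
  qed
  have "mtrace g = mtrace (matrix_inv a ** (a ** h))"
    unfolding gh by (rule mtrace_mult_commute)
  also have "\<dots> = mtrace h" using a by (simp add: matrix_mul_assoc)
  also have "\<dots> = 1 + 2 * cos \<theta>" by (simp add: \<theta> mtrace_def axis_rotation_entries)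
  finally have tr: "mtrace g = 1 + 2 * cos \<theta>" .
  have "char k g = of_real (xchar k \<theta>)" for k
    using char_conj[OF a(1), of "axis_rotation 3 \<theta>"] by (simp add: gh \<theta> char_axis_rotation sum_cis_xchar)
  with tr show thesis by (rule that)
qed

lemma char_real: "g \<in> SO3 \<Longrightarrow> cnj (char k g) = char k g"
  using char_xchar by (metis complex_cnj_complex_of_real)

lemma mtrace_char_0: "g \<in> SO3 \<Longrightarrow> of_real (mtrace g) * char 0 g = char 1 g"
  by (rule char_xchar[of g]) simp_all

text \<open>The trace is the character of degree 1, so this is the Clebsch-Gordan rule for
  multiplying by it; on the level of angles it is the product-to-sum formula for cosines.\<close>

lemma mtrace_char_Suc:
  assumes "g \<in> SO3"
  shows "of_real (mtrace g) * char (Suc k) g = char (Suc (Suc k)) g + char (Suc k) g + char k g"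
proof -
  obtain \<theta> where \<theta>: "mtrace g = 1 + 2 * cos \<theta>" "\<And>k. char k g = of_real (xchar k \<theta>)"
    using char_xchar[OF assms] by blast
  have "(1 + 2 * cos \<theta>) * xchar (Suc k) \<theta> = xchar (Suc (Suc k)) \<theta> + xchar (Suc k) \<theta> + xchar k \<theta>"
    using xchar_recurrence[of \<theta> k] by (simp add: distrib_right del: xchar.simps)
  then show ?thesis unfolding \<theta> by (simp only: of_real_mult[symmetric] of_real_add[symmetric])
qed

definition char_comb :: "(real^3^3 \<Rightarrow> complex) \<Rightarrow> bool" where
  "char_comb u \<longleftrightarrow> (\<exists>n a. \<forall>g\<in>SO3. u g = (\<Sum>k<n. a k * char k g))"

lemma char_comb_char: "char_comb (char k)"
  unfolding char_comb_def
  by (intro exI[of _ "Suc k"] exI[of _ "\<lambda>m. if m = k then 1 else 0"]) (simp add: if_distrib[of "\<lambda>c. c * _"] cong: if_cong)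

text \<open>Padding with zero coefficients lets two combinations share one length, so that they can
  be added.\<close>

lemma char_comb_pad:
  assumes "char_comb u"
  shows "\<exists>n0. \<forall>n\<ge>n0. \<exists>a. \<forall>g\<in>SO3. u g = (\<Sum>k<n. a k * char k g)"
proof -
  obtain m a where a: "\<forall>g\<in>SO3. u g = (\<Sum>k<m. a k * char k g)" using assms by (auto simp: char_comb_def)
  have "\<forall>g\<in>SO3. u g = (\<Sum>k<n. (if k < m then a k else 0) * char k g)" if "n \<ge> m" for n
  proof
    fix g :: "real^3^3" assume "g \<in> SO3"
    then have "u g = (\<Sum>k<m. (if k < m then a k else 0) * char k g)" using a by simp
    also have "\<dots> = (\<Sum>k<n. (if k < m then a k else 0) * char k g)"
      using that by (intro sum.mono_neutral_left) auto
    finally show "u g = (\<Sum>k<n. (if k < m then a k else 0) * char k g)" .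
  qed
  then show ?thesis
    by (intro exI[of _ m] allI impI exI[of _ "\<lambda>k. if k < m then a k else 0"])
qed

lemma char_comb_add:
  assumes "char_comb u" "char_comb v"
  shows "char_comb (\<lambda>g. u g + v g)"
proof -
  obtain n1 where n1: "\<forall>n\<ge>n1. \<exists>a. \<forall>g\<in>SO3. u g = (\<Sum>k<n. a k * char k g)"
    using char_comb_pad[OF assms(1)] by blast
  obtain n2 where n2: "\<forall>n\<ge>n2. \<exists>a. \<forall>g\<in>SO3. v g = (\<Sum>k<n. a k * char k g)"
    using char_comb_pad[OF assms(2)] by blast
  obtain a b where "\<forall>g\<in>SO3. u g = (\<Sum>k<max n1 n2. a k * char k g)" "\<forall>g\<in>SO3. v g = (\<Sum>k<max n1 n2. b k * char k g)"
    using n1 n2 by (metis max.cobounded1 max.cobounded2)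
  then have "\<forall>g\<in>SO3. u g + v g = (\<Sum>k<max n1 n2. (a k + b k) * char k g)"
    by (simp add: sum.distrib distrib_right)
  then show ?thesis unfolding char_comb_def by (intro exI)
qed

lemma char_comb_cmult:
  assumes "char_comb u"
  shows "char_comb (\<lambda>g. c * u g)"
proof -
  obtain n a where "\<forall>g\<in>SO3. u g = (\<Sum>k<n. a k * char k g)" using assms by (auto simp: char_comb_def)
  then have "\<forall>g\<in>SO3. c * u g = (\<Sum>k<n. (c * a k) * char k g)" by (simp add: sum_distrib_left mult.assoc)
  then show ?thesis unfolding char_comb_def by (intro exI)
qed

lemma char_comb_sum: "finite I \<Longrightarrow> (\<And>i. i \<in> I \<Longrightarrow> char_comb (u i)) \<Longrightarrow> char_comb (\<lambda>g. \<Sum>i\<in>I. u i g)"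
proof (induction I rule: finite_induct)
  case empty
  show ?case unfolding char_comb_def by (intro exI[of _ 0]) simp
next
  case (insert i I)
  then show ?case using char_comb_add[of "u i" "\<lambda>g. \<Sum>i\<in>I. u i g"] by simp
qed

lemma char_comb_cong: "(\<And>g. g \<in> SO3 \<Longrightarrow> u g = v g) \<Longrightarrow> char_comb u = char_comb v"
  unfolding char_comb_def by simp

text \<open>The character of degree 0 is constant 1 and starts the induction; the Clebsch-Gordan
  rule keeps the span of the characters closed under multiplication by the trace.\<close>

lemma char_comb_mtrace_power: "char_comb (\<lambda>g. of_real (mtrace g) ^ n)"
proof (induction n)
  case 0
  have "char 0 g = 1" if "g \<in> SO3" for g
    using char_xchar[OF that] by (metis of_real_1 xchar.simps(1))
  then show ?case using char_comb_cong[of "char 0" "\<lambda>g. 1"] char_comb_char[of 0] by simp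
next
  case (Suc n)
  then obtain m a where a: "\<forall>g\<in>SO3. of_real (mtrace g) ^ n = (\<Sum>k<m. a k * char k g)"
    by (auto simp: char_comb_def)
  have *: "char_comb (\<lambda>g. a k * (of_real (mtrace g) * char k g))" for k
  proof (rule char_comb_cmult, cases k)
    case 0
    then show "char_comb (\<lambda>g. of_real (mtrace g) * char k g)"
      using char_comb_cong[OF mtrace_char_0] char_comb_char by simp
  next
    case (Suc k')
    then show "char_comb (\<lambda>g. of_real (mtrace g) * char k g)"
      using char_comb_cong[OF mtrace_char_Suc[of _ k']] by (simp add: char_comb_add char_comb_char)
  qed
  have "char_comb (\<lambda>g. \<Sum>k<m. a k * (of_real (mtrace g) * char k g))"
    by (rule char_comb_sum) (simp_all add: *)
  moreover have "of_real (mtrace g) ^ Suc n = (\<Sum>k<m. a k * (of_real (mtrace g) * char k g))" if "g \<in> SO3" for g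
    using a that by (simp add: sum_distrib_left mult_ac)
  ultimately show ?case by (subst char_comb_cong) auto
qed

end

section \<open>Schur orthogonality\<close>

context haar_group
begin

lemma integral_haar_inv:
  fixes u :: "real^3^3 \<Rightarrow> 'b::{banach, second_countable_topology}"
  assumes "u \<in> borel_measurable \<mu>"
  shows "(\<integral>h. u (matrix_inv h) \<partial>\<mu>) = (\<integral>h. u h \<partial>\<mu>)"
proof -
  have "matrix_inv \<in> \<mu> \<rightarrow>\<^sub>M \<mu>" using measurable_haar_inv[of "\<lambda>x. x" \<mu>] by simp
  from integral_distr[OF this assms] show ?thesis by (simp add: distr_haar_inv)
qed

end

locale wigner_setting = sphere_basis Y + haar_SO3 \<mu>
  for Y :: "nat \<Rightarrow> nat \<Rightarrow> real^3 \<Rightarrow> complex" and \<mu> :: "(real^3^3) measure"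
begin

lemma measurable_orbit_inv_pair:
  "(\<lambda>(g, x). matrix_inv g *v x) \<in> \<mu> \<Otimes>\<^sub>M sphere_measure \<rightarrow>\<^sub>M sphere_measure"
proof -
  have "(\<lambda>p. (matrix_inv (fst p), snd p)) \<in> \<mu> \<Otimes>\<^sub>M sphere_measure \<rightarrow>\<^sub>M \<mu> \<Otimes>\<^sub>M sphere_measure"
    by (intro measurable_Pair measurable_haar_inv) auto
  from measurable_compose[OF this measurable_orbit_pair] show ?thesis
    by (simp add: split_beta')
qed

lemma measurable_matcoef:
  assumes "bounded_sphere \<phi>" "bounded_sphere \<psi>"
  shows "matcoef \<phi> \<psi> \<in> borel_measurable \<mu>"
proof -
  have "(\<lambda>(g, x). \<phi> (matrix_inv g *v x) * cnj (\<psi> x)) \<in> borel_measurable (\<mu> \<Otimes>\<^sub>M sphere_measure)"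
    unfolding split_beta'
  proof (intro borel_measurable_times measurable_cnj)
    show "(\<lambda>p. \<phi> (matrix_inv (fst p) *v snd p)) \<in> borel_measurable (\<mu> \<Otimes>\<^sub>M sphere_measure)"
      using measurable_compose[OF measurable_orbit_inv_pair bounded_sphere_measurable[OF assms(1)]]
      by (simp add: split_beta')
  qed (rule measurable_compose[OF measurable_snd bounded_sphere_measurable[OF assms(2)]])
  then have "(\<lambda>g. \<integral>x. \<phi> (matrix_inv g *v x) * cnj (\<psi> x) \<partial>sphere_measure) \<in> borel_measurable \<mu>"
    by (rule sphere.borel_measurable_lebesgue_integral)
  then show ?thesis by (simp add: matcoef_def[abs_def] l2_inner_def)
qed

lemma measurable_T: "i \<in> idx k \<Longrightarrow> j \<in> idx k \<Longrightarrow> T k i j \<in> borel_measurable \<mu>"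
  unfolding wigner_matcoef[abs_def] by (intro measurable_matcoef Y_bounded)

lemma integrable_bounded:
  fixes u :: "real^3^3 \<Rightarrow> 'b::{banach, second_countable_topology}"
  assumes "u \<in> borel_measurable \<mu>" "\<And>g. g \<in> SO3 \<Longrightarrow> norm (u g) \<le> B"
  shows "integrable \<mu> u"
  using assms by (intro integrable_const_bound[where B=B] AE_I2) auto

lemma integrable_TT:
  assumes "i \<in> idx k" "j \<in> idx k" "m \<in> idx l" "n \<in> idx l"
  shows "integrable \<mu> (\<lambda>g. T k i j g * cnj (T l m n g))"
proof (rule integrable_bounded[where B=1])
  show "(\<lambda>g. T k i j g * cnj (T l m n g)) \<in> borel_measurable \<mu>"
    using assms by (intro borel_measurable_times measurable_cnj measurable_T)
  fix g :: "real^3^3" assume "g \<in> SO3"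
  with assms have "cmod (T k i j g) * cmod (T l m n g) \<le> 1 * 1"
    by (intro mult_mono T_bound) auto
  then show "cmod (T k i j g * cnj (T l m n g)) \<le> 1" by (simp add: norm_mult)
qed

text \<open>The kernel \<open>K\<close> collects the unknown inner products \<open>A\<close> as
  coefficients. For fixed \<open>y\<close> it is a harmonic of degree \<open>k\<close> fixed by the
  stabilizer of \<open>y\<close>, hence a multiple of \<open>Z k x y\<close>, and its diagonal fixes
  the multiple. Comparing coefficients in both variables yields \<open>A\<close>, for equal and for
  different degrees at once.\<close>

lemma schur_orthogonality:
  assumes i: "i \<in> idx k" and j: "j \<in> idx k" and m: "m \<in> idx l" and n: "n \<in> idx l"
  shows "l2_inner \<mu> (T k i j) (T l m n) = (if (k, i, j) = (l, m, n) then 1 / of_nat (2 * k + 1) else 0)"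
proof -
  define A where "A j n = l2_inner \<mu> (T k i j) (T l m n)" for j n
  define K where "K x y = (\<integral>g. Y k i (matrix_inv g *v x) * cnj (Y l m (matrix_inv g *v y)) \<partial>\<mu>)" for x y
  define d :: complex where "d = (if k = l \<and> i = m then 1 else 0)"
  have KA: "K x y = (\<Sum>j\<in>idx k. (\<Sum>n\<in>idx l. A j n * cnj (Y l n y)) * Y k j x)"
    if x: "x \<in> sphere 0 1" and y: "y \<in> sphere 0 1" for x y
  proof -
    have "K x y = (\<integral>g. (\<Sum>j\<in>idx k. \<Sum>n\<in>idx l. (T k i j g * cnj (T l m n g)) * (Y k j x * cnj (Y l n y))) \<partial>\<mu>)"
      unfolding K_def
    proof (rule Bochner_Integration.integral_cong[OF refl])
      fix g assume "g \<in> space \<mu>"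
      then have g: "g \<in> SO3" by simp
      show "Y k i (matrix_inv g *v x) * cnj (Y l m (matrix_inv g *v y))
          = (\<Sum>j\<in>idx k. \<Sum>n\<in>idx l. (T k i j g * cnj (T l m n g)) * (Y k j x * cnj (Y l n y)))"
        unfolding Y_rotate_inv[OF i g x] Y_rotate_inv[OF m g y] by (simp add: sum_product mult_ac)
    qed
    also have "\<dots> = (\<Sum>j\<in>idx k. \<Sum>n\<in>idx l. A j n * (Y k j x * cnj (Y l n y)))"
      unfolding A_def l2_inner_def
      by (subst Bochner_Integration.integral_sum; (intro integrable_sum integrable_mult_left integrable_TT i m | simp)?)+
         (simp_all add: integrable_TT i m)
    finally show ?thesis by (simp add: sum_distrib_left sum_distrib_right mult_ac)
  qed
  \<comment> \<open>Inversion invariance turns the diagonal into an orbit integral, which is the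
    surface integral of a product of basis functions divided by 4 pi.\<close>
  have Kdiag: "K y y = d / of_real (4 * pi)" if y: "y \<in> sphere 0 1" for y
  proof -
    have ms: "(\<lambda>x. Y k i x * cnj (Y l m x)) \<in> borel_measurable sphere_measure"
      by (intro bounded_sphere_measurable bounded_sphere_mult bounded_sphere_cnj Y_bounded i m)
    have "K y y = (\<integral>g. Y k i (g *v y) * cnj (Y l m (g *v y)) \<partial>\<mu>)"
      unfolding K_def
      by (rule integral_haar_inv) (rule measurable_compose[OF measurable_orbit[OF y] ms])
    moreover have "of_real (4 * pi) * (\<integral>g. Y k i (g *v y) * cnj (Y l m (g *v y)) \<partial>\<mu>) = sinner (Y k i) (Y l m)"
      unfolding l2_inner_def by (rule integral_sphere_eq_haar[OF y ms, symmetric])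
    ultimately show ?thesis using Y_inner_degree[OF i m] by (simp add: d_def field_simps)
  qed
  have Kinv: "K (h *v x) (h *v y) = K x y" if h: "h \<in> SO3" and x: "x \<in> sphere 0 1" and y: "y \<in> sphere 0 1" for h x y
  proof -
    have orb: "(\<lambda>g. matrix_inv g *v z) \<in> \<mu> \<rightarrow>\<^sub>M sphere_measure" if "z \<in> sphere 0 1" for z
      using measurable_compose[OF measurable_haar_inv[of "\<lambda>g. g"] measurable_orbit[OF that]] by simp
    have ms: "(\<lambda>g. Y k i (matrix_inv g *v (h *v x)) * cnj (Y l m (matrix_inv g *v (h *v y)))) \<in> borel_measurable \<mu>"
      using x y h by (intro borel_measurable_times measurable_cnj measurable_compose[OF orb bounded_sphere_measurable]
          Y_bounded i m) auto
    have "K (h *v x) (h *v y) = (\<integral>g. Y k i (matrix_inv (h ** g) *v (h *v x)) * cnj (Y l m (matrix_inv (h ** g) *v (h *v y))) \<partial>\<mu>)"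
      unfolding K_def by (rule integral_haar_left[OF ms h, symmetric])
    also have "\<dots> = K x y"
      unfolding K_def using h
      by (intro Bochner_Integration.integral_cong refl) (simp add: SO3_inv_mult flip: matrix_vector_mul_assoc)
    finally show ?thesis .
  qed
  have KZ: "K x y = d / of_nat (2 * k + 1) * Z k x y" if x: "x \<in> sphere 0 1" and y: "y \<in> sphere 0 1" for x y
  proof -
    have sh: "spherical_harmonic k (\<lambda>x. K x y)"
      using spherical_harmonic_cong[of "\<lambda>x. K x y" "\<lambda>x. \<Sum>j\<in>idx k. (\<Sum>n\<in>idx l. A j n * cnj (Y l n y)) * Y k j x" k]
        KA[OF _ y] spherical_harmonic_sum[OF Y_harmonic] by simp
    have "K x y = K y y / Z k y y * Z k x y"
    proof (rule zonal_unique[OF sh y _ x])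
      fix h z assume h: "h \<in> stabilizer y" and z: "z \<in> sphere (0::real^3) 1"
      then have hS: "h \<in> SO3" "h *v y = y" by (auto simp: stabilizer_def)
      show "K (h *v z) y = K z y" using Kinv[OF hS(1) z y] hS by simp
    qed
    then show ?thesis unfolding Z_diag[OF y] Kdiag[OF y] by simp
  qed
  \<comment> \<open>Both expressions for \<open>K x y\<close> are expanded in the basis functions of
    \<open>x\<close>.\<close>
  have A1: "(\<Sum>n\<in>idx l. A j n * cnj (Y l n y)) = d / of_nat (2 * k + 1) * cnj (Y k j y)" if y: "y \<in> sphere 0 1" for y
  proof (rule Y_coeff_unique[OF _ j])
    fix x :: "real^3" assume x: "x \<in> sphere 0 1"
    show "(\<Sum>j\<in>idx k. (\<Sum>n\<in>idx l. A j n * cnj (Y l n y)) * Y k j x)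
        = (\<Sum>j\<in>idx k. (d / of_nat (2 * k + 1) * cnj (Y k j y)) * Y k j x)"
      using KA[OF x y] KZ[OF x y] by (simp add: Z_def sum_distrib_left mult_ac)
  qed
  have dc: "cnj d = d" by (simp add: d_def)
  \<comment> \<open>After conjugation the same comparison works in \<open>y\<close>. If the degrees
    differ then \<open>d\<close> is 0, so the right-hand side is correct even though
    \<open>j\<close> belongs to another degree.\<close>
  have "cnj (A j n) = (if n = j then d / of_nat (2 * k + 1) else 0)"
  proof (rule Y_coeff_unique[OF _ n])
    fix y :: "real^3" assume y: "y \<in> sphere 0 1"
    have "(\<Sum>n\<in>idx l. cnj (A j n) * Y l n y) = cnj (\<Sum>n\<in>idx l. A j n * cnj (Y l n y))" by simp
    also have "\<dots> = d / of_nat (2 * k + 1) * Y k j y" unfolding A1[OF y] by (simp add: dc)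
    also have "\<dots> = (\<Sum>n\<in>idx l. (if n = j then d / of_nat (2 * k + 1) else 0) * Y l n y)"
      using j by (auto simp: d_def if_distrib[of "\<lambda>c. c * _"] cong: if_cong)
    finally show "(\<Sum>n\<in>idx l. cnj (A j n) * Y l n y)
      = (\<Sum>n\<in>idx l. (if n = j then d / of_nat (2 * k + 1) else 0) * Y l n y)" .
  qed
  then have "A j n = cnj (if n = j then d / of_nat (2 * k + 1) else 0)" by (metis complex_cnj_cnj)
  then show ?thesis by (auto simp: A_def d_def)
qed

end

section \<open>Square-integrable functions and approximation\<close>

lemma L2_measurable: "f \<in> L2 M \<Longrightarrow> f \<in> borel_measurable M"
  by (simp add: L2_def)

lemma L2_integrable_square: "f \<in> L2 M \<Longrightarrow> integrable M (\<lambda>x. (cmod (f x))\<^sup>2)"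
  by (simp add: L2_def)

lemma cmod_add_square_le: "(cmod (a + b))\<^sup>2 \<le> 2 * (cmod a)\<^sup>2 + 2 * (cmod b)\<^sup>2"
proof -
  have "(cmod (a + b))\<^sup>2 \<le> (cmod a + cmod b)\<^sup>2" by (intro power_mono norm_triangle_ineq) simp
  also have "\<dots> \<le> 2 * (cmod a)\<^sup>2 + 2 * (cmod b)\<^sup>2"
    using sum_squares_bound[of "cmod a" "cmod b"] by (simp add: power2_sum)
  finally show ?thesis .
qed

lemma L2_add:
  assumes "f \<in> L2 M" "g \<in> L2 M"
  shows "(\<lambda>x. f x + g x) \<in> L2 M"
proof -
  have "integrable M (\<lambda>x. (cmod (f x + g x))\<^sup>2)"
  proof (rule Bochner_Integration.integrable_bound)
    show "integrable M (\<lambda>x. 2 * (cmod (f x))\<^sup>2 + 2 * (cmod (g x))\<^sup>2)"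
      using assms by (intro Bochner_Integration.integrable_add integrable_mult_right L2_integrable_square) auto
    show "(\<lambda>x. (cmod (f x + g x))\<^sup>2) \<in> borel_measurable M"
      using assms[THEN L2_measurable] by measurable
    show "AE x in M. norm ((cmod (f x + g x))\<^sup>2) \<le> norm (2 * (cmod (f x))\<^sup>2 + 2 * (cmod (g x))\<^sup>2)"
      using cmod_add_square_le by (intro AE_I2) auto
  qed
  then show ?thesis using assms by (auto simp: L2_def intro: borel_measurable_add)
qed

lemma L2_cong:
  assumes "\<And>x. x \<in> space M \<Longrightarrow> f x = g x"
  shows "f \<in> L2 M \<longleftrightarrow> g \<in> L2 M"
proof -
  have "f \<in> borel_measurable M \<longleftrightarrow> g \<in> borel_measurable M"
    by (rule measurable_cong) (rule assms)
  moreover have "integrable M (\<lambda>x. (cmod (f x))\<^sup>2) \<longleftrightarrow> integrable M (\<lambda>x. (cmod (g x))\<^sup>2)"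
    by (rule Bochner_Integration.integrable_cong) (simp_all add: assms)
  ultimately show ?thesis by (simp add: L2_def)
qed

lemma L2_cmult: "f \<in> L2 M \<Longrightarrow> (\<lambda>x. c * f x) \<in> L2 M"
  by (auto simp: L2_def norm_mult power_mult_distrib)

lemma L2_diff: "f \<in> L2 M \<Longrightarrow> g \<in> L2 M \<Longrightarrow> (\<lambda>x. f x - g x) \<in> L2 M"
  using L2_add[OF _ L2_cmult[of g M "-1"], of f] by simp

lemma L2_zero: "(\<lambda>x. 0) \<in> L2 M"
  by (simp add: L2_def)

lemma L2_sum:
  assumes "\<And>a. a \<in> A \<Longrightarrow> e a \<in> L2 M"
  shows "(\<lambda>x. \<Sum>a\<in>A. c a * e a x) \<in> L2 M"
  using assms
proof (induction A rule: infinite_finite_induct)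
  case (insert a A)
  then have "(\<lambda>x. c a * e a x) \<in> L2 M" "(\<lambda>x. \<Sum>a\<in>A. c a * e a x) \<in> L2 M"
    by (auto intro: L2_cmult)
  from L2_add[OF this] show ?case using insert by simp
qed (simp_all add: L2_zero)

lemma L2_cnj: "f \<in> L2 M \<Longrightarrow> (\<lambda>x. cnj (f x)) \<in> L2 M"
  by (auto simp: L2_def intro: measurable_cnj)

lemma (in finite_measure) L2_bounded:
  assumes "f \<in> borel_measurable M" "\<And>x. x \<in> space M \<Longrightarrow> cmod (f x) \<le> B"
  shows "f \<in> L2 M"
proof -
  have "(cmod (f x))\<^sup>2 \<le> B\<^sup>2" if "x \<in> space M" for x
    using assms(2)[OF that] by (intro power_mono) auto
  then have "integrable M (\<lambda>x. (cmod (f x))\<^sup>2)"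
    using assms(1) by (intro integrable_const_bound[where B="B\<^sup>2"] AE_I2) auto
  then show ?thesis using assms by (simp add: L2_def)
qed

lemma integrable_L2_mult:
  assumes "f \<in> L2 M" "g \<in> L2 M"
  shows "integrable M (\<lambda>x. f x * cnj (g x))"
proof (rule Bochner_Integration.integrable_bound)
  show "integrable M (\<lambda>x. (cmod (f x))\<^sup>2 + (cmod (g x))\<^sup>2)"
    using assms by (intro Bochner_Integration.integrable_add L2_integrable_square) auto
  show "(\<lambda>x. f x * cnj (g x)) \<in> borel_measurable M"
    using assms[THEN L2_measurable] by measurable
  have "cmod (f x) * cmod (g x) \<le> (cmod (f x))\<^sup>2 + (cmod (g x))\<^sup>2" for x
  proof -
    have "0 \<le> cmod (f x) * cmod (g x)" by simp
    moreover have "2 * (cmod (f x) * cmod (g x)) \<le> (cmod (f x))\<^sup>2 + (cmod (g x))\<^sup>2"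
      using sum_squares_bound[of "cmod (f x)" "cmod (g x)"] by (simp add: mult.assoc)
    ultimately show ?thesis by linarith
  qed
  then show "AE x in M. norm (f x * cnj (g x)) \<le> norm ((cmod (f x))\<^sup>2 + (cmod (g x))\<^sup>2)"
    by (intro AE_I2) (simp add: norm_mult)
qed

lemma l2_inner_sum_left:
  assumes "\<And>a. a \<in> A \<Longrightarrow> e a \<in> L2 M" "g \<in> L2 M"
  shows "l2_inner M (\<lambda>x. \<Sum>a\<in>A. c a * e a x) g = (\<Sum>a\<in>A. c a * l2_inner M (e a) g)"
proof -
  have "l2_inner M (\<lambda>x. \<Sum>a\<in>A. c a * e a x) g = (\<integral>x. (\<Sum>a\<in>A. c a * (e a x * cnj (g x))) \<partial>M)"
    unfolding l2_inner_def by (simp add: sum_distrib_right mult.assoc)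
  also have "\<dots> = (\<Sum>a\<in>A. \<integral>x. c a * (e a x * cnj (g x)) \<partial>M)"
    using assms by (intro Bochner_Integration.integral_sum integrable_mult_right integrable_L2_mult)
  finally show ?thesis
    unfolding l2_inner_def using assms by (simp add: integral_mult_right integrable_L2_mult)
qed

lemma l2_inner_commute: "l2_inner M f g = cnj (l2_inner M g f)"
  using Bochner_Integration.integral_cnj[of M "\<lambda>x. g x * cnj (f x)"]
  by (simp add: l2_inner_def mult.commute)

lemma l2_inner_sum_right:
  assumes "\<And>a. a \<in> A \<Longrightarrow> e a \<in> L2 M" "g \<in> L2 M"
  shows "l2_inner M g (\<lambda>x. \<Sum>a\<in>A. c a * e a x) = (\<Sum>a\<in>A. cnj (c a) * l2_inner M g (e a))"
  unfolding l2_inner_commute[of M g] by (simp add: l2_inner_sum_left assms)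

lemma l2_inner_add_left:
  "f \<in> L2 M \<Longrightarrow> g \<in> L2 M \<Longrightarrow> h \<in> L2 M \<Longrightarrow>
    l2_inner M (\<lambda>x. f x + g x) h = l2_inner M f h + l2_inner M g h"
  unfolding l2_inner_def by (simp add: distrib_right integrable_L2_mult)

lemma l2_inner_diff_left:
  "f \<in> L2 M \<Longrightarrow> g \<in> L2 M \<Longrightarrow> h \<in> L2 M \<Longrightarrow>
    l2_inner M (\<lambda>x. f x - g x) h = l2_inner M f h - l2_inner M g h"
  unfolding l2_inner_def by (simp add: left_diff_distrib integrable_L2_mult)

lemma l2_inner_self: "l2_inner M f f = complex_of_real (\<integral>x. (cmod (f x))\<^sup>2 \<partial>M)"
  unfolding l2_inner_def complex_norm_square[symmetric] by (rule integral_complex_of_real)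

lemma l2_pythagoras:
  assumes "r \<in> L2 M" "s \<in> L2 M" "l2_inner M r s = 0"
  shows "(\<integral>x. (cmod (r x + s x))\<^sup>2 \<partial>M) = (\<integral>x. (cmod (r x))\<^sup>2 \<partial>M) + (\<integral>x. (cmod (s x))\<^sup>2 \<partial>M)"
proof -
  have rs: "(\<lambda>x. r x + s x) \<in> L2 M" by (intro L2_add assms)
  have sr: "l2_inner M s r = 0" using assms(3) l2_inner_commute[of M s r] by simp
  have "l2_inner M (\<lambda>x. r x + s x) (\<lambda>x. r x + s x) = l2_inner M r (\<lambda>x. r x + s x) + l2_inner M s (\<lambda>x. r x + s x)"
    by (rule l2_inner_add_left[OF assms(1,2) rs])
  also have "\<dots> = l2_inner M r r + l2_inner M s s"
    using l2_inner_add_left[OF assms(1,2,1)] l2_inner_add_left[OF assms(1,2,2)] assms(3) sr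
    by (simp add: l2_inner_commute[of M _ "\<lambda>x. r x + s x"]) (simp add: l2_inner_self)
  finally have "complex_of_real (\<integral>x. (cmod (r x + s x))\<^sup>2 \<partial>M)
      = complex_of_real ((\<integral>x. (cmod (r x))\<^sup>2 \<partial>M) + (\<integral>x. (cmod (s x))\<^sup>2 \<partial>M))"
    by (simp add: l2_inner_self)
  then show ?thesis by (simp only: of_real_eq_iff)
qed

text \<open>Exact error of an arbitrary combination \<open>c\<close>: the projection error and the
  distance of \<open>c\<close> from the projection are orthogonal. The norms \<open>w\<close> are
  kept because Wigner polynomials are orthogonal but not normalized.\<close>

lemma l2_best_approximation:
  assumes fin: "finite A" and e: "\<And>a. a \<in> A \<Longrightarrow> e a \<in> L2 M" and f: "f \<in> L2 M"
    and orth: "\<And>a b. a \<in> A \<Longrightarrow> b \<in> A \<Longrightarrow> l2_inner M (e a) (e b) = (if a = b then w a else 0)"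
    and w: "\<And>a. a \<in> A \<Longrightarrow> w a \<noteq> 0"
  shows "(\<integral>x. (cmod (f x - (\<Sum>a\<in>A. c a * e a x)))\<^sup>2 \<partial>M)
    = (\<integral>x. (cmod (f x - (\<Sum>a\<in>A. l2_inner M f (e a) / w a * e a x)))\<^sup>2 \<partial>M)
      + (\<integral>x. (cmod (\<Sum>a\<in>A. (l2_inner M f (e a) / w a - c a) * e a x))\<^sup>2 \<partial>M)"
proof -
  let ?p = "\<lambda>x. \<Sum>a\<in>A. l2_inner M f (e a) / w a * e a x"
  let ?s = "\<lambda>x. \<Sum>a\<in>A. (l2_inner M f (e a) / w a - c a) * e a x"
  have p: "?p \<in> L2 M" "?s \<in> L2 M" by (intro L2_sum e; simp)+
  have "l2_inner M ?p (e b) = l2_inner M f (e b)" if b: "b \<in> A" for b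
  proof -
    have "l2_inner M ?p (e b) = (\<Sum>a\<in>A. l2_inner M f (e a) / w a * l2_inner M (e a) (e b))"
      by (rule l2_inner_sum_left) (auto intro: e b)
    also have "\<dots> = (\<Sum>a\<in>A. if a = b then l2_inner M f (e a) else 0)"
      by (intro sum.cong refl) (auto simp: orth b w)
    finally show ?thesis using fin b by simp
  qed
  then have z: "l2_inner M (\<lambda>x. f x - ?p x) (e b) = 0" if "b \<in> A" for b
    using that unfolding l2_inner_diff_left[OF f p(1) e[OF that]] by simp
  have "l2_inner M (\<lambda>x. f x - ?p x) ?s
      = (\<Sum>a\<in>A. cnj (l2_inner M f (e a) / w a - c a) * l2_inner M (\<lambda>x. f x - ?p x) (e a))"
    by (rule l2_inner_sum_right[OF e L2_diff[OF f p(1)]])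
  also have "\<dots> = 0"
  proof (rule sum.neutral, rule ballI)
    fix a assume a: "a \<in> A"
    show "cnj (l2_inner M f (e a) / w a - c a) * l2_inner M (\<lambda>x. f x - ?p x) (e a) = 0"
      unfolding z[OF a] by (rule mult_zero_right)
  qed
  finally have "l2_inner M (\<lambda>x. f x - ?p x) ?s = 0" .
  from l2_pythagoras[OF L2_diff[OF f p(1)] p(2) this] show ?thesis
    by (simp add: left_diff_distrib sum_subtractf)
qed

text \<open>A triangle inequality for squared norms avoids square roots. The factor 2 on each
  summand is the reason for the tolerances \<open>\<epsilon> / 4\<close> further on.\<close>

lemma L2_square_triangle:
  assumes "f \<in> L2 M" "g \<in> L2 M" "h \<in> L2 M"
  shows "(\<integral>x. (cmod (f x - h x))\<^sup>2 \<partial>M) \<le> 2 * (\<integral>x. (cmod (f x - g x))\<^sup>2 \<partial>M) + 2 * (\<integral>x. (cmod (g x - h x))\<^sup>2 \<partial>M)"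
proof -
  have i: "integrable M (\<lambda>x. (cmod (f x - g x))\<^sup>2)" "integrable M (\<lambda>x. (cmod (g x - h x))\<^sup>2)"
    "integrable M (\<lambda>x. (cmod (f x - h x))\<^sup>2)"
    using assms by (auto intro!: L2_integrable_square L2_diff)
  have "(\<integral>x. (cmod (f x - h x))\<^sup>2 \<partial>M) \<le> (\<integral>x. 2 * (cmod (f x - g x))\<^sup>2 + 2 * (cmod (g x - h x))\<^sup>2 \<partial>M)"
  proof (rule integral_mono)
    show "(cmod (f x - h x))\<^sup>2 \<le> 2 * (cmod (f x - g x))\<^sup>2 + 2 * (cmod (g x - h x))\<^sup>2" for x
      using cmod_add_square_le[of "f x - g x" "g x - h x"] by simp
  qed (use i in auto)
  also have "\<dots> = 2 * (\<integral>x. (cmod (f x - g x))\<^sup>2 \<partial>M) + 2 * (\<integral>x. (cmod (g x - h x))\<^sup>2 \<partial>M)"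
    using i by simp
  finally show ?thesis .
qed

section \<open>Trace and distance on the rotation group\<close>

context haar_SO3
begin

lemma mtrace_continuous: "continuous_on S mtrace"
  unfolding mtrace_def by (intro continuous_intros)

lemma measurable_mtrace: "u \<in> N \<rightarrow>\<^sub>M \<mu> \<Longrightarrow> (\<lambda>x. mtrace (u x)) \<in> borel_measurable N"
  by (rule measurable_compose[OF _ measurable_haar_continuous[OF mtrace_continuous]])

end

text \<open>Rotations have squared Frobenius norm 3, and the inner product of two of them is the
  trace of the quotient. A condition on the trace of \<open>matrix_inv h ** g\<close> thus describes
  a ball around \<open>h\<close>.\<close>

lemma SO3_norm_diff:
  assumes "g \<in> SO3" "h \<in> SO3"
  shows "(norm (g - h))\<^sup>2 = 6 - 2 * mtrace (matrix_inv h ** g)"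
proof -
  have self: "g \<bullet> g = 3" if "g \<in> SO3" for g :: "real^3^3"
  proof -
    have "mtrace (g ** transpose g) = 3"
      using orthogonal_matrix_SO3[OF that] by (simp add: orthogonal_matrix_def mtrace_def mat_def)
    then show ?thesis by (simp add: mtrace_def matrix_matrix_mult_def transpose_def inner_vec_def sum_3)
  qed
  have "g \<bullet> h = mtrace (matrix_inv h ** g)"
    using assms by (simp add: matrix_inv_SO3 mtrace_def matrix_matrix_mult_def transpose_def inner_vec_def sum_3)
  then show ?thesis
    using assms by (simp add: power2_norm_eq_inner inner_diff_left inner_diff_right self inner_commute[of h g])
qed

text \<open>A crude bound; the interval only has to be a compact domain for polynomial
  approximation.\<close>

lemma mtrace_bounds:
  assumes "g \<in> SO3"
  shows "mtrace g \<in> {-3..3}"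
proof -
  have "\<bar>g $ i $ i\<bar> \<le> 1" for i
  proof -
    have "norm (row i g) = 1"
      using orthogonal_matrix_SO3[OF assms] by (simp add: orthogonal_matrix_orthonormal_rows)
    then show ?thesis using component_le_norm_cart[of "row i g" i] by (simp add: row_def)
  qed
  from this[of 1] this[of 2] this[of 3] show ?thesis by (simp add: mtrace_def abs_le_iff)
qed

section \<open>Finite Wigner sums and their closure in L2\<close>

context wigner_setting
begin

text \<open>Complete blocks of all degrees below \<open>n\<close>: an increasing exhaustion of
  \<open>wigner_index\<close> by finite sets that matches the partial sums of the series.\<close>

definition W :: "nat \<Rightarrow> (nat \<times> nat \<times> nat) set" where
  "W n = (SIGMA k:{..<n}. idx k \<times> idx k)"

abbreviation e :: "nat \<times> nat \<times> nat \<Rightarrow> real^3^3 \<Rightarrow> complex" where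
  "e \<equiv> \<lambda>(k, i, j). T k i j"

lemma finite_W [simp]: "finite (W n)"
  by (simp add: W_def)

lemma sum_W: "(\<Sum>a\<in>W n. u a) = (\<Sum>k<n. \<Sum>i\<in>idx k. \<Sum>j\<in>idx k. u (k, i, j))"
  unfolding W_def by (simp add: sum.cartesian_product split_beta') (subst sum.Sigma; simp add: split_beta')

lemma W_mono: "m \<le> n \<Longrightarrow> W m \<subseteq> W n"
  by (auto simp: W_def)

definition dim :: "nat \<times> nat \<times> nat \<Rightarrow> complex" where
  "dim a = of_nat (2 * fst a + 1)"

lemma dim_nonzero: "dim a \<noteq> 0"
  unfolding dim_def of_nat_eq_0_iff by simp

lemma W_cases:
  assumes "a \<in> W n"
  obtains k i j where "a = (k, i, j)" "k < n" "i \<in> idx k" "j \<in> idx k"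
  using assms by (auto simp: W_def)

lemma e_bounded: "a \<in> W n \<Longrightarrow> g \<in> SO3 \<Longrightarrow> cmod (e a g) \<le> 1"
  by (erule W_cases) (simp add: T_bound)

lemma e_measurable: "a \<in> W n \<Longrightarrow> e a \<in> borel_measurable \<mu>"
  by (erule W_cases) (simp add: measurable_T)

lemma e_L2: "a \<in> W n \<Longrightarrow> e a \<in> L2 \<mu>"
  by (rule L2_bounded[where B=1]) (auto intro: e_bounded e_measurable)

lemma e_orthogonal:
  "a \<in> W n \<Longrightarrow> b \<in> W n \<Longrightarrow> l2_inner \<mu> (e a) (e b) = (if a = b then 1 / dim a else 0)"
  by (elim W_cases) (simp add: schur_orthogonality dim_def del: of_nat_Suc of_nat_add of_nat_mult)

text \<open>Equality is demanded on the group only; values at other matrices do not affect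
  \<open>\<mu>\<close>-integrals.\<close>

definition wspan :: "(real^3^3 \<Rightarrow> complex) \<Rightarrow> bool" where
  "wspan Q \<longleftrightarrow> (\<exists>n c. \<forall>g\<in>SO3. Q g = (\<Sum>a\<in>W n. c a * e a g))"

lemma wspan_pad:
  assumes "wspan Q"
  shows "\<exists>n0. \<forall>n\<ge>n0. \<exists>c. \<forall>g\<in>SO3. Q g = (\<Sum>a\<in>W n. c a * e a g)"
proof -
  obtain m c where c: "\<forall>g\<in>SO3. Q g = (\<Sum>a\<in>W m. c a * e a g)" using assms by (auto simp: wspan_def)
  have "\<forall>g\<in>SO3. Q g = (\<Sum>a\<in>W n. (if a \<in> W m then c a else 0) * e a g)" if "n \<ge> m" for n
  proof
    fix g :: "real^3^3" assume "g \<in> SO3"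
    then have "Q g = (\<Sum>a\<in>W m. (if a \<in> W m then c a else 0) * e a g)" using c by simp
    also have "\<dots> = (\<Sum>a\<in>W n. (if a \<in> W m then c a else 0) * e a g)"
      using W_mono[OF that] by (intro sum.mono_neutral_left) auto
    finally show "Q g = (\<Sum>a\<in>W n. (if a \<in> W m then c a else 0) * e a g)" .
  qed
  then show ?thesis by (intro exI[of _ m] allI impI exI[of _ "\<lambda>a. if a \<in> W m then c a else 0"])
qed

lemma wspan_add:
  assumes "wspan P" "wspan Q"
  shows "wspan (\<lambda>g. P g + Q g)"
proof -
  obtain n1 where n1: "\<forall>n\<ge>n1. \<exists>c. \<forall>g\<in>SO3. P g = (\<Sum>a\<in>W n. c a * e a g)" using wspan_pad[OF assms(1)] by blast
  obtain n2 where n2: "\<forall>n\<ge>n2. \<exists>c. \<forall>g\<in>SO3. Q g = (\<Sum>a\<in>W n. c a * e a g)" using wspan_pad[OF assms(2)] by blast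
  obtain c where c: "\<forall>g\<in>SO3. P g = (\<Sum>a\<in>W (max n1 n2). c a * e a g)"
    using n1[rule_format, of "max n1 n2"] by auto
  obtain d where d: "\<forall>g\<in>SO3. Q g = (\<Sum>a\<in>W (max n1 n2). d a * e a g)"
    using n2[rule_format, of "max n1 n2"] by auto
  have "\<forall>g\<in>SO3. P g + Q g = (\<Sum>a\<in>W (max n1 n2). (c a + d a) * e a g)"
    using c d by (simp add: sum.distrib distrib_right)
  then show ?thesis unfolding wspan_def by (intro exI)
qed

lemma wspan_cmult:
  assumes "wspan Q"
  shows "wspan (\<lambda>g. b * Q g)"
proof -
  obtain n c where "\<forall>g\<in>SO3. Q g = (\<Sum>a\<in>W n. c a * e a g)" using assms by (auto simp: wspan_def)
  then have "\<forall>g\<in>SO3. b * Q g = (\<Sum>a\<in>W n. (b * c a) * e a g)" by (simp add: sum_distrib_left mult.assoc)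
  then show ?thesis unfolding wspan_def by (intro exI)
qed

lemma wspan_L2:
  assumes "wspan Q"
  shows "Q \<in> L2 \<mu>"
proof -
  obtain n c where c: "\<forall>g\<in>SO3. Q g = (\<Sum>a\<in>W n. c a * e a g)" using assms by (auto simp: wspan_def)
  have "(\<lambda>g. \<Sum>a\<in>W n. c a * e a g) \<in> L2 \<mu>" by (intro L2_sum e_L2)
  then show ?thesis using c by (subst L2_cong) auto
qed

definition approx :: "(real^3^3 \<Rightarrow> complex) \<Rightarrow> bool" where
  "approx f \<longleftrightarrow> f \<in> L2 \<mu> \<and> (\<forall>\<epsilon>>0. \<exists>Q. wspan Q \<and> (\<integral>g. (cmod (f g - Q g))\<^sup>2 \<partial>\<mu>) < \<epsilon>)"

lemma approx_closed:
  assumes f: "f \<in> L2 \<mu>" and lim: "\<And>\<epsilon>. \<epsilon> > 0 \<Longrightarrow> \<exists>g. approx g \<and> (\<integral>x. (cmod (f x - g x))\<^sup>2 \<partial>\<mu>) < \<epsilon>"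
  shows "approx f"
  unfolding approx_def
proof (intro conjI f allI impI)
  fix \<epsilon> :: real assume "\<epsilon> > 0"
  then obtain g where g: "approx g" "(\<integral>x. (cmod (f x - g x))\<^sup>2 \<partial>\<mu>) < \<epsilon> / 4" using lim[of "\<epsilon> / 4"] by auto
  then obtain Q where Q: "wspan Q" "(\<integral>x. (cmod (g x - Q x))\<^sup>2 \<partial>\<mu>) < \<epsilon> / 4"
    using \<open>\<epsilon> > 0\<close> unfolding approx_def by (meson divide_pos_pos zero_less_numeral)
  have "(\<integral>x. (cmod (f x - Q x))\<^sup>2 \<partial>\<mu>) < \<epsilon>"
    using L2_square_triangle[OF f _ wspan_L2[OF Q(1)], of g] g Q by (auto simp: approx_def)
  then show "\<exists>Q. wspan Q \<and> (\<integral>x. (cmod (f x - Q x))\<^sup>2 \<partial>\<mu>) < \<epsilon>" using Q(1) by blast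
qed

lemma approx_wspan: "wspan Q \<Longrightarrow> approx Q"
  unfolding approx_def using wspan_L2 by (auto intro: exI[of _ Q])

lemma approx_add:
  assumes "approx f" "approx g"
  shows "approx (\<lambda>x. f x + g x)"
  unfolding approx_def
proof (intro conjI allI impI)
  have fg: "f \<in> L2 \<mu>" "g \<in> L2 \<mu>" using assms by (auto simp: approx_def)
  then show "(\<lambda>x. f x + g x) \<in> L2 \<mu>" by (rule L2_add)
  fix \<epsilon> :: real assume "\<epsilon> > 0"
  then obtain P Q where P: "wspan P" "(\<integral>x. (cmod (f x - P x))\<^sup>2 \<partial>\<mu>) < \<epsilon> / 4"
    and Q: "wspan Q" "(\<integral>x. (cmod (g x - Q x))\<^sup>2 \<partial>\<mu>) < \<epsilon> / 4"
    using assms unfolding approx_def by (meson divide_pos_pos zero_less_numeral)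
  have PQ: "P \<in> L2 \<mu>" "Q \<in> L2 \<mu>" using P Q wspan_L2 by auto
  have "(\<integral>x. (cmod (f x + g x - (P x + Q x)))\<^sup>2 \<partial>\<mu>)
     \<le> 2 * (\<integral>x. (cmod (f x + g x - (P x + g x)))\<^sup>2 \<partial>\<mu>) + 2 * (\<integral>x. (cmod (P x + g x - (P x + Q x)))\<^sup>2 \<partial>\<mu>)"
    by (rule L2_square_triangle) (intro L2_add fg PQ)+
  then have "(\<integral>x. (cmod (f x + g x - (P x + Q x)))\<^sup>2 \<partial>\<mu>) < \<epsilon>" using P(2) Q(2) by simp
  then show "\<exists>Q. wspan Q \<and> (\<integral>x. (cmod (f x + g x - Q x))\<^sup>2 \<partial>\<mu>) < \<epsilon>"
    using wspan_add[OF P(1) Q(1)] by blast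
qed

lemma approx_cmult:
  assumes "approx f"
  shows "approx (\<lambda>x. c * f x)"
  unfolding approx_def
proof (intro conjI allI impI)
  show "(\<lambda>x. c * f x) \<in> L2 \<mu>" using assms by (auto simp: approx_def intro: L2_cmult)
  fix \<epsilon> :: real assume "\<epsilon> > 0"
  then have "\<epsilon> / ((cmod c)\<^sup>2 + 1) > 0" by (simp add: add_nonneg_pos)
  then obtain Q where Q: "wspan Q" "(\<integral>x. (cmod (f x - Q x))\<^sup>2 \<partial>\<mu>) < \<epsilon> / ((cmod c)\<^sup>2 + 1)"
    using assms unfolding approx_def by blast
  have "(\<integral>x. (cmod (c * f x - c * Q x))\<^sup>2 \<partial>\<mu>) = (cmod c)\<^sup>2 * (\<integral>x. (cmod (f x - Q x))\<^sup>2 \<partial>\<mu>)"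
    by (simp add: right_diff_distrib[symmetric] norm_mult power_mult_distrib)
  also have "\<dots> \<le> ((cmod c)\<^sup>2 + 1) * (\<integral>x. (cmod (f x - Q x))\<^sup>2 \<partial>\<mu>)"
    by (intro mult_right_mono) auto
  also have "\<dots> < \<epsilon>" using Q(2) by (simp add: pos_less_divide_eq add_nonneg_pos mult.commute)
  finally show "\<exists>Q. wspan Q \<and> (\<integral>x. (cmod (c * f x - Q x))\<^sup>2 \<partial>\<mu>) < \<epsilon>"
    using wspan_cmult[OF Q(1)] by blast
qed

lemma approx_cong:
  assumes "\<And>g. g \<in> SO3 \<Longrightarrow> f g = f' g"
  shows "approx f = approx f'"
proof -
  have "f \<in> L2 \<mu> \<longleftrightarrow> f' \<in> L2 \<mu>"
    using assms by (intro L2_cong) simp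
  moreover have "(\<integral>g. (cmod (f g - Q g))\<^sup>2 \<partial>\<mu>) = (\<integral>g. (cmod (f' g - Q g))\<^sup>2 \<partial>\<mu>)" for Q
    using assms by (intro Bochner_Integration.integral_cong) auto
  ultimately show ?thesis by (simp add: approx_def)
qed

lemma approx_sum: "finite I \<Longrightarrow> (\<And>i. i \<in> I \<Longrightarrow> approx (u i)) \<Longrightarrow> approx (\<lambda>x. \<Sum>i\<in>I. u i x)"
proof (induction I rule: finite_induct)
  case empty
  have "wspan (\<lambda>g. 0)" unfolding wspan_def by (intro exI[of _ 0] exI[of _ "\<lambda>_. 0"]) simp
  then show ?case by (simp add: approx_wspan)
next
  case (insert i I)
  then show ?case using approx_add[of "u i" "\<lambda>x. \<Sum>i\<in>I. u i x"] by simp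
qed

end

section \<open>Completeness of the Wigner polynomials\<close>

context wigner_setting
begin

text \<open>A tent in the trace. The trace of a rotation is 3 only at the identity, and the support
  condition on \<open>matrix_inv h ** g\<close> says that \<open>g\<close> has distance less than
  \<open>sqrt (2 * \<delta>)\<close> from \<open>h\<close>.\<close>

definition bump :: "real \<Rightarrow> real \<Rightarrow> real" where
  "bump \<delta> \<tau> = max 0 (\<tau> - (3 - \<delta>))"

lemma bump_continuous: "continuous_on S (bump \<delta>)"
  unfolding bump_def by (intro continuous_intros)

lemma bump_nonneg: "0 \<le> bump \<delta> \<tau>"
  by (simp add: bump_def)

lemma measurable_mtrace_function:
  assumes "continuous_on UNIV q" "u \<in> N \<rightarrow>\<^sub>M \<mu>"
  shows "(\<lambda>x. q (mtrace (u x)) :: real) \<in> borel_measurable N"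
  by (rule measurable_compose[OF measurable_mtrace[OF assms(2)] borel_measurable_continuous_onI[OF assms(1)]])

lemma integrable_mtrace_function:
  assumes "continuous_on UNIV q" "u \<in> \<mu> \<rightarrow>\<^sub>M \<mu>"
  shows "integrable \<mu> (\<lambda>x. q (mtrace (u x)) :: real)"
proof -
  have "compact (q ` {-3..3})"
    by (intro compact_continuous_image continuous_on_subset[OF assms(1)]) auto
  then have "bounded (q ` {-3..3})" by (rule compact_imp_bounded)
  then obtain B where B: "\<forall>x\<in>q ` {-3..3}. norm x \<le> B" unfolding bounded_iff by auto
  show ?thesis
  proof (rule integrable_bounded[OF measurable_mtrace_function[OF assms]])
    fix g :: "real^3^3" assume "g \<in> SO3"
    then have "u g \<in> SO3" using measurable_space[OF assms(2), of g] by simp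
    then show "norm (q (mtrace (u g))) \<le> B" by (intro B[rule_format] imageI mtrace_bounds)
  qed
qed

definition bump_mass :: "real \<Rightarrow> real" where
  "bump_mass \<delta> = (\<integral>h. bump \<delta> (mtrace h) \<partial>\<mu>)"

lemma measurable_inv_left: "g \<in> SO3 \<Longrightarrow> (\<lambda>h. matrix_inv h ** g) \<in> \<mu> \<rightarrow>\<^sub>M \<mu>"
  by (intro measurable_haar_mult measurable_haar_inv) auto

lemma bump_mass_translate:
  assumes "g \<in> SO3"
  shows "(\<integral>h. bump \<delta> (mtrace (matrix_inv h ** g)) \<partial>\<mu>) = bump_mass \<delta>"
proof -
  have 1: "(\<lambda>h. bump \<delta> (mtrace (h ** g))) \<in> borel_measurable \<mu>"
    by (intro measurable_mtrace_function bump_continuous measurable_haar_right assms)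
  have 2: "(\<lambda>h. bump \<delta> (mtrace h)) \<in> borel_measurable \<mu>"
    by (intro measurable_mtrace_function bump_continuous) simp
  show ?thesis
    unfolding bump_mass_def using integral_haar_inv[OF 1] integral_haar_right[OF 2 assms] by simp
qed

text \<open>If the mass were 0, almost every \<open>g\<close> would avoid the balls of radius
  \<open>sqrt (2 * \<delta>)\<close> around all points of a countable dense set. These balls cover
  the group, which has measure 1.\<close>

lemma bump_mass_positive:
  assumes "\<delta> > 0"
  shows "bump_mass \<delta> > 0"
proof (rule ccontr)
  assume "\<not> bump_mass \<delta> > 0"
  moreover have "bump_mass \<delta> \<ge> 0" unfolding bump_mass_def by (simp add: bump_nonneg)
  ultimately have z: "bump_mass \<delta> = 0" by simp
  obtain D where D: "countable D" "D \<subseteq> SO3" "SO3 \<subseteq> closure D"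
    by (rule separable[of SO3])
  have "AE g in \<mu>. bump \<delta> (mtrace (matrix_inv h ** g)) = 0" if "h \<in> D" for h
  proof -
    have h: "matrix_inv h \<in> SO3" using that D by (auto intro: SO3_inv)
    have m: "(\<lambda>g. bump \<delta> (mtrace g)) \<in> borel_measurable \<mu>"
      by (intro measurable_mtrace_function bump_continuous) simp
    have "(\<integral>g. bump \<delta> (mtrace (matrix_inv h ** g)) \<partial>\<mu>) = 0"
      using integral_haar_left[OF m h] z by (simp add: bump_mass_def)
    moreover have "integrable \<mu> (\<lambda>g. bump \<delta> (mtrace (matrix_inv h ** g)))"
      by (intro integrable_mtrace_function bump_continuous measurable_haar_left h)
    ultimately show ?thesis
      by (subst (asm) integral_nonneg_eq_0_iff_AE) (auto simp: bump_nonneg)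
  qed
  then have "AE g in \<mu>. \<forall>h\<in>D. bump \<delta> (mtrace (matrix_inv h ** g)) = 0"
    using D(1) by (simp add: AE_ball_countable)
  with AE_space[of \<mu>] have "AE g in \<mu>. False"
  proof eventually_elim
    case (elim g)
    then have g: "g \<in> SO3" by simp
    have "sqrt (2 * \<delta>) > 0" using assms by simp
    moreover have "g \<in> closure D" using D(3) g by (rule subsetD)
    ultimately obtain h where h: "h \<in> D" "dist h g < sqrt (2 * \<delta>)"
      unfolding closure_approachable by blast
    have "(norm (g - h))\<^sup>2 < (sqrt (2 * \<delta>))\<^sup>2"
      using h(2) by (intro power_strict_mono) (auto simp: dist_norm norm_minus_commute)
    then have "bump \<delta> (mtrace (matrix_inv h ** g)) > 0"
      using SO3_norm_diff[OF g subsetD[OF D(2) h(1)]] assms by (simp add: bump_def)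
    moreover have "bump \<delta> (mtrace (matrix_inv h ** g)) = 0" using elim(2) h(1) by blast
    ultimately show False by simp
  qed
  then show False by (simp add: eventually_False ae_filter_eq_bot_iff)
qed

text \<open>A polynomial in the trace is a combination of characters, and the character at
  \<open>matrix_inv h ** g\<close> is a sum of products of a function of \<open>g\<close> and a
  function of \<open>h\<close>. Integrating over \<open>h\<close> leaves a finite Wigner sum in
  \<open>g\<close>.\<close>

lemma wspan_convolution:
  assumes q: "real_polynomial_function q" and \<phi>: "\<phi> \<in> borel_measurable \<mu>" "\<And>h. h \<in> SO3 \<Longrightarrow> \<bar>\<phi> h\<bar> \<le> B"
  shows "wspan (\<lambda>g. of_real (\<integral>h. \<phi> h * q (mtrace (matrix_inv h ** g)) \<partial>\<mu>))"
proof -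
  obtain b N where b: "q = (\<lambda>\<tau>. \<Sum>i\<le>N. b i * \<tau> ^ i)"
    using q unfolding real_polynomial_function_iff_sum by blast
  have "char_comb (\<lambda>g. \<Sum>i\<le>N. of_real (b i) * of_real (mtrace g) ^ i)"
    by (intro char_comb_sum char_comb_cmult char_comb_mtrace_power) simp
  then have "char_comb (\<lambda>g. of_real (q (mtrace g)))" by (simp add: b)
  then obtain n a where a: "\<And>g. g \<in> SO3 \<Longrightarrow> of_real (q (mtrace g)) = (\<Sum>k<n. a k * char k g)"
    unfolding char_comb_def by blast
  have qT: "of_real (q (mtrace (matrix_inv h ** g))) = (\<Sum>c\<in>W n. (a (fst c) * cnj (e c h)) * e c g)"
    if h: "h \<in> SO3" and g: "g \<in> SO3" for h g
  proof -
    have "char k (matrix_inv h ** g) = (\<Sum>i\<in>idx k. \<Sum>j\<in>idx k. T k i j g * cnj (T k i j h))" for k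
      using h g by (simp add: char_def T_mult SO3_inv T_inv)
    then have "of_real (q (mtrace (matrix_inv h ** g))) = (\<Sum>k<n. \<Sum>i\<in>idx k. \<Sum>j\<in>idx k. (a k * cnj (T k i j h)) * T k i j g)"
      using a[OF SO3_mult[OF SO3_inv[OF h] g]] by (simp add: sum_distrib_left mult_ac)
    also have "\<dots> = (\<Sum>c\<in>W n. (a (fst c) * cnj (e c h)) * e c g)"
      by (simp add: sum_W)
    finally show ?thesis .
  qed
  have int: "integrable \<mu> (\<lambda>h. of_real (\<phi> h) * (a (fst c) * cnj (e c h)))" if c: "c \<in> W n" for c
  proof (rule integrable_bounded[where B="B * cmod (a (fst c))"])
    show "(\<lambda>h. of_real (\<phi> h) * (a (fst c) * cnj (e c h))) \<in> borel_measurable \<mu>"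
      using \<phi>(1) e_measurable[OF c] by measurable
    fix h :: "real^3^3" assume h: "h \<in> SO3"
    have "\<bar>\<phi> h\<bar> * (cmod (a (fst c)) * cmod (e c h)) \<le> B * (cmod (a (fst c)) * 1)"
      using \<phi>(2)[OF h] e_bounded[OF c h] by (intro mult_mono mult_left_mono) (auto intro: order_trans[OF abs_ge_zero])
    then show "cmod (of_real (\<phi> h) * (a (fst c) * cnj (e c h))) \<le> B * cmod (a (fst c))"
      by (simp add: norm_mult)
  qed
  have "of_real (\<integral>h. \<phi> h * q (mtrace (matrix_inv h ** g)) \<partial>\<mu>)
      = (\<Sum>c\<in>W n. (\<integral>h. of_real (\<phi> h) * (a (fst c) * cnj (e c h)) \<partial>\<mu>) * e c g)" if g: "g \<in> SO3" for g
  proof -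
    have "complex_of_real (\<integral>h. \<phi> h * q (mtrace (matrix_inv h ** g)) \<partial>\<mu>)
        = (\<integral>h. complex_of_real (\<phi> h * q (mtrace (matrix_inv h ** g))) \<partial>\<mu>)"
      by (rule integral_complex_of_real[symmetric])
    also have "\<dots> = (\<integral>h. (\<Sum>c\<in>W n. (of_real (\<phi> h) * (a (fst c) * cnj (e c h))) * e c g) \<partial>\<mu>)"
      by (intro Bochner_Integration.integral_cong refl) (simp add: qT g sum_distrib_left mult.assoc)
    also have "\<dots> = (\<Sum>c\<in>W n. \<integral>h. (of_real (\<phi> h) * (a (fst c) * cnj (e c h))) * e c g \<partial>\<mu>)"
      by (rule Bochner_Integration.integral_sum) (intro integrable_mult_left int)
    also have "\<dots> = (\<Sum>c\<in>W n. (\<integral>h. of_real (\<phi> h) * (a (fst c) * cnj (e c h)) \<partial>\<mu>) * e c g)"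
      by (rule sum.cong[OF refl]) (simp del: mult_cancel_right)
    finally show ?thesis .
  qed
  then show ?thesis unfolding wspan_def
    by (intro exI[of _ n] exI[of _ "\<lambda>c. \<integral>h. of_real (\<phi> h) * (a (fst c) * cnj (e c h)) \<partial>\<mu>"] ballI)
qed

text \<open>Convolution with a normalized bump approximates \<open>\<phi>\<close> uniformly; replacing the bump by a
  Weierstrass approximation in the trace turns the convolution into a finite Wigner sum.\<close>

lemma approx_lipschitz:
  assumes lip: "\<And>g h. \<bar>\<phi> g - \<phi> h\<bar> \<le> L * norm (g - h)" and L: "L \<ge> 0"
    and bd: "\<And>g. \<bar>\<phi> g\<bar> \<le> 1"
  shows "approx (\<lambda>g. of_real (\<phi> g))"
proof -
  have cont: "continuous_on S \<phi>" for S
  proof (rule lipschitz_on_continuous_on[of L])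
    show "L-lipschitz_on S \<phi>"
      using lip L by (intro lipschitz_onI) (auto simp: dist_norm)
  qed
  then have meas: "\<phi> \<in> borel_measurable \<mu>" by (rule measurable_haar_continuous)
  have L2\<phi>: "(\<lambda>g. complex_of_real (\<phi> g)) \<in> L2 \<mu>"
    using meas bd by (intro L2_bounded[where B=1]) auto
  show ?thesis unfolding approx_def
  proof (intro conjI L2\<phi> allI impI)
    fix \<epsilon> :: real assume \<epsilon>: "\<epsilon> > 0"
    \<comment> \<open>The pointwise error will be \<open>2 * \<eta>\<close>. The minimum with 1
      makes its square at most \<open>2 * \<eta>\<close>, which is below
      \<open>\<epsilon>\<close>.\<close>
    define \<eta> where "\<eta> = min 1 \<epsilon> / 4"
    have \<eta>: "\<eta> > 0" "(2 * \<eta>)\<^sup>2 < \<epsilon>"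
    proof -
      show "\<eta> > 0" using \<epsilon> by (simp add: \<eta>_def)
      have "(2 * \<eta>)\<^sup>2 \<le> 2 * \<eta>"
        using \<open>\<eta> > 0\<close> unfolding power2_eq_square by (intro mult_left_le) (auto simp: \<eta>_def)
      also have "\<dots> < \<epsilon>" using \<epsilon> by (auto simp: \<eta>_def)
      finally show "(2 * \<eta>)\<^sup>2 < \<epsilon>" .
    qed
    \<comment> \<open>Chosen such that the bump lives where \<open>g\<close> and \<open>h\<close>
      have distance below \<open>\<eta> / (L + 1)\<close>, so that \<open>\<phi>\<close> varies by
      at most \<open>\<eta>\<close> there; \<open>L + 1\<close> instead of \<open>L\<close> admits
      \<open>L = 0\<close>.\<close>
    define \<delta> where "\<delta> = (\<eta> / (L + 1))\<^sup>2 / 2"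
    have \<delta>: "\<delta> > 0" using \<eta> L by (simp add: \<delta>_def)
    let ?c = "bump_mass \<delta>"
    have c: "?c > 0" by (rule bump_mass_positive[OF \<delta>])
    \<comment> \<open>The tolerance is proportional to the bump mass because the convolution is
      divided by that mass in the end.\<close>
    obtain q where q: "real_polynomial_function q" "\<And>\<tau>. \<tau> \<in> {-3..3} \<Longrightarrow> \<bar>bump \<delta> \<tau> - q \<tau>\<bar> < \<eta> * ?c"
      using Stone_Weierstrass_real_polynomial_function[of "{-3..3}" "bump \<delta>" "\<eta> * ?c"]
        bump_continuous \<eta> c by auto
    have qcont: "continuous_on UNIV q"
      by (intro continuous_at_imp_continuous_on ballI continuous_real_polymonial_function q(1))
    define Q where "Q g = (\<integral>h. \<phi> h * q (mtrace (matrix_inv h ** g)) \<partial>\<mu>)" for g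
    have "wspan (\<lambda>g. of_real (1 / ?c) * of_real (Q g))"
      unfolding Q_def by (intro wspan_cmult wspan_convolution[OF q(1) meas]) (rule bd)
    moreover have "(\<integral>g. (cmod (of_real (\<phi> g) - of_real (1 / ?c) * of_real (Q g)))\<^sup>2 \<partial>\<mu>) < \<epsilon>"
    proof -
      have pt: "\<bar>\<phi> g - Q g / ?c\<bar> \<le> 2 * \<eta>" if g: "g \<in> SO3" for g
      proof -
        let ?b = "\<lambda>h. bump \<delta> (mtrace (matrix_inv h ** g))" and ?q = "\<lambda>h. q (mtrace (matrix_inv h ** g))"
        have mi: "(\<lambda>h. matrix_inv h ** g) \<in> \<mu> \<rightarrow>\<^sub>M \<mu>" by (rule measurable_inv_left[OF g])
        have ib: "integrable \<mu> ?b" by (intro integrable_mtrace_function bump_continuous mi)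
        have iq: "integrable \<mu> ?q" by (intro integrable_mtrace_function qcont mi)
        have i\<phi>q: "integrable \<mu> (\<lambda>h. \<phi> h * ?q h)"
        proof (rule Bochner_Integration.integrable_bound[OF iq])
          show "(\<lambda>h. \<phi> h * ?q h) \<in> borel_measurable \<mu>" using meas iq by measurable
          show "AE h in \<mu>. norm (\<phi> h * ?q h) \<le> norm (?q h)"
            using bd by (intro AE_I2) (simp add: abs_mult mult_left_le_one_le)
        qed
        \<comment> \<open>One term comes from the variation of \<open>\<phi>\<close> on the support
          of the bump, the other from replacing the bump by the polynomial. Each integrates to
          \<open>\<eta> * bump_mass \<delta>\<close>.\<close>
        have near: "\<bar>\<phi> g * ?b h - \<phi> h * ?q h\<bar> \<le> \<eta> * ?b h + \<eta> * ?c" if h: "h \<in> SO3" for h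
        proof -
          have 1: "\<bar>\<phi> g - \<phi> h\<bar> * ?b h \<le> \<eta> * ?b h"
          proof (cases "?b h = 0")
            case False
            then have "mtrace (matrix_inv h ** g) > 3 - \<delta>" by (auto simp: bump_def)
            then have "(norm (g - h))\<^sup>2 < 2 * \<delta>" using SO3_norm_diff[OF g h] by simp
            also have "2 * \<delta> = (\<eta> / (L + 1))\<^sup>2" by (simp add: \<delta>_def)
            finally have "norm (g - h) < \<eta> / (L + 1)"
              by (rule power_less_imp_less_base) (use \<eta> L in auto)
            then have "L * norm (g - h) \<le> L * (\<eta> / (L + 1))" using L by (intro mult_left_mono) auto
            also have "\<dots> \<le> \<eta>" using L \<eta> by (simp add: field_simps)
            finally have "\<bar>\<phi> g - \<phi> h\<bar> \<le> \<eta>" using lip[of g h] by linarith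
            then show ?thesis by (intro mult_right_mono bump_nonneg)
          qed simp
          have "mtrace (matrix_inv h ** g) \<in> {-3..3}"
            using g h by (intro mtrace_bounds SO3_mult SO3_inv)
          then have "\<bar>\<phi> h\<bar> * \<bar>?b h - ?q h\<bar> \<le> 1 * (\<eta> * ?c)"
            using bd[of h] q(2) by (intro mult_mono) (auto intro: less_imp_le)
          moreover have "\<phi> g * ?b h - \<phi> h * ?q h = (\<phi> g - \<phi> h) * ?b h + \<phi> h * (?b h - ?q h)"
            by (simp add: algebra_simps)
          ultimately show ?thesis
            using 1 bump_nonneg[of \<delta> "mtrace (matrix_inv h ** g)"]
              abs_triangle_ineq[of "(\<phi> g - \<phi> h) * ?b h" "\<phi> h * (?b h - ?q h)"]
            by (simp add: abs_mult)
        qed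
        have "\<phi> g * ?c - Q g = (\<integral>h. \<phi> g * ?b h - \<phi> h * ?q h \<partial>\<mu>)"
          using ib i\<phi>q bump_mass_translate[OF g] by (simp add: Q_def)
        also have "\<bar>\<dots>\<bar> \<le> (\<integral>h. \<bar>\<phi> g * ?b h - \<phi> h * ?q h\<bar> \<partial>\<mu>)"
          by (rule integral_abs_bound)
        also have "\<dots> \<le> (\<integral>h. \<eta> * ?b h + \<eta> * ?c \<partial>\<mu>)"
          using ib i\<phi>q near by (intro integral_mono) auto
        also have "\<dots> = 2 * \<eta> * ?c"
          using ib bump_mass_translate[OF g] by simp
        finally have "\<bar>\<phi> g * ?c - Q g\<bar> \<le> 2 * \<eta> * ?c" .
        moreover have "\<phi> g - Q g / ?c = (\<phi> g * ?c - Q g) / ?c" using c by (simp add: field_simps)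
        ultimately show ?thesis using c by (simp add: abs_divide pos_divide_le_eq)
      qed
      have "(\<integral>g. (cmod (of_real (\<phi> g) - of_real (1 / ?c) * of_real (Q g)))\<^sup>2 \<partial>\<mu>) \<le> (\<integral>g. (2 * \<eta>)\<^sup>2 \<partial>\<mu>)"
      proof (rule integral_mono)
        show "integrable \<mu> (\<lambda>g. (cmod (of_real (\<phi> g) - of_real (1 / ?c) * of_real (Q g)))\<^sup>2)"
          by (intro L2_integrable_square L2_diff L2\<phi> wspan_L2) fact
        fix g assume "g \<in> space \<mu>"
        then have "cmod (of_real (\<phi> g) - of_real (1 / ?c) * of_real (Q g)) \<le> 2 * \<eta>"
          using pt[of g] by (simp flip: of_real_mult of_real_diff of_real_divide add: norm_of_real)
        then show "(cmod (of_real (\<phi> g) - of_real (1 / ?c) * of_real (Q g)))\<^sup>2 \<le> (2 * \<eta>)\<^sup>2"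
          by (intro power_mono) auto
      qed simp
      also have "\<dots> < \<epsilon>" using \<eta>(2) by simp
      finally show ?thesis .
    qed
    ultimately show "\<exists>Q. wspan Q \<and> (\<integral>g. (cmod (of_real (\<phi> g) - Q g))\<^sup>2 \<partial>\<mu>) < \<epsilon>" by blast
  qed
qed

text \<open>Dominated convergence upgrades pointwise to L2 convergence, and
  \<open>approx_closed\<close> does the rest.\<close>

lemma approx_limit:
  assumes u: "\<And>n. approx (u n)" and f: "f \<in> borel_measurable \<mu>"
    and lim: "\<And>x. x \<in> SO3 \<Longrightarrow> (\<lambda>n. u n x) \<longlonglongrightarrow> f x"
    and w: "integrable \<mu> w" and bd: "\<And>n x. x \<in> SO3 \<Longrightarrow> (cmod (f x - u n x))\<^sup>2 \<le> w x" and fL2: "f \<in> L2 \<mu>"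
  shows "approx f"
proof (rule approx_closed[OF fL2])
  fix \<epsilon> :: real assume "\<epsilon> > 0"
  have "(\<lambda>n. \<integral>x. (cmod (f x - u n x))\<^sup>2 \<partial>\<mu>) \<longlonglongrightarrow> (\<integral>x. 0 \<partial>\<mu>)"
  proof (rule integral_dominated_convergence[OF _ _ w])
    have "u n \<in> borel_measurable \<mu>" for n using u L2_measurable by (auto simp: approx_def)
    with f show "(\<lambda>x. (cmod (f x - u n x))\<^sup>2) \<in> borel_measurable \<mu>" for n by measurable
    show "AE x in \<mu>. (\<lambda>n. (cmod (f x - u n x))\<^sup>2) \<longlonglongrightarrow> 0"
    proof (rule AE_I2)
      fix x assume "x \<in> space \<mu>"
      then have "(\<lambda>n. f x - u n x) \<longlonglongrightarrow> f x - f x" by (intro tendsto_diff tendsto_const lim) simp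
      then have "(\<lambda>n. (cmod (f x - u n x))\<^sup>2) \<longlonglongrightarrow> (cmod 0)\<^sup>2" by (intro tendsto_intros) simp
      then show "(\<lambda>n. (cmod (f x - u n x))\<^sup>2) \<longlonglongrightarrow> 0" by simp
    qed
    show "AE x in \<mu>. norm ((cmod (f x - u n x))\<^sup>2) \<le> w x" for n
      using bd by (intro AE_I2) auto
  qed simp
  then have "(\<lambda>n. \<integral>x. (cmod (f x - u n x))\<^sup>2 \<partial>\<mu>) \<longlonglongrightarrow> 0" by simp
  from order_tendstoD(2)[OF this \<open>\<epsilon> > 0\<close>]
  obtain n where "(\<integral>x. (cmod (f x - u n x))\<^sup>2 \<partial>\<mu>) < \<epsilon>"
    unfolding eventually_sequentially by blast
  then show "\<exists>g. approx g \<and> (\<integral>x. (cmod (f x - g x))\<^sup>2 \<partial>\<mu>) < \<epsilon>" using u by blast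
qed

section \<open>From Lipschitz functions to all square-integrable functions\<close>

lemma measurable_indicator_haar:
  assumes "A \<in> sets borel"
  shows "(\<lambda>x. indicator A x :: complex) \<in> borel_measurable \<mu>"
  by (rule measurable_compose[OF measurable_id_haar borel_measurable_indicator[OF assms]])

lemma indicator_L2:
  assumes "A \<in> sets borel"
  shows "(\<lambda>x. indicator A x :: complex) \<in> L2 \<mu>"
  by (rule L2_bounded[where B=1, OF measurable_indicator_haar[OF assms]]) (simp add: indicator_def)

lemma approx_const: "approx (\<lambda>g. c)"
  using approx_cmult[OF approx_lipschitz[of "\<lambda>g. 1" 0], of c] by simp

lemma approx_indicator_closed:
  assumes C: "closed C"
  shows "approx (indicator C)"
\<comment> \<open>\<open>infdist\<close> to the empty set is 0, so the Lipschitz cut-offs of the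
  distance would converge to 1 there. For nonempty closed \<open>C\<close> they decrease to its
  indicator.\<close>
proof (cases "C = {}")
  case True
  have "indicator ({} :: (real^3^3) set) = (\<lambda>_. 0 :: complex)" by (simp add: fun_eq_iff)
  then show ?thesis using approx_const[of 0] True by simp
next
  case False
  define \<phi> where "\<phi> n x = max 0 (1 - real n * infdist x C)" for n x
  have lip: "\<bar>\<phi> n g - \<phi> n h\<bar> \<le> real n * norm (g - h)" for n g h
  proof -
    have "\<bar>\<phi> n g - \<phi> n h\<bar> \<le> \<bar>real n * infdist g C - real n * infdist h C\<bar>"
      unfolding \<phi>_def by linarith
    also have "\<dots> = real n * \<bar>infdist g C - infdist h C\<bar>"
      by (simp add: abs_mult flip: right_diff_distrib)
    also have "\<dots> \<le> real n * norm (g - h)"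
      using infdist_triangle_abs[of g C h] by (intro mult_left_mono) (auto simp: dist_norm)
    finally show ?thesis .
  qed
  have bd: "\<bar>\<phi> n g\<bar> \<le> 1" for n g
    using mult_nonneg_nonneg[of "real n" "infdist g C"] infdist_nonneg[of g C] by (simp add: \<phi>_def)
  show ?thesis
  proof (rule approx_limit[where w="\<lambda>_. 4"])
    show "approx (\<lambda>g. of_real (\<phi> n g))" for n
      using lip bd by (intro approx_lipschitz[where L="real n"]) auto
    show "(\<lambda>n. complex_of_real (\<phi> n x)) \<longlonglongrightarrow> indicator C x" for x
    proof (cases "x \<in> C")
      case True
      then show ?thesis by (simp add: \<phi>_def)
    next
      case F: False
      then have pos: "infdist x C > 0"
        using C False infdist_nonneg[of x C] in_closed_iff_infdist_zero[OF C False, of x] by auto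
      obtain N where N: "1 / infdist x C < real N" using reals_Archimedean2 by blast
      have "\<phi> n x = 0" if "n \<ge> N" for n
      proof -
        have "1 < real N * infdist x C" using N pos by (simp add: divide_less_eq)
        also have "\<dots> \<le> real n * infdist x C" using that pos by (intro mult_right_mono) auto
        finally show ?thesis by (simp add: \<phi>_def)
      qed
      then have "eventually (\<lambda>n. complex_of_real (\<phi> n x) = indicator C x) sequentially"
        unfolding eventually_sequentially using F by (intro exI[of _ N]) auto
      then show ?thesis by (rule tendsto_eventually)
    qed
    show "(cmod (indicator C x - of_real (\<phi> n x)))\<^sup>2 \<le> 4" for n x
    proof -
      have "cmod (indicator C x - of_real (\<phi> n x)) \<le> 1 + 1"
        by (rule norm_triangle_le_diff[OF add_mono]) (use bd in \<open>auto simp: indicator_def\<close>)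
      then show ?thesis using power_mono[of _ 2 2] by fastforce
    qed
  qed (use C in \<open>auto intro: measurable_indicator_haar indicator_L2 borel_closed\<close>)
qed

text \<open>Dynkin's argument: closed sets form a generator stable under intersections, and the sets
  with approximable indicator are closed under complements and countable disjoint unions.\<close>

lemma approx_indicator:
  assumes "A \<in> sets borel"
  shows "approx (indicator A)"
proof -
  have "Int_stable (Collect (closed :: (real^3^3) set \<Rightarrow> bool))"
    by (auto simp: Int_stable_def closed_Int)
  moreover have "Collect (closed :: (real^3^3) set \<Rightarrow> bool) \<subseteq> Pow UNIV" by auto
  moreover have "A \<in> sigma_sets UNIV (Collect closed)"
    using assms by (simp add: borel_eq_closed)
  ultimately show ?thesis
  proof (induction rule: sigma_sets_induct_disjoint)
    case (basic A)
    then show ?case by (simp add: approx_indicator_closed)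
  next
    case empty
    have "indicator ({} :: (real^3^3) set) = (\<lambda>_. 0 :: complex)" by (simp add: fun_eq_iff)
    then show ?case using approx_const[of 0] by simp
  next
    case (compl A)
    have "indicator (UNIV - A) = (\<lambda>x. 1 + (- 1) * indicator A x :: complex)"
      by (auto simp: indicator_def fun_eq_iff)
    moreover have "approx (\<lambda>x. 1 + (- 1) * indicator A x)"
      by (intro approx_add approx_cmult approx_const) (rule compl)
    ultimately show ?case by simp
  next
    case (union A)
    have sets: "A i \<in> sets borel" for i using union by (simp add: borel_eq_closed range_subsetD)
    show ?case
    proof (rule approx_limit[where w="\<lambda>_. 4"])
      show "approx (\<lambda>x. \<Sum>i<n. indicator (A i) x)" for n by (rule approx_sum) (simp_all add: union)
      show "(\<lambda>n. \<Sum>i<n. indicator (A i) x :: complex) \<longlonglongrightarrow> indicator (\<Union>i. A i) x" for x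
      proof -
        have c: "complex_of_real (indicator B x) = indicator B x" for B by (simp add: indicator_def)
        have "(\<lambda>i. complex_of_real (indicator (A i) x)) sums complex_of_real (indicator (\<Union>i. A i) x)"
          by (intro sums_of_real indicator_sums) (use union(1) in \<open>auto simp: disjoint_family_on_def\<close>)
        then show ?thesis by (simp only: c sums_def)
      qed
      show "(cmod (indicator (\<Union>i. A i) x - (\<Sum>i<n. indicator (A i) x)))\<^sup>2 \<le> 4" for n x
      proof -
        have "(\<Sum>i<n. indicator (A i) x :: complex) = indicator (\<Union>i<n. A i) x"
          using union(1) by (subst indicator_UN_disjoint) (auto simp: disjoint_family_on_def)
        then show ?thesis by (simp add: indicator_def)
      qed
    qed (use sets in \<open>auto intro: measurable_indicator_haar indicator_L2\<close>)
  qed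
qed

end

context wigner_setting
begin

lemma approx_indicator_haar:
  assumes "A \<in> sets \<mu>"
  shows "approx (indicator A)"
proof -
  obtain B where B: "B \<in> sets borel" "A = SO3 \<inter> B"
    using assms by (auto simp: sets_haar sets_restrict_space)
  have "approx (indicator A) = approx (indicator B)"
    by (rule approx_cong) (simp add: B indicator_def)
  then show ?thesis using approx_indicator[OF B(1)] by simp
qed

lemma approx_simple:
  fixes s :: "real^3^3 \<Rightarrow> complex"
  assumes s: "simple_function \<mu> s"
  shows "approx s"
proof -
  have fin: "finite (s ` SO3)" using simple_functionD(1)[OF s] by simp
  have m: "s -` {y} \<inter> SO3 \<in> sets \<mu>" for y using simple_functionD(2)[OF s, of "{y}"] by simp
  have "approx (\<lambda>x. \<Sum>y\<in>s ` SO3. y * indicator (s -` {y} \<inter> SO3) x)"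
    by (intro approx_sum fin approx_cmult approx_indicator_haar m)
  moreover have "(\<Sum>y\<in>s ` SO3. y * indicator (s -` {y} \<inter> SO3) x) = s x" if x: "x \<in> SO3" for x
  proof -
    have "(\<Sum>y\<in>s ` SO3. y * indicator (s -` {y} \<inter> SO3) x) = (\<Sum>y\<in>s ` SO3. if y = s x then y else 0)"
      using x by (intro sum.cong) (auto simp: indicator_def)
    then show ?thesis using fin x by simp
  qed
  ultimately show ?thesis by (subst (asm) approx_cong) auto
qed

lemma approx_L2:
  assumes f: "f \<in> L2 \<mu>"
  shows "approx f"
proof -
  obtain F where F: "\<And>i. simple_function \<mu> (F i)" "\<And>x. x \<in> space \<mu> \<Longrightarrow> (\<lambda>i. F i x) \<longlonglongrightarrow> f x"
    "\<And>i x. x \<in> space \<mu> \<Longrightarrow> dist (F i x) 0 \<le> 2 * dist (f x) 0"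
    using borel_measurable_implies_sequence_metric[OF L2_measurable[OF f], of 0] by blast
  show ?thesis
  \<comment> \<open>The simple functions satisfy |F n| \<le> 2 |f|, so the error is at most 3 |f|,
    which gives the constant 9.\<close>
  proof (rule approx_limit[where u=F and w="\<lambda>x. 9 * (cmod (f x))\<^sup>2"])
    show "approx (F n)" for n by (rule approx_simple[OF F(1)])
    show "integrable \<mu> (\<lambda>x. 9 * (cmod (f x))\<^sup>2)" using L2_integrable_square[OF f] by simp
    fix n and x :: "real^3^3" assume "x \<in> SO3"
    then have "cmod (f x - F n x) \<le> 3 * cmod (f x)"
      using F(3)[of x n] norm_triangle_ineq4[of "f x" "F n x"] by simp
    then have "(cmod (f x - F n x))\<^sup>2 \<le> (3 * cmod (f x))\<^sup>2" by (intro power_mono) auto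
    then show "(cmod (f x - F n x))\<^sup>2 \<le> 9 * (cmod (f x))\<^sup>2" by (simp add: power_mult_distrib)
  qed (use F f L2_measurable in auto)
qed

section \<open>Orthogonal projections onto the span of finitely many degrees\<close>

definition proj :: "nat \<Rightarrow> (real^3^3 \<Rightarrow> complex) \<Rightarrow> real^3^3 \<Rightarrow> complex" where
  "proj n f g = (\<Sum>a\<in>W n. (l2_inner \<mu> f (e a) * dim a) * e a g)"

lemma proj_L2: "proj n f \<in> L2 \<mu>"
  unfolding proj_def[abs_def] by (intro L2_sum e_L2)

text \<open>Density provides one finite Wigner sum close to \<open>f\<close>; once its degrees lie
  below \<open>n\<close>, the orthogonal projection is at least as close.\<close>

lemma peter_weyl:
  assumes f: "f \<in> L2 \<mu>"
  shows "(\<lambda>n. \<integral>g. (cmod (f g - proj n f g))\<^sup>2 \<partial>\<mu>) \<longlonglongrightarrow> 0"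
proof (rule LIMSEQ_I)
  fix \<epsilon> :: real assume "\<epsilon> > 0"
  then obtain Q where Q: "wspan Q" "(\<integral>g. (cmod (f g - Q g))\<^sup>2 \<partial>\<mu>) < \<epsilon>"
    using approx_L2[OF f] by (auto simp: approx_def)
  obtain n0 where n0: "\<forall>n\<ge>n0. \<exists>c. \<forall>g\<in>SO3. Q g = (\<Sum>a\<in>W n. c a * e a g)"
    using wspan_pad[OF Q(1)] by blast
  have "norm ((\<integral>g. (cmod (f g - proj n f g))\<^sup>2 \<partial>\<mu>) - 0) < \<epsilon>" if n: "n \<ge> n0" for n
  proof -
    obtain c where c: "\<forall>g\<in>SO3. Q g = (\<Sum>a\<in>W n. c a * e a g)" using n0[rule_format, OF n] by auto
    have "(\<integral>g. (cmod (f g - proj n f g))\<^sup>2 \<partial>\<mu>) \<le> (\<integral>g. (cmod (f g - (\<Sum>a\<in>W n. c a * e a g)))\<^sup>2 \<partial>\<mu>)"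
    proof -
      have "(\<integral>g. (cmod (f g - (\<Sum>a\<in>W n. c a * e a g)))\<^sup>2 \<partial>\<mu>)
        = (\<integral>g. (cmod (f g - (\<Sum>a\<in>W n. l2_inner \<mu> f (e a) / (1 / dim a) * e a g)))\<^sup>2 \<partial>\<mu>)
          + (\<integral>g. (cmod (\<Sum>a\<in>W n. (l2_inner \<mu> f (e a) / (1 / dim a) - c a) * e a g))\<^sup>2 \<partial>\<mu>)"
        by (rule l2_best_approximation[OF finite_W e_L2 f e_orthogonal]) (simp_all add: dim_nonzero)
      moreover have "(\<integral>g. (cmod (\<Sum>a\<in>W n. (l2_inner \<mu> f (e a) / (1 / dim a) - c a) * e a g))\<^sup>2 \<partial>\<mu>) \<ge> 0"
        by simp
      ultimately show ?thesis by (simp add: proj_def)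
    qed
    also have "\<dots> = (\<integral>g. (cmod (f g - Q g))\<^sup>2 \<partial>\<mu>)"
      using c by (intro Bochner_Integration.integral_cong) auto
    also have "\<dots> < \<epsilon>" by (rule Q(2))
    finally show ?thesis by simp
  qed
  then show "\<exists>n0. \<forall>n\<ge>n0. norm ((\<integral>g. (cmod (f g - proj n f g))\<^sup>2 \<partial>\<mu>) - 0) < \<epsilon>" by blast
qed

lemma proj_coeff:
  assumes "a \<in> W m"
  shows "l2_inner \<mu> (proj n f) (e a) = (if a \<in> W n then l2_inner \<mu> f (e a) else 0)"
proof -
  have "l2_inner \<mu> (proj n f) (e a) = (\<Sum>b\<in>W n. (l2_inner \<mu> f (e b) * dim b) * l2_inner \<mu> (e b) (e a))"
    unfolding proj_def[abs_def] by (rule l2_inner_sum_left[OF e_L2 e_L2[OF assms]])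
  also have "\<dots> = (\<Sum>b\<in>W n. if b = a then l2_inner \<mu> f (e b) else 0)"
  proof (rule sum.cong[OF refl])
    fix b assume "b \<in> W n"
    then have "b \<in> W (max m n)" "a \<in> W (max m n)" using assms W_mono by (meson max.cobounded1 max.cobounded2 subsetD)+
    then show "(l2_inner \<mu> f (e b) * dim b) * l2_inner \<mu> (e b) (e a) = (if b = a then l2_inner \<mu> f (e b) else 0)"
      by (simp add: e_orthogonal dim_nonzero)
  qed
  finally show ?thesis by simp
qed

section \<open>Exchanging Wigner polynomials and their conjugates\<close>

lemma kernel_char:
  assumes "g \<in> SO3" "h \<in> SO3"
  shows "(\<Sum>i\<in>idx k. \<Sum>j\<in>idx k. T k i j g * cnj (T k i j h)) = char k (matrix_inv h ** g)"
  using assms by (simp add: char_def T_mult SO3_inv T_inv)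

lemma kernel_symmetric:
  assumes "g \<in> SO3" "h \<in> SO3"
  shows "(\<Sum>i\<in>idx k. \<Sum>j\<in>idx k. T k i j g * cnj (T k i j h)) = (\<Sum>i\<in>idx k. \<Sum>j\<in>idx k. T k i j h * cnj (T k i j g))"
proof -
  have "(\<Sum>i\<in>idx k. \<Sum>j\<in>idx k. T k i j h * cnj (T k i j g))
      = cnj (\<Sum>i\<in>idx k. \<Sum>j\<in>idx k. T k i j g * cnj (T k i j h))"
    by (simp add: mult.commute)
  then show ?thesis unfolding kernel_char[OF assms]
    using char_real[OF SO3_mult[OF SO3_inv[OF assms(2)] assms(1)]] by simp
qed

lemma integrable_L2_T:
  assumes "f \<in> L2 \<mu>" "i \<in> idx k" "j \<in> idx k"
  shows "integrable \<mu> (\<lambda>g. f g * T k i j g)" "integrable \<mu> (\<lambda>g. f g * cnj (T k i j g))"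
proof -
  have T: "T k i j \<in> L2 \<mu>" using e_L2[of "(k, i, j)" "Suc k"] assms by (simp add: W_def)
  show "integrable \<mu> (\<lambda>g. f g * T k i j g)" using integrable_L2_mult[OF assms(1) L2_cnj[OF T]] by simp
  show "integrable \<mu> (\<lambda>g. f g * cnj (T k i j g))" by (rule integrable_L2_mult[OF assms(1) T])
qed

text \<open>The reproducing kernel of the span of the \<open>T k i j\<close> is the character, which is real; hence
  the family \<open>cnj (T k i j)\<close> yields the same projection.\<close>

lemma projection_cnj:
  assumes f: "f \<in> L2 \<mu>" and g: "g \<in> SO3"
  shows "(\<Sum>i\<in>idx k. \<Sum>j\<in>idx k. (\<integral>h. f h * T k i j h \<partial>\<mu>) * cnj (T k i j g))
    = (\<Sum>i\<in>idx k. \<Sum>j\<in>idx k. (\<integral>h. f h * cnj (T k i j h) \<partial>\<mu>) * T k i j g)"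
proof -
  have "(\<Sum>i\<in>idx k. \<Sum>j\<in>idx k. (\<integral>h. f h * T k i j h \<partial>\<mu>) * cnj (T k i j g))
      = (\<integral>h. (\<Sum>i\<in>idx k. \<Sum>j\<in>idx k. (f h * T k i j h) * cnj (T k i j g)) \<partial>\<mu>)"
    by (simp add: integrable_L2_T[OF f])
  also have "\<dots> = (\<integral>h. (\<Sum>i\<in>idx k. \<Sum>j\<in>idx k. (f h * cnj (T k i j h)) * T k i j g) \<partial>\<mu>)"
  proof (rule Bochner_Integration.integral_cong[OF refl])
    fix h assume "h \<in> space \<mu>"
    then have h: "h \<in> SO3" by simp
    have "(\<Sum>i\<in>idx k. \<Sum>j\<in>idx k. (f h * T k i j h) * cnj (T k i j g))
        = f h * (\<Sum>i\<in>idx k. \<Sum>j\<in>idx k. T k i j h * cnj (T k i j g))"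
      by (simp add: sum_distrib_left mult.assoc)
    also have "\<dots> = f h * (\<Sum>i\<in>idx k. \<Sum>j\<in>idx k. T k i j g * cnj (T k i j h))"
      unfolding kernel_symmetric[OF h g] ..
    also have "\<dots> = (\<Sum>i\<in>idx k. \<Sum>j\<in>idx k. (f h * cnj (T k i j h)) * T k i j g)"
      by (simp add: sum_distrib_left mult_ac)
    finally show "(\<Sum>i\<in>idx k. \<Sum>j\<in>idx k. (f h * T k i j h) * cnj (T k i j g))
        = (\<Sum>i\<in>idx k. \<Sum>j\<in>idx k. (f h * cnj (T k i j h)) * T k i j g)" .
  qed
  also have "\<dots> = (\<Sum>i\<in>idx k. \<Sum>j\<in>idx k. (\<integral>h. f h * cnj (T k i j h) \<partial>\<mu>) * T k i j g)"
    by (simp add: integrable_L2_T[OF f])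
  finally show ?thesis .
qed

text \<open>Either side is the integral of \<open>cnj (f g)\<close> against the
  degree-\<open>k\<close> projection of \<open>f\<close>, and by \<open>projection_cnj\<close> the
  two projections coincide.\<close>

lemma coeff_norm_cnj:
  assumes f: "f \<in> L2 \<mu>"
  shows "(\<Sum>i\<in>idx k. \<Sum>j\<in>idx k. (cmod (\<integral>h. f h * T k i j h \<partial>\<mu>))\<^sup>2)
    = (\<Sum>i\<in>idx k. \<Sum>j\<in>idx k. (cmod (\<integral>h. f h * cnj (T k i j h) \<partial>\<mu>))\<^sup>2)"
proof -
  have c: "(\<lambda>g. cnj (f g)) \<in> L2 \<mu>" by (rule L2_cnj[OF f])
  let ?p = "\<lambda>i j. \<integral>h. f h * T k i j h \<partial>\<mu>" and ?q = "\<lambda>i j. \<integral>h. f h * cnj (T k i j h) \<partial>\<mu>"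
  have cp: "cnj (?p i j) = (\<integral>h. cnj (f h) * cnj (T k i j h) \<partial>\<mu>)" for i j
    by (simp flip: Bochner_Integration.integral_cnj)
  have cq: "cnj (?q i j) = (\<integral>h. cnj (f h) * T k i j h \<partial>\<mu>)" for i j
    by (simp flip: Bochner_Integration.integral_cnj)
  have "(\<Sum>i\<in>idx k. \<Sum>j\<in>idx k. ?p i j * cnj (?p i j))
      = (\<integral>g. cnj (f g) * (\<Sum>i\<in>idx k. \<Sum>j\<in>idx k. ?p i j * cnj (T k i j g)) \<partial>\<mu>)"
    unfolding cp by (simp add: sum_distrib_left mult.left_commute[of "cnj (f _)"] integrable_L2_T[OF c])
  also have "\<dots> = (\<integral>g. cnj (f g) * (\<Sum>i\<in>idx k. \<Sum>j\<in>idx k. ?q i j * T k i j g) \<partial>\<mu>)"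
    by (intro Bochner_Integration.integral_cong refl) (simp add: projection_cnj[OF f])
  also have "\<dots> = (\<Sum>i\<in>idx k. \<Sum>j\<in>idx k. ?q i j * cnj (?q i j))"
    unfolding cq by (simp add: sum_distrib_left mult.left_commute[of "cnj (f _)"] integrable_L2_T[OF c])
  finally have "complex_of_real (\<Sum>i\<in>idx k. \<Sum>j\<in>idx k. (cmod (?p i j))\<^sup>2)
      = complex_of_real (\<Sum>i\<in>idx k. \<Sum>j\<in>idx k. (cmod (?q i j))\<^sup>2)"
    unfolding of_real_sum complex_norm_square .
  then show ?thesis by (simp only: of_real_eq_iff)
qed

end

section \<open>Duality for the Radon transform\<close>

locale radon_setting = wigner_setting Y \<mu> for Y \<mu> +
  fixes x0 :: "real^3" and \<nu> :: "(real^3^3) measure"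
  assumes x0: "x0 \<in> sphere 0 1" and haar_stabilizer: "haar_measure (stabilizer x0) \<nu>"

sublocale radon_setting \<subseteq> N: haar_group "stabilizer x0" \<nu>
  by (rule haar_group_stabilizer[OF haar_stabilizer])

context radon_setting
begin

lemma stabilizer_SO3: "h \<in> stabilizer x0 \<Longrightarrow> h \<in> SO3"
  by (simp add: stabilizer_def)

lemma stabilizer_fixes: "h \<in> stabilizer x0 \<Longrightarrow> h *v x0 = x0"
  by (simp add: stabilizer_def)

lemma stabilizer_inv_fixes: "h \<in> stabilizer x0 \<Longrightarrow> matrix_inv h *v x0 = x0"
  using N.K_inv stabilizer_fixes by blast

lemma measurable_stabilizer_inclusion:
  assumes "u \<in> M \<rightarrow>\<^sub>M \<nu>"
  shows "u \<in> M \<rightarrow>\<^sub>M \<mu>"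
proof (rule measurable_haarI)
  show "u \<in> borel_measurable M" using measurable_compose[OF assms N.measurable_id_haar] by simp
  show "u x \<in> SO3" if "x \<in> space M" for x using measurable_space[OF assms that] stabilizer_SO3 by simp
qed

lemma measurable_twist:
  assumes "u \<in> M \<rightarrow>\<^sub>M \<mu>" "v \<in> M \<rightarrow>\<^sub>M \<mu>" "w \<in> M \<rightarrow>\<^sub>M \<nu>"
  shows "(\<lambda>p. u p ** w p ** matrix_inv (v p)) \<in> M \<rightarrow>\<^sub>M \<mu>"
  by (intro measurable_haar_mult measurable_haar_inv measurable_stabilizer_inclusion assms)

text \<open>Whatever rotation the choice operator selects, it differs from \<open>a\<close> by a
  right factor in the stabilizer.\<close>

lemma carrier_rotation_decompose:
  assumes a: "a \<in> SO3"
  obtains k where "k \<in> stabilizer x0" "carrier_rotation x0 (a *v x0) = a ** k"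
proof -
  let ?a = "carrier_rotation x0 (a *v x0)"
  have c: "?a \<in> SO3 \<and> ?a *v x0 = a *v x0"
    unfolding carrier_rotation_def by (rule someI[of _ a]) (use a in simp)
  have "matrix_inv a ** ?a \<in> stabilizer x0"
    using c a by (auto simp: stabilizer_def SO3_mult SO3_inv simp flip: matrix_vector_mul_assoc)
  moreover have "?a = a ** (matrix_inv a ** ?a)" using a by (simp add: matrix_mul_assoc)
  ultimately show thesis by (rule that)
qed

text \<open>The stabilizer factors hidden in the chosen rotations are absorbed on the left and on
  the right by the invariance of \<open>\<nu>\<close>, so arbitrary representatives \<open>a\<close>
  and \<open>b\<close> may be used.\<close>

lemma radon_orbit:
  assumes f: "f \<in> borel_measurable \<mu>" and a: "a \<in> SO3" and b: "b \<in> SO3"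
  shows "radon \<nu> x0 f (a *v x0, b *v x0) = (\<integral>h. f (a ** h ** matrix_inv b) \<partial>\<nu>)"
proof -
  obtain k where k: "k \<in> stabilizer x0" "carrier_rotation x0 (a *v x0) = a ** k"
    by (rule carrier_rotation_decompose[OF a])
  obtain l where l: "l \<in> stabilizer x0" "carrier_rotation x0 (b *v x0) = b ** l"
    by (rule carrier_rotation_decompose[OF b])
  define u where "u h = f (a ** h ** matrix_inv b)" for h
  have u: "u \<in> borel_measurable \<nu>"
    unfolding u_def[abs_def] using a b by (intro measurable_compose[OF _ f] measurable_twist) auto
  have ul: "(\<lambda>h. u (h ** matrix_inv l)) \<in> borel_measurable \<nu>"
    by (intro measurable_compose[OF _ u] N.measurable_haar_right N.K_inv l)
  have "radon \<nu> x0 f (a *v x0, b *v x0)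
      = (\<integral>h. f (carrier_rotation x0 (a *v x0) ** h ** matrix_inv (carrier_rotation x0 (b *v x0))) \<partial>\<nu>)"
    by (simp add: radon_def)
  also have "\<dots> = (\<integral>h. u (k ** h ** matrix_inv l) \<partial>\<nu>)"
    unfolding u_def k(2) l(2)
    using b stabilizer_SO3[OF l(1)] by (simp add: SO3_inv_mult matrix_mul_assoc)
  also have "\<dots> = (\<integral>h. u (h ** matrix_inv l) \<partial>\<nu>)"
    by (rule N.integral_haar_left[OF ul k(1)])
  also have "\<dots> = (\<integral>h. u h \<partial>\<nu>)"
    by (rule N.integral_haar_right[OF u N.K_inv[OF l(1)]])
  finally show ?thesis by (simp add: u_def)
qed

lemma L2_integrable:
  assumes "f \<in> L2 \<mu>"
  shows "integrable \<mu> f"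
  using integrable_L2_mult[OF assms L2_bounded[of "\<lambda>_. 1" 1]] by simp

text \<open>Duality for the double fibration: both sides are the integral of
  \<open>f (a h b\<inverse>) \<alpha> (a x0) \<beta> (b x0)\<close> over \<open>a\<close>, \<open>b\<close>, \<open>h\<close>.\<close>

lemma radon_dual_group:
  assumes f: "f \<in> L2 \<mu>" and \<alpha>: "bounded_sphere \<alpha>" and \<beta>: "bounded_sphere \<beta>"
  shows "(\<integral>a. (\<integral>b. (\<integral>h. f (a ** h ** matrix_inv b) \<partial>\<nu>) * (\<alpha> (a *v x0) * \<beta> (b *v x0)) \<partial>\<mu>) \<partial>\<mu>)
    = (\<integral>a. f a * (\<integral>b. \<alpha> (a *v (b *v x0)) * \<beta> (b *v x0) \<partial>\<mu>) \<partial>\<mu>)"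
proof -
  interpret Q: pair_sigma_finite \<mu> \<nu> by standard
  interpret MN: finite_measure "\<mu> \<Otimes>\<^sub>M \<nu>" 
    by (rule finite_measure_pair_measure[OF N.finite_measure_axioms finite_measure_axioms])
  interpret R: pair_sigma_finite "\<mu> \<Otimes>\<^sub>M \<nu>" \<mu> by standard
  interpret S: pair_sigma_finite \<mu> \<mu> by standard
  obtain A where A: "\<And>x. x \<in> sphere 0 1 \<Longrightarrow> cmod (\<alpha> x) \<le> A" using \<alpha> unfolding bounded_sphere_def by blast
  obtain B where B: "\<And>x. x \<in> sphere 0 1 \<Longrightarrow> cmod (\<beta> x) \<le> B" using \<beta> unfolding bounded_sphere_def by blast
  have A0: "0 \<le> A" using A[OF x0] norm_ge_zero order_trans by blast
  have AB: "cmod (\<alpha> x * \<beta> y) \<le> A * B" if "x \<in> sphere 0 1" "y \<in> sphere 0 1" for x y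
    unfolding norm_mult using A[OF that(1)] B[OF that(2)] A0 by (intro mult_mono) auto
  have AB0: "0 \<le> A * B" using AB[OF x0 x0] norm_ge_zero order_trans by blast
  have fm: "f \<in> borel_measurable \<mu>" by (rule L2_measurable[OF f])
  have fi: "integrable \<mu> f" by (rule L2_integrable[OF f])
  have orb: "(\<lambda>p. u p *v x0) \<in> M \<rightarrow>\<^sub>M sphere_measure" if "u \<in> M \<rightarrow>\<^sub>M \<mu>" for u and M :: "'z measure"
    by (rule measurable_compose[OF that measurable_orbit[OF x0]])
  have \<alpha>m: "(\<lambda>p. \<alpha> (u p *v x0)) \<in> borel_measurable M" if "u \<in> M \<rightarrow>\<^sub>M \<mu>" for u and M :: "'z measure"
    by (rule measurable_compose[OF orb[OF that] bounded_sphere_measurable[OF \<alpha>]])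
  have \<beta>m: "(\<lambda>p. \<beta> (u p *v x0)) \<in> borel_measurable M" if "u \<in> M \<rightarrow>\<^sub>M \<mu>" for u and M :: "'z measure"
    by (rule measurable_compose[OF orb[OF that] bounded_sphere_measurable[OF \<beta>]])
  \<comment> \<open>The variables are grouped with \<open>a\<close> apart, because the translation
    in \<open>a\<close> takes place for fixed \<open>b\<close> and \<open>h\<close>.\<close>
  define F where "F = (\<lambda>((b, h), a). f (a ** h ** matrix_inv b) * (\<alpha> (a *v x0) * \<beta> (b *v x0)))"
  define w where "w b = (\<integral>a. f a * (\<alpha> (a *v (b *v x0)) * \<beta> (b *v x0)) \<partial>\<mu>)" for b
  have Fm: "F \<in> borel_measurable ((\<mu> \<Otimes>\<^sub>M \<nu>) \<Otimes>\<^sub>M \<mu>)"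
    unfolding F_def split_beta
    by (intro borel_measurable_times measurable_compose[OF _ fm] measurable_twist \<alpha>m \<beta>m) auto
  \<comment> \<open>Substituting \<open>a ** b ** matrix_inv h\<close> for \<open>a\<close> frees
    the argument of \<open>f\<close>; the factor \<open>matrix_inv h\<close> then fixes
    \<open>x0\<close> and drops out. The general \<open>c\<close> covers the product itself and its
    absolute value, which is used for integrability.\<close>
  have translate: "(\<integral>a. c (f (a ** h ** matrix_inv b)) (\<alpha> (a *v x0) * \<beta> (b *v x0)) \<partial>\<mu>)
      = (\<integral>a. c (f a) (\<alpha> (a *v (b *v x0)) * \<beta> (b *v x0)) \<partial>\<mu>)"
    if b: "b \<in> SO3" and h: "h \<in> stabilizer x0" and c: "case_prod c \<in> borel_measurable (borel \<Otimes>\<^sub>M borel)"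
    for b h and c :: "complex \<Rightarrow> complex \<Rightarrow> 'y::{banach, second_countable_topology}"
  proof -
    let ?r = "h ** matrix_inv b"
    have hS: "h \<in> SO3" by (rule stabilizer_SO3[OF h])
    have r: "?r \<in> SO3" by (intro SO3_mult SO3_inv b hS)
    have bh: "b ** matrix_inv h \<in> SO3" by (intro SO3_mult SO3_inv b hS)
    let ?v = "\<lambda>a. c (f a) (\<alpha> ((a ** (b ** matrix_inv h)) *v x0) * \<beta> (b *v x0))"
    have vm: "?v \<in> borel_measurable \<mu>"
    proof -
      have "(\<lambda>a. (f a, \<alpha> ((a ** (b ** matrix_inv h)) *v x0) * \<beta> (b *v x0))) \<in> \<mu> \<rightarrow>\<^sub>M borel \<Otimes>\<^sub>M borel"
        by (intro measurable_Pair fm borel_measurable_times \<alpha>m measurable_haar_right bh) simp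
      from measurable_compose[OF this c] show ?thesis by simp
    qed
    have rb: "?r ** (b ** matrix_inv h) = mat 1"
    proof -
      have "?r ** (b ** matrix_inv h) = h ** (matrix_inv b ** b) ** matrix_inv h"
        by (simp only: matrix_mul_assoc)
      then show ?thesis using b hS by simp
    qed
    have eq: "(a ** ?r) ** (b ** matrix_inv h) = a" for a
      by (simp only: matrix_mul_assoc[of a, symmetric] rb matrix_mul_rid)
    have "(\<integral>a. c (f (a ** h ** matrix_inv b)) (\<alpha> (a *v x0) * \<beta> (b *v x0)) \<partial>\<mu>) = (\<integral>a. ?v (a ** ?r) \<partial>\<mu>)"
      unfolding eq by (simp add: matrix_mul_assoc)
    also have "\<dots> = (\<integral>a. ?v a \<partial>\<mu>)" by (rule integral_haar_right[OF vm r])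
    also have "\<dots> = (\<integral>a. c (f a) (\<alpha> (a *v (b *v x0)) * \<beta> (b *v x0)) \<partial>\<mu>)"
      by (simp add: matrix_vector_mul_assoc[symmetric] stabilizer_inv_fixes[OF h])
    finally show ?thesis .
  qed
  have F_section: "integrable \<mu> (\<lambda>a. F ((b, h), a))" if b: "b \<in> SO3" and h: "h \<in> stabilizer x0" for b h
  proof -
    have r: "h ** matrix_inv b \<in> SO3" by (intro SO3_mult SO3_inv b stabilizer_SO3[OF h])
    have "integrable (distr \<mu> \<mu> (\<lambda>a. a ** (h ** matrix_inv b))) f" using fi by (simp add: distr_haar_right[OF r])
    then have "integrable \<mu> (\<lambda>a. f (a ** (h ** matrix_inv b)))"
      by (rule integrable_distr[OF measurable_haar_right[OF r]])
    then have "integrable \<mu> (\<lambda>a. (A * B) *\<^sub>R f (a ** h ** matrix_inv b))" by (simp add: matrix_mul_assoc)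
    then show ?thesis
    proof (rule Bochner_Integration.integrable_bound)
      show "(\<lambda>a. F ((b, h), a)) \<in> borel_measurable \<mu>"
        by (rule measurable_Pair2[OF Fm]) (use b h in \<open>simp add: space_pair_measure\<close>)
      show "AE a in \<mu>. norm (F ((b, h), a)) \<le> norm ((A * B) *\<^sub>R f (a ** h ** matrix_inv b))"
      proof (rule AE_I2)
        fix a assume "a \<in> space \<mu>"
        then have "cmod (\<alpha> (a *v x0) * \<beta> (b *v x0)) \<le> \<bar>A * B\<bar>" using AB[of "a *v x0" "b *v x0"] x0 b by simp
        then have "cmod (f (a ** h ** matrix_inv b)) * cmod (\<alpha> (a *v x0) * \<beta> (b *v x0))
            \<le> cmod (f (a ** h ** matrix_inv b)) * \<bar>A * B\<bar>" by (intro mult_left_mono) auto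
        then show "norm (F ((b, h), a)) \<le> norm ((A * B) *\<^sub>R f (a ** h ** matrix_inv b))"
          by (simp add: F_def norm_mult mult_ac)
      qed
    qed
  qed
  \<comment> \<open>After translation the integral of the modulus over \<open>a\<close> is bounded
    by \<open>A * B\<close> times the L1 norm of \<open>f\<close>, uniformly in \<open>b\<close> and
    \<open>h\<close>. The latter range over a finite measure space.\<close>
  have Fi: "integrable ((\<mu> \<Otimes>\<^sub>M \<nu>) \<Otimes>\<^sub>M \<mu>) F"
  proof (rule R.Fubini_integrable[OF Fm])
    show "AE p in \<mu> \<Otimes>\<^sub>M \<nu>. integrable \<mu> (\<lambda>a. F (p, a))"
      by (rule AE_I2) (auto simp: space_pair_measure F_section)
    show "integrable (\<mu> \<Otimes>\<^sub>M \<nu>) (\<lambda>p. \<integral>a. norm (F (p, a)) \<partial>\<mu>)"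
    proof (rule MN.integrable_const_bound[where B="(A * B) * (\<integral>a. cmod (f a) \<partial>\<mu>)"])
      show "(\<lambda>p. \<integral>a. norm (F (p, a)) \<partial>\<mu>) \<in> borel_measurable (\<mu> \<Otimes>\<^sub>M \<nu>)"
        using Fm by (intro borel_measurable_lebesgue_integral) (simp add: split_beta')
      show "AE p in \<mu> \<Otimes>\<^sub>M \<nu>. norm (\<integral>a. norm (F (p, a)) \<partial>\<mu>) \<le> (A * B) * (\<integral>a. cmod (f a) \<partial>\<mu>)"
      proof (rule AE_I2)
        fix p assume "p \<in> space (\<mu> \<Otimes>\<^sub>M \<nu>)"
        then obtain b h where p: "p = (b, h)" "b \<in> SO3" "h \<in> stabilizer x0" by (auto simp: space_pair_measure)
        have "(\<integral>a. norm (F (p, a)) \<partial>\<mu>) = (\<integral>a. cmod (f a * (\<alpha> (a *v (b *v x0)) * \<beta> (b *v x0))) \<partial>\<mu>)"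
          using translate[OF p(2,3), of "\<lambda>y z. cmod (y * z)"] by (simp add: p F_def)
        also have "\<dots> \<le> (\<integral>a. (A * B) * cmod (f a) \<partial>\<mu>)"
        proof (rule integral_mono')
          show "integrable \<mu> (\<lambda>a. (A * B) * cmod (f a))" using fi by simp
          fix a assume "a \<in> space \<mu>"
          then have "cmod (\<alpha> (a *v (b *v x0)) * \<beta> (b *v x0)) \<le> A * B" using AB x0 p by simp
          then show "cmod (f a * (\<alpha> (a *v (b *v x0)) * \<beta> (b *v x0))) \<le> (A * B) * cmod (f a)"
            unfolding norm_mult[of "f a"] by (subst mult.commute) (intro mult_right_mono; simp)
        qed (use AB0 in simp)
        finally show "norm (\<integral>a. norm (F (p, a)) \<partial>\<mu>) \<le> (A * B) * (\<integral>a. cmod (f a) \<partial>\<mu>)" by simp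
      qed
    qed
  qed
  have "(\<integral>a. (\<integral>b. (\<integral>h. f (a ** h ** matrix_inv b) \<partial>\<nu>) * (\<alpha> (a *v x0) * \<beta> (b *v x0)) \<partial>\<mu>) \<partial>\<mu>)
      = (\<integral>a. (\<integral>p. F (p, a) \<partial>(\<mu> \<Otimes>\<^sub>M \<nu>)) \<partial>\<mu>)"
  proof (rule integral_cong_AE)
    show "(\<lambda>a. \<integral>p. F (p, a) \<partial>(\<mu> \<Otimes>\<^sub>M \<nu>)) \<in> borel_measurable \<mu>"
      using R.integrable_snd[of "\<lambda>p a. F (p, a)"] Fi by (auto simp: split_beta')
    have m3: "(\<lambda>((a, b), h). f (a ** h ** matrix_inv b)) \<in> borel_measurable ((\<mu> \<Otimes>\<^sub>M \<mu>) \<Otimes>\<^sub>M \<nu>)"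
      unfolding split_beta by (intro measurable_compose[OF _ fm] measurable_twist) auto
    have m2: "(\<lambda>(a, b). (\<integral>h. f (a ** h ** matrix_inv b) \<partial>\<nu>)) \<in> borel_measurable (\<mu> \<Otimes>\<^sub>M \<mu>)"
      unfolding split_beta using m3 by (intro N.borel_measurable_lebesgue_integral) (simp add: split_beta')
    have "(\<lambda>(a, b). (\<integral>h. f (a ** h ** matrix_inv b) \<partial>\<nu>) * (\<alpha> (a *v x0) * \<beta> (b *v x0))) \<in> borel_measurable (\<mu> \<Otimes>\<^sub>M \<mu>)"
      using m2 unfolding split_beta by (intro borel_measurable_times \<alpha>m \<beta>m) auto
    then show "(\<lambda>a. \<integral>b. (\<integral>h. f (a ** h ** matrix_inv b) \<partial>\<nu>) * (\<alpha> (a *v x0) * \<beta> (b *v x0)) \<partial>\<mu>) \<in> borel_measurable \<mu>"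
      by (rule borel_measurable_lebesgue_integral)
    have "AE a in \<mu>. integrable (\<mu> \<Otimes>\<^sub>M \<nu>) (\<lambda>p. F (p, a))"
      using R.AE_integrable_snd[of "\<lambda>p a. F (p, a)"] Fi by (simp add: split_beta')
    then show "AE a in \<mu>. (\<integral>b. (\<integral>h. f (a ** h ** matrix_inv b) \<partial>\<nu>) * (\<alpha> (a *v x0) * \<beta> (b *v x0)) \<partial>\<mu>)
        = (\<integral>p. F (p, a) \<partial>(\<mu> \<Otimes>\<^sub>M \<nu>))"
    proof eventually_elim
      case (elim a)
      have "(\<integral>b. (\<integral>h. F ((b, h), a) \<partial>\<nu>) \<partial>\<mu>) = (\<integral>p. F (p, a) \<partial>(\<mu> \<Otimes>\<^sub>M \<nu>))"
        by (rule Q.integral_fst'[OF elim])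
      moreover have "(\<integral>h. F ((b, h), a) \<partial>\<nu>) = (\<integral>h. f (a ** h ** matrix_inv b) \<partial>\<nu>) * (\<alpha> (a *v x0) * \<beta> (b *v x0))" for b
        by (simp add: F_def)
      ultimately show ?case by simp
    qed
  qed
  also have "\<dots> = (\<integral>p. (\<integral>a. F (p, a) \<partial>\<mu>) \<partial>(\<mu> \<Otimes>\<^sub>M \<nu>))"
    using R.Fubini_integral[of "\<lambda>p a. F (p, a)"] Fi by (simp add: split_beta')
  \<comment> \<open>The translated inner integral is independent of \<open>h\<close>, so the
    integration over the stabilizer has no further effect.\<close>
  also have "\<dots> = (\<integral>p. w (fst p) \<partial>(\<mu> \<Otimes>\<^sub>M \<nu>))"
    using translate[of _ _ "(*)"]
    by (intro Bochner_Integration.integral_cong refl) (auto simp: space_pair_measure F_def w_def)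
  also have "\<dots> = (\<integral>b. w b \<partial>\<mu>)"
  proof -
    have "integrable (\<mu> \<Otimes>\<^sub>M \<nu>) (\<lambda>p. \<integral>a. F (p, a) \<partial>\<mu>)" by (rule R.integrable_fst'[OF Fi])
    then have "integrable (\<mu> \<Otimes>\<^sub>M \<nu>) (\<lambda>p. w (fst p))"
      using translate[of _ _ "(*)"]
      by (subst (asm) Bochner_Integration.integrable_cong[OF refl, of _ _ "\<lambda>p. w (fst p)"])
         (auto simp: space_pair_measure F_def w_def)
    from Q.integral_fst'[OF this] show ?thesis by simp
  qed
  also have "\<dots> = (\<integral>a. (\<integral>b. f a * (\<alpha> (a *v (b *v x0)) * \<beta> (b *v x0)) \<partial>\<mu>) \<partial>\<mu>)"
    unfolding w_def
  proof (rule S.Fubini_integral)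
    let ?H = "\<lambda>(a, b). f a * (\<alpha> (a *v (b *v x0)) * \<beta> (b *v x0))"
    have Hm: "?H \<in> borel_measurable (\<mu> \<Otimes>\<^sub>M \<mu>)"
      unfolding split_beta matrix_vector_mul_assoc
      by (intro borel_measurable_times \<alpha>m \<beta>m measurable_compose[OF measurable_fst fm] measurable_haar_mult) auto
    have "integrable (\<mu> \<Otimes>\<^sub>M \<mu>) (\<lambda>(a, b). (A * B) *\<^sub>R f a)"
    proof -
      have "integrable (\<mu> \<Otimes>\<^sub>M \<mu>) (\<lambda>p. f (fst p))"
      proof (rule S.Fubini_integrable)
        show "(\<lambda>p. f (fst p)) \<in> borel_measurable (\<mu> \<Otimes>\<^sub>M \<mu>)" by (rule measurable_compose[OF measurable_fst fm])
      qed (use fi in simp_all)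
      then show ?thesis by (simp add: split_beta')
    qed
    then show "integrable (\<mu> \<Otimes>\<^sub>M \<mu>) ?H"
    proof (rule Bochner_Integration.integrable_bound[OF _ Hm])
      show "AE p in \<mu> \<Otimes>\<^sub>M \<mu>. norm (?H p) \<le> norm (case p of (a, b) \<Rightarrow> (A * B) *\<^sub>R f a)"
      proof (rule AE_I2)
        fix p assume "p \<in> space (\<mu> \<Otimes>\<^sub>M \<mu>)"
        then obtain a b where p: "p = (a, b)" "a \<in> SO3" "b \<in> SO3" by (auto simp: space_pair_measure)
        have "cmod (\<alpha> (a *v (b *v x0)) * \<beta> (b *v x0)) \<le> \<bar>A * B\<bar>" using AB[of "a *v (b *v x0)" "b *v x0"] x0 p by simp
        then have "cmod (f a) * cmod (\<alpha> (a *v (b *v x0)) * \<beta> (b *v x0)) \<le> cmod (f a) * \<bar>A * B\<bar>"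
          by (intro mult_left_mono) auto
        then show "norm (?H p) \<le> norm (case p of (a, b) \<Rightarrow> (A * B) *\<^sub>R f a)"
          by (simp add: p norm_mult mult_ac)
      qed
    qed
  qed
  also have "\<dots> = (\<integral>a. f a * (\<integral>b. \<alpha> (a *v (b *v x0)) * \<beta> (b *v x0) \<partial>\<mu>) \<partial>\<mu>)" by simp
  finally show ?thesis .
qed

end

section \<open>Sobolev norms and the reconstruction formula\<close>

interpretation sphere_pair: pair_sigma_finite sphere_measure sphere_measure
  by standard

interpretation sphere_product: finite_measure "sphere_measure \<Otimes>\<^sub>M sphere_measure"
  by (rule finite_measure_pair_measure[OF sphere.finite_measure_axioms sphere.finite_measure_axioms])

definition tensor :: "(real^3 \<Rightarrow> complex) \<Rightarrow> (real^3 \<Rightarrow> complex) \<Rightarrow> (real^3) \<times> (real^3) \<Rightarrow> complex" where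
  "tensor \<alpha> \<beta> = (\<lambda>(x, y). \<alpha> x * \<beta> y)"

lemma tensor_L2:
  assumes "bounded_sphere \<alpha>" "bounded_sphere \<beta>"
  shows "tensor \<alpha> \<beta> \<in> L2 S2xS2_measure"
proof -
  obtain A B where A: "\<forall>x\<in>sphere 0 1. cmod (\<alpha> x) \<le> A" and B: "\<forall>x\<in>sphere 0 1. cmod (\<beta> x) \<le> B"
    using assms unfolding bounded_sphere_def by blast
  show ?thesis
  proof (rule sphere_product.L2_bounded[where B="A * B"])
    show "tensor \<alpha> \<beta> \<in> borel_measurable S2xS2_measure"
      unfolding tensor_def split_beta
      by (intro borel_measurable_times measurable_compose[OF measurable_fst bounded_sphere_measurable]
          measurable_compose[OF measurable_snd bounded_sphere_measurable] assms)
    fix z assume "z \<in> space S2xS2_measure"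
    then obtain x y where z: "z = (x, y)" "x \<in> sphere 0 1" "y \<in> sphere 0 1" by (auto simp: space_pair_measure)
    have "cmod (\<alpha> x) * cmod (\<beta> y) \<le> A * B"
      using A B z by (intro mult_mono) (auto intro: order_trans[OF norm_ge_zero])
    then show "cmod (tensor \<alpha> \<beta> z) \<le> A * B" by (simp add: z tensor_def norm_mult)
  qed
qed

lemma tensor_inner:
  assumes "bounded_sphere \<alpha>" "bounded_sphere \<beta>" "bounded_sphere \<alpha>'" "bounded_sphere \<beta>'"
  shows "l2_inner S2xS2_measure (tensor \<alpha> \<beta>) (tensor \<alpha>' \<beta>') = sinner \<alpha> \<alpha>' * sinner \<beta> \<beta>'"
proof -
  have "integrable S2xS2_measure (\<lambda>z. tensor \<alpha> \<beta> z * cnj (tensor \<alpha>' \<beta>' z))"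
    by (intro integrable_L2_mult tensor_L2 assms)
  from sphere_pair.integral_fst'[OF this]
  have "l2_inner S2xS2_measure (tensor \<alpha> \<beta>) (tensor \<alpha>' \<beta>')
      = (\<integral>x. (\<integral>y. tensor \<alpha> \<beta> (x, y) * cnj (tensor \<alpha>' \<beta>' (x, y)) \<partial>sphere_measure) \<partial>sphere_measure)"
    by (simp add: l2_inner_def)
  also have "\<dots> = (\<integral>x. (\<integral>y. (\<alpha> x * cnj (\<alpha>' x)) * (\<beta> y * cnj (\<beta>' y)) \<partial>sphere_measure) \<partial>sphere_measure)"
    by (simp add: tensor_def mult_ac)
  also have "\<dots> = sinner \<alpha> \<alpha>' * sinner \<beta> \<beta>'" by (simp add: l2_inner_def)
  finally show ?thesis .
qed

lemma harmonic_product_tensor: "harmonic_product Y ((k, i), (l, j)) = tensor (Y k i) (\<lambda>y. cnj (Y l j y))"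
  by (simp add: harmonic_product_def tensor_def)

lemma bessel_single:
  assumes "u \<in> L2 M" "e \<in> L2 M" "l2_inner M e e = 1"
  shows "(cmod (l2_inner M u e))\<^sup>2 \<le> (\<integral>x. (cmod (u x))\<^sup>2 \<partial>M)"
proof -
  have "complex_of_real (\<integral>x. (cmod (e x))\<^sup>2 \<partial>M) = complex_of_real 1"
    using assms(3) by (simp add: l2_inner_self)
  then have e1: "(\<integral>x. (cmod (e x))\<^sup>2 \<partial>M) = 1" by (simp only: of_real_eq_iff)
  \<comment> \<open>The error decomposition for a one-element system, comparing the projection with
    the coefficient 0.\<close>
  have "(\<integral>x. (cmod (u x - (\<Sum>a\<in>{()}. 0 * e x)))\<^sup>2 \<partial>M)
    = (\<integral>x. (cmod (u x - (\<Sum>a\<in>{()}. l2_inner M u e / 1 * e x)))\<^sup>2 \<partial>M)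
      + (\<integral>x. (cmod (\<Sum>a\<in>{()}. (l2_inner M u e / 1 - 0) * e x))\<^sup>2 \<partial>M)"
    by (rule l2_best_approximation[of "{()}" "\<lambda>_. e" M u "\<lambda>_. 1" "\<lambda>_. 0"]) (use assms in auto)
  then have "(\<integral>x. (cmod (u x))\<^sup>2 \<partial>M)
    = (\<integral>x. (cmod (u x - l2_inner M u e * e x))\<^sup>2 \<partial>M) + (\<integral>x. (cmod (l2_inner M u e * e x))\<^sup>2 \<partial>M)"
    by simp
  moreover have "(\<integral>x. (cmod (l2_inner M u e * e x))\<^sup>2 \<partial>M) = (cmod (l2_inner M u e))\<^sup>2"
    by (simp add: norm_mult power_mult_distrib e1)
  moreover have "(\<integral>x. (cmod (u x - l2_inner M u e * e x))\<^sup>2 \<partial>M) \<ge> 0" by simp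
  ultimately show ?thesis by simp
qed

text \<open>\<open>eigenvalue\<close> is a definite description, so uniqueness has to be secured by
  a point where the function does not vanish.\<close>

lemma eigenvalueI:
  assumes "\<And>x. x \<in> space M \<Longrightarrow> L \<phi> x = complex_of_real ev * \<phi> x" "x0 \<in> space M" "\<phi> x0 \<noteq> 0"
  shows "eigenvalue M L \<phi> = ev"
  unfolding eigenvalue_def
proof (rule the_equality)
  fix r assume "\<forall>x\<in>space M. L \<phi> x = complex_of_real r * \<phi> x"
  then have "complex_of_real r * \<phi> x0 = complex_of_real ev * \<phi> x0" using assms(1)[OF assms(2)] assms(2) by simp
  then show "r = ev" using assms(3) by simp
qed (use assms in simp)

lemma l2_inner_nonzero_imp:
  assumes "l2_inner M f f \<noteq> 0"
  obtains x where "x \<in> space M" "f x \<noteq> 0"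
proof -
  have "\<exists>x\<in>space M. f x \<noteq> 0"
  proof (rule ccontr)
    assume "\<not> (\<exists>x\<in>space M. f x \<noteq> 0)"
    then have "l2_inner M f f = (\<integral>x. 0 \<partial>M)" unfolding l2_inner_def
      by (intro Bochner_Integration.integral_cong) auto
    with assms show False by simp
  qed
  then show thesis using that by blast
qed

lemma l2_norm_eq: "l2_inner M f f = complex_of_real r \<Longrightarrow> l2_norm M f = sqrt r"
  unfolding l2_inner_self l2_norm_def by (simp only: of_real_eq_iff)

lemma finite_subset_mono_UN:
  fixes W :: "nat \<Rightarrow> 'a set"
  assumes "finite X" "X \<subseteq> (\<Union>n. W n)" and mono: "\<And>m n. m \<le> n \<Longrightarrow> W m \<subseteq> W n"
  obtains n where "X \<subseteq> W n"
proof -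
  have "\<exists>n. X \<subseteq> W n" using assms(1,2)
  proof (induction X rule: finite_induct)
    case (insert x X)
    then obtain m n where "X \<subseteq> W m" "x \<in> W n" by auto
    then have "insert x X \<subseteq> W (max m n)" using mono[of m "max m n"] mono[of n "max m n"] by auto
    then show ?case by blast
  qed simp
  then show thesis using that by blast
qed

text \<open>An increasing exhaustion by finite sets is cofinal among the finite subsets of
  \<open>I\<close>, so the sums over \<open>W n\<close> converge to the full sum; the tail is the
  difference of the two.\<close>

lemma infsum_tail_tendsto_0:
  fixes s :: "'i \<Rightarrow> real"
  assumes s: "s summable_on I" and W: "\<And>n. finite (W n)" "\<And>n. W n \<subseteq> I" "\<And>m n. m \<le> n \<Longrightarrow> W m \<subseteq> W n" "I \<subseteq> (\<Union>n. W n)"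
  shows "(\<lambda>n. \<Sum>\<^sub>\<infinity>a\<in>I. if a \<in> W n then 0 else s a) \<longlonglongrightarrow> 0"
proof -
  have hs: "(s has_sum infsum s I) I" using s by simp
  have "filterlim W (finite_subsets_at_top I) sequentially"
    unfolding filterlim_finite_subsets_at_top
  proof (intro allI impI)
    fix X assume X: "finite X \<and> X \<subseteq> I"
    then have "finite X" "X \<subseteq> (\<Union>n. W n)" using W(4) by auto
    then obtain n where "X \<subseteq> W n" using W(3) by (rule finite_subset_mono_UN)
    then show "\<forall>\<^sub>F n in sequentially. finite (W n) \<and> X \<subseteq> W n \<and> W n \<subseteq> I"
      unfolding eventually_sequentially using W by blast
  qed
  with hs have "(\<lambda>n. sum s (W n)) \<longlonglongrightarrow> infsum s I"
    unfolding has_sum_def by (rule filterlim_compose)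
  then have "(\<lambda>n. infsum s I - sum s (W n)) \<longlonglongrightarrow> infsum s I - infsum s I" by (intro tendsto_intros)
  moreover have "(\<Sum>\<^sub>\<infinity>a\<in>I. if a \<in> W n then 0 else s a) = infsum s I - sum s (W n)" for n
  proof (rule infsumI)
    have "((\<lambda>a. if a \<in> W n then - s a else 0) has_sum (\<Sum>a\<in>W n. - s a)) I"
      using W(1,2) by (intro has_sum_finite_neutralI[where B="W n"]) auto
    moreover have "(\<lambda>a. s a + (if a \<in> W n then - s a else 0)) = (\<lambda>a. if a \<in> W n then 0 else s a)"
      by auto
    ultimately show "((\<lambda>a. if a \<in> W n then 0 else s a) has_sum (infsum s I - sum s (W n))) I"
      using has_sum_add[OF hs, of "\<lambda>a. if a \<in> W n then - s a else 0" "\<Sum>a\<in>W n. - s a"]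
      by (simp add: sum_negf)
  qed
  ultimately show ?thesis by simp
qed

section \<open>Eigenvalues and Sobolev weights of the two orthogonal systems\<close>

context wigner_setting
begin

lemma wigner_index_idx: "wigner_index = {(k, i, j). i \<in> idx k \<and> j \<in> idx k}"
  by (simp add: wigner_index_def idx_def)

lemma wigner_index_W: "wigner_index = (\<Union>n. W n)"
  by (auto simp: wigner_index_idx W_def)

lemma eigenvalue_T:
  assumes "i \<in> idx k" "j \<in> idx k"
  shows "eigenvalue \<mu> SO3_laplacian (T k i j) = - real (k * (k + 1))"
proof -
  have "l2_inner \<mu> (T k i j) (T k i j) = 1 / of_nat (2 * k + 1)"
    using schur_orthogonality[OF assms assms] by simp
  then have "l2_inner \<mu> (T k i j) (T k i j) \<noteq> 0"
    by (simp only: divide_eq_0_iff of_nat_eq_0_iff) simp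
  then obtain g where "g \<in> space \<mu>" "T k i j g \<noteq> 0" by (rule l2_inner_nonzero_imp)
  moreover have "SO3_laplacian (T k i j) g = complex_of_real (- real (k * (k + 1))) * T k i j g" if "g \<in> space \<mu>" for g
  proof -
    have "SO3_laplacian (matcoef (Y k i) (Y k j)) g = - of_nat (k * (k + 1)) * matcoef (Y k i) (Y k j) g"
      using that by (intro SO3_laplacian_matcoef Y_harmonic Y_bounded assms) simp
    then show ?thesis unfolding wigner_matcoef[abs_def] by simp
  qed
  ultimately show ?thesis by (intro eigenvalueI)
qed

lemma l2_norm_T:
  assumes "i \<in> idx k" "j \<in> idx k"
  shows "l2_norm \<mu> (T k i j) = sqrt (1 / real (2 * k + 1))"
  using schur_orthogonality[OF assms assms] by (intro l2_norm_eq) simp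

text \<open>The left-hand base is the square of 2 k + 1.\<close>

lemma powr_eigenvalue: "(1 + 4 * real (k * (k + 1))) powr s = real (2 * k + 1) powr (2 * s)"
proof -
  have "1 + 4 * real (k * (k + 1)) = real (2 * k + 1) powr 2"
    by (simp add: power2_eq_square algebra_simps)
  then show ?thesis by (simp only: powr_powr)
qed

text \<open>The 1 in the exponent comes from dividing by the squared norm 1 / (2 k + 1) of a Wigner
  polynomial.\<close>

lemma sobolev_term_T:
  assumes "i \<in> idx k" "j \<in> idx k"
  shows "sobolev_term \<mu> SO3_laplacian 4 t e u (k, i, j)
    = real (2 * k + 1) powr (1 + 2 * t) * (cmod (l2_inner \<mu> u (T k i j)))\<^sup>2"
proof -
  let ?d = "real (2 * k + 1)"
  have d: "?d > 0" by simp
  have ev: "1 - 4 * (- real (k * (k + 1))) = 1 + 4 * real (k * (k + 1))" by simp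
  have "sobolev_term \<mu> SO3_laplacian 4 t e u (k, i, j)
      = (?d powr (2 * (t / 2)) * cmod (l2_inner \<mu> u (T k i j)) / sqrt (1 / ?d))\<^sup>2"
    unfolding sobolev_term_def prod.case eigenvalue_T[OF assms] l2_norm_T[OF assms] ev powr_eigenvalue ..
  also have "2 * (t / 2) = t" by simp
  finally have "sobolev_term \<mu> SO3_laplacian 4 t e u (k, i, j)
      = (?d powr t * cmod (l2_inner \<mu> u (T k i j)) / sqrt (1 / ?d))\<^sup>2" .
  also have "\<dots> = (?d powr t * ?d powr t) * (cmod (l2_inner \<mu> u (T k i j)))\<^sup>2 * ?d"
    using d by (simp add: power_divide power_mult_distrib power2_eq_square[of "_ powr _"] del: of_nat_Suc of_nat_add of_nat_mult)
  also have "?d powr t * ?d powr t = ?d powr (2 * t)" by (simp add: powr_add[symmetric])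
  also have "?d powr (2 * t) * (cmod (l2_inner \<mu> u (T k i j)))\<^sup>2 * ?d
      = (?d powr 1 * ?d powr (2 * t)) * (cmod (l2_inner \<mu> u (T k i j)))\<^sup>2"
    using d by (simp del: of_nat_Suc of_nat_add of_nat_mult)
  finally show ?thesis by (simp only: powr_add[symmetric])
qed

lemma hp_bounded:
  assumes "i \<in> idx k"
  shows "bounded_sphere (Y k i)" "bounded_sphere (\<lambda>y. cnj (Y k i y))"
  using Y_bounded[OF assms] bounded_sphere_cnj by auto

lemma hp_L2: "i \<in> idx k \<Longrightarrow> j \<in> idx l \<Longrightarrow> harmonic_product Y ((k, i), (l, j)) \<in> L2 S2xS2_measure"
  unfolding harmonic_product_tensor by (intro tensor_L2 hp_bounded)

lemma hp_inner:
  assumes "i \<in> idx k" "j \<in> idx l" "i' \<in> idx k'" "j' \<in> idx l'"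
  shows "l2_inner S2xS2_measure (harmonic_product Y ((k, i), (l, j))) (harmonic_product Y ((k', i'), (l', j')))
    = (if k = k' \<and> i = i' \<and> l = l' \<and> j = j' then 1 else 0)"
proof -
  have "sinner (\<lambda>y. cnj (Y l j y)) (\<lambda>y. cnj (Y l' j' y)) = sinner (Y l' j') (Y l j)"
    by (simp add: l2_inner_def mult.commute)
  then show ?thesis
    unfolding harmonic_product_tensor tensor_inner[OF hp_bounded(1)[OF assms(1)] hp_bounded(2)[OF assms(2)]
        hp_bounded(1)[OF assms(3)] hp_bounded(2)[OF assms(4)]]
    using Y_inner_degree[OF assms(1,3)] Y_inner_degree[OF assms(4,2)] by auto
qed

lemma eigenvalue_hp:
  assumes i: "i \<in> idx k" and j: "j \<in> idx l"
  shows "eigenvalue S2xS2_measure S2xS2_laplacian (harmonic_product Y ((k, i), (l, j)))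
    = - real (k * (k + 1)) - real (l * (l + 1))"
proof -
  let ?h = "harmonic_product Y ((k, i), (l, j))"
  have "l2_inner S2xS2_measure ?h ?h \<noteq> 0" using hp_inner[OF i j i j] by simp
  then obtain z where "z \<in> space S2xS2_measure" "?h z \<noteq> 0" by (rule l2_inner_nonzero_imp)
  moreover have "S2xS2_laplacian ?h z = complex_of_real (- real (k * (k + 1)) - real (l * (l + 1))) * ?h z"
    if mem: "z \<in> space S2xS2_measure" for z
  proof -
    obtain x y where z: "z = (x, y)" "x \<in> sphere 0 1" "y \<in> sphere 0 1"
      using mem unfolding space_pair_measure space_sphere_measure by blast
    have 1: "S2_laplacian (\<lambda>x. cnj (Y l j y) * Y k i x) x = - of_nat (k * (k + 1)) * (cnj (Y l j y) * Y k i x)"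
      by (intro S2_laplacian_harmonic spherical_harmonic_cmult Y_harmonic i z)
    have 2: "S2_laplacian (\<lambda>y. Y k i x * cnj (Y l j y)) y = - of_nat (l * (l + 1)) * (Y k i x * cnj (Y l j y))"
      by (intro S2_laplacian_harmonic spherical_harmonic_cmult spherical_harmonic_cnj Y_harmonic j z)
    show ?thesis
      using 1 2
      by (simp add: z S2xS2_laplacian_def S2xS2_laplacian1_def S2xS2_laplacian2_def harmonic_product_def
          mult.commute[of "cnj (Y l j y)"] del: of_nat_mult of_nat_add) (simp add: algebra_simps)
  qed
  ultimately show ?thesis by (intro eigenvalueI)
qed

text \<open>The functions are normalized here; the 1 in the exponent now comes from the smoothness
  1/2 + t. The weight coincides with that of \<open>sobolev_term_T\<close>.\<close>

lemma sobolev_term_hp: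
  assumes i: "i \<in> idx k" and j: "j \<in> idx k"
  shows "sobolev_term S2xS2_measure S2xS2_laplacian 2 (1/2 + t) (harmonic_product Y) G ((k, i), (k, j))
    = real (2 * k + 1) powr (1 + 2 * t) * (cmod (l2_inner S2xS2_measure G (harmonic_product Y ((k, i), (k, j)))))\<^sup>2"
proof -
  let ?d = "real (2 * k + 1)" and ?h = "harmonic_product Y ((k, i), (k, j))"
  have n: "l2_norm S2xS2_measure ?h = sqrt 1" using hp_inner[OF i j i j] by (intro l2_norm_eq) simp
  have ev: "1 - 2 * (- real (k * (k + 1)) - real (k * (k + 1))) = 1 + 4 * real (k * (k + 1))" by simp
  have "sobolev_term S2xS2_measure S2xS2_laplacian 2 (1/2 + t) (harmonic_product Y) G ((k, i), (k, j))
      = (?d powr (2 * ((1/2 + t) / 2)) * cmod (l2_inner S2xS2_measure G ?h) / sqrt 1)\<^sup>2"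
    unfolding sobolev_term_def eigenvalue_hp[OF i j] n ev powr_eigenvalue ..
  also have "2 * ((1/2 + t) / 2) = 1/2 + t" by simp
  finally have "sobolev_term S2xS2_measure S2xS2_laplacian 2 (1/2 + t) (harmonic_product Y) G ((k, i), (k, j))
      = (?d powr (1/2 + t) * cmod (l2_inner S2xS2_measure G ?h))\<^sup>2" by simp
  also have "\<dots> = (?d powr (1/2 + t) * ?d powr (1/2 + t)) * (cmod (l2_inner S2xS2_measure G ?h))\<^sup>2"
    by (simp add: power_mult_distrib power2_eq_square)
  also have "?d powr (1/2 + t) * ?d powr (1/2 + t) = ?d powr (1 + 2 * t)" by (simp add: powr_add[symmetric] algebra_simps)
  finally show ?thesis .
qed

end

section \<open>Coefficients of the Radon transform\<close>

context radon_setting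
begin

text \<open>Each surface integral becomes a Haar integral with a factor 4 pi. Duality moves the
  integration onto \<open>f\<close>, and the inner Haar integral is turned back into a surface
  integral, which consumes one factor and is a matrix coefficient.\<close>

lemma radon_coefficient:
  assumes f: "f \<in> L2 \<mu>" and G: "G \<in> L2 S2xS2_measure"
    and Gf: "AE z in S2xS2_measure. G z = radon \<nu> x0 f z"
    and i: "i \<in> idx k" and j: "j \<in> idx k"
  shows "l2_inner S2xS2_measure G (harmonic_product Y ((k, i), (k, j)))
    = of_real (4 * pi) * (\<integral>g. f g * T k j i g \<partial>\<mu>)"
proof -
  \<comment> \<open>The conjugations are arranged such that the product of \<open>\<alpha>\<close>
    and \<open>\<beta>\<close> is the conjugate of the harmonic product, as the inner product
    demands.\<close>
  define \<alpha> where "\<alpha> x = cnj (Y k i x)" for x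
  define \<beta> where "\<beta> y = Y k j y" for y
  let ?p = "complex_of_real (4 * pi)"
  have ab: "bounded_sphere \<alpha>" "bounded_sphere \<beta>"
    unfolding \<alpha>_def[abs_def] \<beta>_def[abs_def] using hp_bounded i j by auto
  define \<Phi> where "\<Phi> z = G z * (\<alpha> (fst z) * \<beta> (snd z))" for z
  have \<Phi>i: "integrable S2xS2_measure \<Phi>"
    using integrable_L2_mult[OF G hp_L2[OF i j]]
    by (simp add: \<Phi>_def[abs_def] \<alpha>_def \<beta>_def harmonic_product_def split_beta')
  have \<Phi>m: "\<Phi> \<in> borel_measurable S2xS2_measure" using \<Phi>i by (rule borel_measurable_integrable)
  have inner_m: "(\<lambda>x. \<integral>y. \<Phi> (x, y) \<partial>sphere_measure) \<in> borel_measurable sphere_measure"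
    using \<Phi>m by (intro sphere.borel_measurable_lebesgue_integral) (simp add: split_beta')
  have orb2: "(\<lambda>p. (fst p *v x0, snd p *v x0)) \<in> \<mu> \<Otimes>\<^sub>M \<mu> \<rightarrow>\<^sub>M S2xS2_measure"
    by (intro measurable_Pair measurable_compose[OF measurable_fst measurable_orbit[OF x0]]
        measurable_compose[OF measurable_snd measurable_orbit[OF x0]])
  have "l2_inner S2xS2_measure G (harmonic_product Y ((k, i), (k, j))) = (\<integral>z. \<Phi> z \<partial>S2xS2_measure)"
    by (simp add: l2_inner_def \<Phi>_def \<alpha>_def \<beta>_def harmonic_product_def split_beta')
  also have "\<dots> = (\<integral>x. (\<integral>y. \<Phi> (x, y) \<partial>sphere_measure) \<partial>sphere_measure)"
    by (rule sphere_pair.integral_fst'[OF \<Phi>i, symmetric])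
  also have "\<dots> = ?p * (\<integral>a. (\<integral>y. \<Phi> (a *v x0, y) \<partial>sphere_measure) \<partial>\<mu>)"
    by (rule integral_sphere_eq_haar[OF x0 inner_m])
  also have "\<dots> = ?p * (\<integral>a. ?p * (\<integral>b. \<Phi> (a *v x0, b *v x0) \<partial>\<mu>) \<partial>\<mu>)"
  proof -
    have "(\<integral>y. \<Phi> (a *v x0, y) \<partial>sphere_measure) = ?p * (\<integral>b. \<Phi> (a *v x0, b *v x0) \<partial>\<mu>)" if "a \<in> SO3" for a
    proof (rule integral_sphere_eq_haar[OF x0])
      show "(\<lambda>y. \<Phi> (a *v x0, y)) \<in> borel_measurable sphere_measure"
        by (rule measurable_Pair2[OF \<Phi>m]) (use that x0 in simp)
    qed
    then have "(\<integral>a. (\<integral>y. \<Phi> (a *v x0, y) \<partial>sphere_measure) \<partial>\<mu>) = (\<integral>a. ?p * (\<integral>b. \<Phi> (a *v x0, b *v x0) \<partial>\<mu>) \<partial>\<mu>)"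
      by (intro Bochner_Integration.integral_cong) auto
    then show ?thesis by simp
  qed
  also have "\<dots> = ?p * ?p * (\<integral>a. (\<integral>b. \<Phi> (a *v x0, b *v x0) \<partial>\<mu>) \<partial>\<mu>)" by simp
  also have "(\<integral>a. (\<integral>b. \<Phi> (a *v x0, b *v x0) \<partial>\<mu>) \<partial>\<mu>)
      = (\<integral>a. (\<integral>b. (\<integral>h. f (a ** h ** matrix_inv b) \<partial>\<nu>) * (\<alpha> (a *v x0) * \<beta> (b *v x0)) \<partial>\<mu>) \<partial>\<mu>)"
  proof -
    have fm: "f \<in> borel_measurable \<mu>" by (rule L2_measurable[OF f])
    have \<alpha>m: "(\<lambda>p. \<alpha> (fst p *v x0)) \<in> borel_measurable (\<mu> \<Otimes>\<^sub>M \<mu>)"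
      by (intro measurable_compose[OF _ bounded_sphere_measurable[OF ab(1)]]
          measurable_compose[OF measurable_fst measurable_orbit[OF x0]])
    have \<beta>m: "(\<lambda>p. \<beta> (snd p *v x0)) \<in> borel_measurable (\<mu> \<Otimes>\<^sub>M \<mu>)"
      by (intro measurable_compose[OF _ bounded_sphere_measurable[OF ab(2)]]
          measurable_compose[OF measurable_snd measurable_orbit[OF x0]])
    have m3: "(\<lambda>((a, b), h). f (a ** h ** matrix_inv b)) \<in> borel_measurable ((\<mu> \<Otimes>\<^sub>M \<mu>) \<Otimes>\<^sub>M \<nu>)"
      unfolding split_beta by (intro measurable_compose[OF _ fm] measurable_twist) auto
    have "(\<lambda>p. (\<integral>h. f (fst p ** h ** matrix_inv (snd p)) \<partial>\<nu>)) \<in> borel_measurable (\<mu> \<Otimes>\<^sub>M \<mu>)"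
      using m3 by (intro N.borel_measurable_lebesgue_integral) (simp add: split_beta')
    then have RHm: "(\<lambda>p. (\<integral>h. f (fst p ** h ** matrix_inv (snd p)) \<partial>\<nu>) * (\<alpha> (fst p *v x0) * \<beta> (snd p *v x0)))
        \<in> borel_measurable (\<mu> \<Otimes>\<^sub>M \<mu>)"
      by (intro borel_measurable_times \<alpha>m \<beta>m)
    have \<Phi>m2: "(\<lambda>p. \<Phi> (fst p *v x0, snd p *v x0)) \<in> borel_measurable (\<mu> \<Otimes>\<^sub>M \<mu>)"
      by (rule measurable_compose[OF orb2 \<Phi>m])
    \<comment> \<open>The exceptional null set of the product is split into iterated form before
      each variable is pulled back to the group.\<close>
    have "AE x in sphere_measure. AE y in sphere_measure. G (x, y) = radon \<nu> x0 f (x, y)"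
      using sphere_pair.AE_pair[OF Gf] .
    then have ae: "AE a in \<mu>. AE y in sphere_measure. G (a *v x0, y) = radon \<nu> x0 f (a *v x0, y)"
      by (rule AE_sphere_haar[OF x0])
    show ?thesis
    proof (rule integral_cong_AE)
      show "(\<lambda>a. \<integral>b. \<Phi> (a *v x0, b *v x0) \<partial>\<mu>) \<in> borel_measurable \<mu>"
        using \<Phi>m2 by (intro borel_measurable_lebesgue_integral) (simp add: split_beta')
      show "(\<lambda>a. \<integral>b. (\<integral>h. f (a ** h ** matrix_inv b) \<partial>\<nu>) * (\<alpha> (a *v x0) * \<beta> (b *v x0)) \<partial>\<mu>) \<in> borel_measurable \<mu>"
        using RHm by (intro borel_measurable_lebesgue_integral) (simp add: split_beta')
      show "AE a in \<mu>. (\<integral>b. \<Phi> (a *v x0, b *v x0) \<partial>\<mu>)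
          = (\<integral>b. (\<integral>h. f (a ** h ** matrix_inv b) \<partial>\<nu>) * (\<alpha> (a *v x0) * \<beta> (b *v x0)) \<partial>\<mu>)"
        using ae AE_space[of \<mu>]
      proof eventually_elim
        case (elim a)
        then have a: "a \<in> SO3" by simp
        have "AE b in \<mu>. G (a *v x0, b *v x0) = radon \<nu> x0 f (a *v x0, b *v x0)"
          by (rule AE_sphere_haar[OF x0 elim(1)])
        then have "AE b in \<mu>. \<Phi> (a *v x0, b *v x0)
            = (\<integral>h. f (a ** h ** matrix_inv b) \<partial>\<nu>) * (\<alpha> (a *v x0) * \<beta> (b *v x0))"
          using AE_space[of \<mu>] by eventually_elim (simp add: \<Phi>_def radon_orbit[OF fm a])
        moreover have "(\<lambda>b. \<Phi> (a *v x0, b *v x0)) \<in> borel_measurable \<mu>"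
          using measurable_Pair2[OF \<Phi>m2, of a] a by simp
        moreover have "(\<lambda>b. (\<integral>h. f (a ** h ** matrix_inv b) \<partial>\<nu>) * (\<alpha> (a *v x0) * \<beta> (b *v x0))) \<in> borel_measurable \<mu>"
          using measurable_Pair2[OF RHm, of a] a by simp
        ultimately show ?case by (intro integral_cong_AE)
      qed
    qed
  qed
  also have "\<dots> = (\<integral>a. f a * (\<integral>b. \<alpha> (a *v (b *v x0)) * \<beta> (b *v x0) \<partial>\<mu>) \<partial>\<mu>)"
    by (rule radon_dual_group[OF f ab])
  also have "?p * ?p * \<dots> = ?p * (\<integral>a. f a * (?p * (\<integral>b. \<alpha> (a *v (b *v x0)) * \<beta> (b *v x0) \<partial>\<mu>)) \<partial>\<mu>)"
    unfolding mult.left_commute[of "f _" ?p] by simp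
  also have "(\<integral>a. f a * (?p * (\<integral>b. \<alpha> (a *v (b *v x0)) * \<beta> (b *v x0) \<partial>\<mu>)) \<partial>\<mu>) = (\<integral>a. f a * T k j i a \<partial>\<mu>)"
  proof (rule Bochner_Integration.integral_cong[OF refl])
    fix a assume "a \<in> space \<mu>"
    then have a: "a \<in> SO3" by simp
    have m: "(\<lambda>y. \<alpha> (a *v y) * \<beta> y) \<in> borel_measurable sphere_measure"
      by (intro bounded_sphere_measurable bounded_sphere_mult bounded_sphere_rotate ab a)
    have "?p * (\<integral>b. \<alpha> (a *v (b *v x0)) * \<beta> (b *v x0) \<partial>\<mu>) = (\<integral>y. \<alpha> (a *v y) * \<beta> y \<partial>sphere_measure)"
      by (rule integral_sphere_eq_haar[OF x0 m, symmetric])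
    also have "\<dots> = sinner (Y k j) (\<lambda>y. Y k i (a *v y))"
      by (simp add: l2_inner_def \<alpha>_def \<beta>_def mult.commute)
    \<comment> \<open>The rotation \<open>a\<close> passes to the other argument as its inverse,
      which is why the indices appear in the order \<open>j\<close>, \<open>i\<close>.\<close>
    also have "\<dots> = T k j i a"
      using sinner_rotate_left[OF Y_bounded[OF j] Y_bounded[OF i] SO3_inv[OF a]] a
      by (simp add: wigner_matcoef matcoef_def)
    finally show "f a * (?p * (\<integral>b. \<alpha> (a *v (b *v x0)) * \<beta> (b *v x0) \<partial>\<mu>)) = f a * T k j i a" by simp
  qed
  finally show ?thesis .
qed

end

section \<open>Partial sums of the series and their convergence\<close>

context wigner_setting
begin

lemma proj_sum:
  "proj n f g = (\<Sum>k<n. \<Sum>i\<in>idx k. \<Sum>j\<in>idx k. of_nat (2 * k + 1) * l2_inner \<mu> f (T k i j) * T k i j g)"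
  unfolding proj_def sum_W by (simp add: dim_def mult_ac)

lemma sobolev_term_diff_proj:
  assumes f: "f \<in> L2 \<mu>" and S: "\<And>g. g \<in> SO3 \<Longrightarrow> S g = proj n f g" and a: "a \<in> wigner_index"
  shows "sobolev_term \<mu> SO3_laplacian 4 t e (\<lambda>g. f g - S g) a
    = (if a \<in> W n then 0 else sobolev_term \<mu> SO3_laplacian 4 t e f a)"
proof -
  obtain k i j where kij: "a = (k, i, j)" "i \<in> idx k" "j \<in> idx k" using a by (auto simp: wigner_index_idx)
  have aW: "a \<in> W (Suc k)" using kij by (simp add: W_def)
  have "l2_inner \<mu> (\<lambda>g. f g - S g) (e a) = l2_inner \<mu> (\<lambda>g. f g - proj n f g) (e a)"
    unfolding l2_inner_def using S by (intro Bochner_Integration.integral_cong) auto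
  also have "\<dots> = l2_inner \<mu> f (e a) - l2_inner \<mu> (proj n f) (e a)"
    by (rule l2_inner_diff_left[OF f proj_L2 e_L2[OF aW]])
  also have "\<dots> = (if a \<in> W n then 0 else l2_inner \<mu> f (e a))"
    by (simp add: proj_coeff[OF aW])
  finally have "l2_inner \<mu> (\<lambda>g. f g - S g) (T k i j) = (if a \<in> W n then 0 else l2_inner \<mu> f (T k i j))"
    by (simp add: kij)
  then show ?thesis unfolding kij(1) sobolev_term_T[OF kij(2,3)] by (simp add: kij(1))
qed

text \<open>Reduces convergence to the identification of the partial sums with \<open>proj\<close>:
  L2 convergence is \<open>peter_weyl\<close>, and the Sobolev norm of the remainder is the tail of
  a convergent sum.\<close>

lemma H_SO3_sums_proj:
  assumes f: "f \<in> H_SO3 \<mu> Y t" and F: "\<And>n g. g \<in> SO3 \<Longrightarrow> (\<Sum>k<n. F k g) = proj n f g"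
  shows "H_SO3_sums \<mu> Y t F f"
proof -
  have fL2: "f \<in> L2 \<mu>" and sf: "sobolev_term \<mu> SO3_laplacian 4 t e f summable_on wigner_index"
    using f by (auto simp: H_SO3_def sobolev_space_def)
  have "(\<lambda>n. sqrt (\<integral>g. (cmod (f g - proj n f g))\<^sup>2 \<partial>\<mu>)) \<longlonglongrightarrow> sqrt 0"
    by (intro tendsto_real_sqrt peter_weyl fL2)
  moreover have "l2_norm \<mu> (\<lambda>g. f g - (\<Sum>k<n. F k g)) = sqrt (\<integral>g. (cmod (f g - proj n f g))\<^sup>2 \<partial>\<mu>)" for n
    unfolding l2_norm_def using F
    by (intro arg_cong[of _ _ sqrt] Bochner_Integration.integral_cong) auto
  ultimately have 1: "norm_sums (l2_norm \<mu>) F f" by (simp add: norm_sums_def)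
  have "(\<lambda>n. sqrt (\<Sum>\<^sub>\<infinity>a\<in>wigner_index. if a \<in> W n then 0 else sobolev_term \<mu> SO3_laplacian 4 t e f a)) \<longlonglongrightarrow> sqrt 0"
    by (intro tendsto_real_sqrt infsum_tail_tendsto_0 sf) (auto simp: wigner_index_W dest: W_mono)
  moreover have "H_SO3_norm \<mu> Y t (\<lambda>g. f g - (\<Sum>k<n. F k g))
      = sqrt (\<Sum>\<^sub>\<infinity>a\<in>wigner_index. if a \<in> W n then 0 else sobolev_term \<mu> SO3_laplacian 4 t e f a)" for n
    unfolding H_SO3_norm_def sobolev_norm_def
    by (intro arg_cong[of _ _ sqrt] infsum_cong sobolev_term_diff_proj[OF fL2 F])
  ultimately have 2: "norm_sums (H_SO3_norm \<mu> Y t) F f" by (simp add: norm_sums_def)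
  from 1 2 show ?thesis by (simp add: H_SO3_sums_def)
qed

text \<open>From \<open>n = Suc k\<close> on, the coefficient of the remainder at the given index no
  longer depends on \<open>n\<close>. Bessel's inequality bounds it by the norm of the remainder,
  which tends to 0.\<close>

lemma harmonic_series_coefficient:
  assumes G: "G \<in> L2 S2xS2_measure"
    and sums: "norm_sums (l2_norm S2xS2_measure)
      (\<lambda>k (x, y). \<Sum>i\<in>idx k. \<Sum>j\<in>idx k. Ghat k i j * Y k i x * cnj (Y k j y)) G"
    and i: "i \<in> idx k" and j: "j \<in> idx k"
  shows "Ghat k i j = l2_inner S2xS2_measure G (harmonic_product Y ((k, i), (k, j)))"
proof -
  define hp where "hp = (\<lambda>(k, i, j). harmonic_product Y ((k, i), (k, j)))"
  define gh where "gh = (\<lambda>(k, i, j). Ghat k i j)"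
  define S where "S n z = (\<Sum>a\<in>W n. gh a * hp a z)" for n z
  have hpL2: "hp a \<in> L2 S2xS2_measure" if "a \<in> W n" for a n
    using that by (auto simp: hp_def W_def intro: hp_L2)
  have SL2: "S n \<in> L2 S2xS2_measure" for n
    unfolding S_def[abs_def] by (intro L2_sum hpL2)
  let ?a = "(k, i, j)"
  have aW: "?a \<in> W (Suc k)" using i j by (simp add: W_def)
  have S_eq: "(\<Sum>k<n. (case z of (x, y) \<Rightarrow> \<Sum>i\<in>idx k. \<Sum>j\<in>idx k. Ghat k i j * Y k i x * cnj (Y k j y))) = S n z" for n z
    by (cases z) (simp add: S_def sum_W gh_def hp_def harmonic_product_def mult.assoc)
  have lim: "(\<lambda>n. (l2_norm S2xS2_measure (\<lambda>z. G z - S n z))\<^sup>2) \<longlonglongrightarrow> 0\<^sup>2"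
    using sums unfolding norm_sums_def S_eq by (intro tendsto_power)
  let ?c = "(cmod (l2_inner S2xS2_measure G (hp ?a) - Ghat k i j))\<^sup>2"
  have "?c \<le> (l2_norm S2xS2_measure (\<lambda>z. G z - S n z))\<^sup>2" if n: "n \<ge> Suc k" for n
  proof -
    have "l2_inner S2xS2_measure (S n) (hp ?a) = (\<Sum>b\<in>W n. gh b * l2_inner S2xS2_measure (hp b) (hp ?a))"
      unfolding S_def[abs_def] by (rule l2_inner_sum_left[OF hpL2 hpL2[OF aW]])
    also have "\<dots> = (\<Sum>b\<in>W n. if b = ?a then gh b else 0)"
      by (rule sum.cong[OF refl]) (auto simp: hp_def W_def hp_inner i j split: if_splits)
    also have "\<dots> = Ghat k i j" using aW W_mono[OF n] by (auto simp: gh_def)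
    finally have "l2_inner S2xS2_measure (\<lambda>z. G z - S n z) (hp ?a) = l2_inner S2xS2_measure G (hp ?a) - Ghat k i j"
      using l2_inner_diff_left[OF G SL2 hpL2[OF aW], of n] by simp
    moreover have "l2_inner S2xS2_measure (hp ?a) (hp ?a) = 1" using i j by (simp add: hp_def hp_inner)
    ultimately have "?c \<le> (\<integral>z. (cmod (G z - S n z))\<^sup>2 \<partial>S2xS2_measure)"
      using bessel_single[OF L2_diff[OF G SL2] hpL2[OF aW], of n] by simp
    then show ?thesis by (simp add: l2_norm_def)
  qed
  then have "?c \<le> 0\<^sup>2" by (intro LIMSEQ_le_const[OF lim] exI[of _ "Suc k"]) auto
  then show ?thesis by (simp add: hp_def)
qed

text \<open>The factor 4 pi cancels, and inverting \<open>g\<close> transposes and conjugates the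
  Wigner matrix. The result is the expansion in conjugates, which \<open>projection_cnj\<close>
  identifies with the Fourier partial sum.\<close>

lemma inversion_partial_sums:
  assumes f: "f \<in> L2 \<mu>" and g: "g \<in> SO3"
    and Ghat: "\<And>k i j. i \<in> idx k \<Longrightarrow> j \<in> idx k \<Longrightarrow> Ghat k i j = of_real (4 * pi) * (\<integral>g. f g * T k j i g \<partial>\<mu>)"
  shows "(\<Sum>k<n. \<Sum>i\<in>idx k. \<Sum>j\<in>idx k.
      of_real ((2 * real k + 1) / (4 * pi)) * Ghat k i j * T k i j (matrix_inv g)) = proj n f g"
  unfolding proj_sum
proof (rule sum.cong[OF refl])
  fix k
  let ?c = "complex_of_nat (2 * k + 1)"
  have "(\<Sum>i\<in>idx k. \<Sum>j\<in>idx k. of_real ((2 * real k + 1) / (4 * pi)) * Ghat k i j * T k i j (matrix_inv g))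
      = (\<Sum>i\<in>idx k. \<Sum>j\<in>idx k. ?c * ((\<integral>g. f g * T k j i g \<partial>\<mu>) * cnj (T k j i g)))"
    by (intro sum.cong refl) (simp add: Ghat T_inv g)
  also have "\<dots> = ?c * (\<Sum>i\<in>idx k. \<Sum>j\<in>idx k. (\<integral>g. f g * T k i j g \<partial>\<mu>) * cnj (T k i j g))"
    unfolding sum_distrib_left[symmetric] by (subst sum.swap) (rule refl)
  also have "\<dots> = (\<Sum>i\<in>idx k. \<Sum>j\<in>idx k. ?c * l2_inner \<mu> f (T k i j) * T k i j g)"
    unfolding projection_cnj[OF f g] by (simp add: l2_inner_def sum_distrib_left mult.assoc)
  finally show "(\<Sum>i\<in>idx k. \<Sum>j\<in>idx k. of_real ((2 * real k + 1) / (4 * pi)) * Ghat k i j * T k i j (matrix_inv g))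
      = (\<Sum>i\<in>idx k. \<Sum>j\<in>idx k. ?c * l2_inner \<mu> f (T k i j) * T k i j g)" .
qed

lemma fourier_partial_sums:
  "(\<Sum>k<n. \<Sum>i\<in>idx k. \<Sum>j\<in>idx k. of_real (2 * real k + 1) * fourier_coeff \<mu> Y f k i j * T k j i g) = proj n f g"
  unfolding proj_sum
proof (rule sum.cong[OF refl])
  fix k
  show "(\<Sum>i\<in>idx k. \<Sum>j\<in>idx k. of_real (2 * real k + 1) * fourier_coeff \<mu> Y f k i j * T k j i g)
      = (\<Sum>i\<in>idx k. \<Sum>j\<in>idx k. of_nat (2 * k + 1) * l2_inner \<mu> f (T k i j) * T k i j g)"
    by (subst sum.swap) (simp add: fourier_coeff_def l2_inner_def add.commute)
qed

end

section \<open>Sobolev regularity of the pre-image\<close>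

context radon_setting
begin

text \<open>The terms of \<open>G\<close> at equal degrees form a summable subfamily, which is
  compared with the terms of \<open>f\<close> by means of the common weight.\<close>

lemma radon_sobolev:
  assumes f: "f \<in> L2 \<mu>" and Gf: "AE z in S2xS2_measure. G z = radon \<nu> x0 f z"
    and G: "G \<in> H_S2xS2 Y (1/2 + t)"
  shows "f \<in> H_SO3 \<mu> Y t"
proof -
  have GL2: "G \<in> L2 S2xS2_measure"
    and Gs: "sobolev_term S2xS2_measure S2xS2_laplacian 2 (1/2 + t) (harmonic_product Y) G summable_on harmonic_product_index"
    using G by (auto simp: H_S2xS2_def sobolev_space_def)
  let ?s = "sobolev_term S2xS2_measure S2xS2_laplacian 2 (1/2 + t) (harmonic_product Y) G"
  let ?r = "sobolev_term \<mu> SO3_laplacian 4 t e f"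
  let ?P = "\<lambda>(k, i, j). ((k, i), (k, j)) :: (nat \<times> nat) \<times> (nat \<times> nat)"
  let ?d = "\<lambda>k. real (2 * k + 1) powr (1 + 2 * t)"
  have nonneg: "?s n \<ge> 0" "?r a \<ge> 0" for n a by (simp_all add: sobolev_term_def)
  have inj: "inj_on ?P wigner_index" by (auto simp: inj_on_def)
  have sub: "?P ` wigner_index \<subseteq> harmonic_product_index"
    by (auto simp: wigner_index_def harmonic_product_index_def)
  have "?s summable_on ?P ` wigner_index" by (rule summable_on_subset_banach[OF Gs sub])
  then have sP: "(?s \<circ> ?P) summable_on wigner_index" using summable_on_reindex[OF inj] by blast
  \<comment> \<open>The coefficients of \<open>G\<close> are integrals of \<open>f\<close> against
    unconjugated Wigner polynomials, so the comparison holds only after summing over all indices of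
    a degree (\<open>coeff_norm_cnj\<close>).\<close>
  have block: "(\<Sum>a\<in>W n. (?s \<circ> ?P) a) = (4 * pi)\<^sup>2 * (\<Sum>a\<in>W n. ?r a)" for n
  proof -
    have "(\<Sum>a\<in>W n. (?s \<circ> ?P) a)
        = (\<Sum>k<n. \<Sum>i\<in>idx k. \<Sum>j\<in>idx k. ?d k * ((4 * pi)\<^sup>2 * (cmod (\<integral>g. f g * T k j i g \<partial>\<mu>))\<^sup>2))"
      unfolding sum_W
      by (intro sum.cong refl)
         (simp add: sobolev_term_hp radon_coefficient[OF f GL2 Gf] norm_mult power_mult_distrib del: of_nat_Suc of_nat_add of_nat_mult)
    also have "\<dots> = (4 * pi)\<^sup>2 * (\<Sum>k<n. ?d k * (\<Sum>j\<in>idx k. \<Sum>i\<in>idx k. (cmod (\<integral>g. f g * T k i j g \<partial>\<mu>))\<^sup>2))"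
      by (simp add: sum_distrib_left mult.left_commute[of "(4 * pi)\<^sup>2"] power_mult_distrib mult_ac)
    also have "\<dots> = (4 * pi)\<^sup>2 * (\<Sum>k<n. ?d k * (\<Sum>i\<in>idx k. \<Sum>j\<in>idx k. (cmod (\<integral>g. f g * T k i j g \<partial>\<mu>))\<^sup>2))"
      by (subst sum.swap) simp
    also have "\<dots> = (4 * pi)\<^sup>2 * (\<Sum>k<n. ?d k * (\<Sum>i\<in>idx k. \<Sum>j\<in>idx k. (cmod (l2_inner \<mu> f (T k i j)))\<^sup>2))"
      unfolding coeff_norm_cnj[OF f] l2_inner_def ..
    also have "\<dots> = (4 * pi)\<^sup>2 * (\<Sum>a\<in>W n. ?r a)"
      unfolding sum_W by (simp add: sobolev_term_T sum_distrib_left cong: sum.cong)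
    finally show ?thesis .
  qed
  have "?r summable_on wigner_index"
  proof (rule nonneg_bdd_above_summable_on)
    show "bdd_above (sum ?r ` {F. F \<subseteq> wigner_index \<and> finite F})"
    proof (rule bdd_aboveI2)
      fix X assume "X \<in> {F. F \<subseteq> wigner_index \<and> finite F}"
      then have X: "finite X" "X \<subseteq> wigner_index" by auto
      \<comment> \<open>An arbitrary finite set is enlarged to complete degrees, where
        \<open>block\<close> applies.\<close>
      obtain n where n: "X \<subseteq> W n"
        using finite_subset_mono_UN[of X W] X W_mono unfolding wigner_index_W by blast
      have "sum ?r X \<le> sum ?r (W n)" by (rule sum_mono2[OF finite_W n]) (rule nonneg)
      also have "\<dots> = (\<Sum>a\<in>W n. (?s \<circ> ?P) a) / (4 * pi)\<^sup>2" unfolding block by simp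
      also have "\<dots> \<le> infsum (?s \<circ> ?P) wigner_index / (4 * pi)\<^sup>2"
        using finite_sum_le_infsum[OF sP finite_W, of n] nonneg
        by (intro divide_right_mono) (auto simp: wigner_index_W)
      finally show "sum ?r X \<le> infsum (?s \<circ> ?P) wigner_index / (4 * pi)\<^sup>2" .
    qed
  qed (rule nonneg)
  then show ?thesis using f by (simp add: H_SO3_def sobolev_space_def)
qed

end

theorem theorem5p4:
  fixes x0 :: "real^3"
    and \<mu> \<nu> :: "(real^3^3) measure"
    and Y :: "nat \<Rightarrow> nat \<Rightarrow> real^3 \<Rightarrow> complex"
    and f :: "real^3^3 \<Rightarrow> complex"
    and G :: "(real^3) \<times> (real^3) \<Rightarrow> complex"
    and Ghat :: "nat \<Rightarrow> nat \<Rightarrow> nat \<Rightarrow> complex"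
    and t :: real
  assumes "x0 \<in> sphere 0 1"
    and "haar_measure SO3 \<mu>"
    and "haar_measure (stabilizer x0) \<nu>"
    and "harmonic_basis Y"
    and "t \<ge> 0"
    and "f \<in> L2 \<mu>"
    and "AE z in S2xS2_measure. G z = radon \<nu> x0 f z"
    and "norm_sums (l2_norm S2xS2_measure)
           (\<lambda>k (x, y). \<Sum>i=1..2*k+1. \<Sum>j=1..2*k+1. Ghat k i j * Y k i x * cnj (Y k j y)) G"
    and "G \<in> H_Delta_S2xS2 Y (1/2 + t)"
  shows "f \<in> H_SO3 \<mu> Y t
    \<and> H_SO3_sums \<mu> Y t
        (\<lambda>k g. \<Sum>i=1..2*k+1. \<Sum>j=1..2*k+1.
           of_real ((2 * real k + 1) / (4 * pi)) * Ghat k i j * wigner Y k i j (matrix_inv g)) f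
    \<and> H_SO3_sums \<mu> Y t
        (\<lambda>k g. \<Sum>i=1..2*k+1. \<Sum>j=1..2*k+1.
           of_real (2 * real k + 1) * fourier_coeff \<mu> Y f k i j * wigner Y k j i g) f
    \<and> H_SO3_sums \<mu> Y t
        (\<lambda>k g. of_real (2 * real k + 1) *
           nmat_trace (2*k+1) (nmat_mult (2*k+1)
             (\<lambda>i j. fourier_coeff \<mu> Y f k i j) (\<lambda>i j. wigner Y k i j g))) f"
proof -
  interpret radon_setting Y \<mu> x0 \<nu>
    by unfold_locales (rule assms)+
  have G: "G \<in> H_S2xS2 Y (1/2 + t)" using assms(9) by (simp add: H_Delta_S2xS2_def)
  then have GL2: "G \<in> L2 S2xS2_measure" by (simp add: H_S2xS2_def sobolev_space_def)
  have fH: "f \<in> H_SO3 \<mu> Y t" by (rule radon_sobolev[OF assms(6,7) G])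
  have Ghat: "Ghat k i j = of_real (4 * pi) * (\<integral>g. f g * wigner Y k j i g \<partial>\<mu>)"
    if "i \<in> idx k" "j \<in> idx k" for k i j
    using harmonic_series_coefficient[OF GL2 assms(8)[folded idx_def] that]
      radon_coefficient[OF assms(6) GL2 assms(7) that] by simp
  \<comment> \<open>Writing out the trace of the matrix product gives the second series, so both
    share the partial sums \<open>fourier_partial_sums\<close>.\<close>
  have trace: "of_real (2 * real k + 1) * nmat_trace (2*k+1) (nmat_mult (2*k+1)
        (\<lambda>i j. fourier_coeff \<mu> Y f k i j) (\<lambda>i j. wigner Y k i j g))
      = (\<Sum>i\<in>idx k. \<Sum>j\<in>idx k. of_real (2 * real k + 1) * fourier_coeff \<mu> Y f k i j * wigner Y k j i g)" for k g
    unfolding nmat_trace_def nmat_mult_def idx_def[symmetric] by (simp only: sum_distrib_left mult.assoc)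
  show ?thesis
    unfolding trace unfolding idx_def[symmetric]
    by (intro conjI fH H_SO3_sums_proj[OF fH] inversion_partial_sums[OF assms(6) _ Ghat] fourier_partial_sums)
qed

end
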